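(* Let $k>0$, and let $\{(\eta(a;k),c(a;k))\}$, $|a|\ll 1$, be the one-parameter family of even, smooth, $2\pi$-periodic profiles and wave speeds described in the context, so that $u(t,x)=\eta(a;k)\big(k(x-c(a;k)t)\big)$ is a $2\pi/k$-periodic traveling wave of $$(c^{2}-2u)u_{xx}-(u_x)^{2}+u-2c\,u_{tx}=0,\qquad c=c(a;k).$$ Then sufficiently small waves of this family are modulationally stable; that is, there exists $a_0>0$ (depending on $k$) such that for every $a$ with $0<|a|<a_0$ the wave $\eta(a;k)$ is modulationally stable.
   Context: $\mathbb{T}=\mathbb{R}/2\pi\mathbb{Z}$; $L^2(\mathbb{T})$ and $H^2(\mathbb{T})$ are the usual spaces of complex-valued $2\pi$-periodic functions. The family of waves: for each $k>0$ there is a family, defined for $a\in\mathbb{R}$ with $|a|$ sufficiently small and depending analytically on $a$ and $k$, of $2\pi$-periodic, even, smooth functions $\eta=\eta(a;k)(z)$ and numbers $c=c(a;k)>0$, with $c$ even in $a$, solving $$(3c^{2}-2\eta)k^{2}\eta''-k^{2}(\eta')^{2}+\eta=0,$$ with, as $a\to0$, $$\eta(a;k)(z)=a\cos z+a^{2}\Big(-\tfrac{k^2}{2}+\tfrac{k^2}{2}\cos 2z\Big)+\tfrac{7k^4}{16}a^{3}\cos 3z+O(a^4),\qquad c(a;k)=\tfrac{1}{\sqrt3\,k}+\tfrac{k^3}{4\sqrt3}a^2+O(a^4).$$ Bloch operators: for $\lambda\in\mathbb{C}$ and $\mu\in(-\frac12,\frac12]$ define the operator in $L^2(\mathbb{T})$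 with domain $H^2(\mathbb{T})$ $$\mathcal{T}^{\lambda}_{k,a,\mu}:=2\left(c\lambda-k^2\eta_z\right)(\partial_z+i\mu)+k^2(\partial_z+i\mu)^2\left(-3c^2+2\eta\right)-1,$$ where $\eta=\eta(a;k)$, $c=c(a;k)$, functions act as multiplication operators, and $(\partial_z+i\mu)^2(-3c^2+2\eta)$ means: first multiply by $-3c^2+2\eta$, then apply $(\partial_z+i\mu)^2$. (These arise by linearizing the equation about $\eta$ in the variable $z=k(x-ct)$, looking for perturbations $e^{\lambda t/k}\,\widetilde v(z)$, and using the Floquet–Bloch form $\widetilde v(z)=e^{i\mu z}V(z)$ with $V$ $2\pi$-periodic.) Definition (modulational stability): the wave $\eta(a;k)$ is modulationally stable if the operators $\mathcal{T}^{\lambda}_{k,a,\mu}$ are invertible on $L^2(\mathbb{T})$ for all $|(\lambda,\mu)|\ll1$ with $\operatorname{Re}(\lambda)\neq0$, i.e. there is $\delta>0$ such that $\mathcal{T}^{\lambda}_{k,a,\mu}:H^2(\mathbb{T})\to L^2(\mathbb{T})$ is invertible with bounded inverse whenever $|(\lambda,\mu)|<\delta$ and $\operatorname{Re}(\lambda)\ne0$. Otherwise it is modulationally unstable. *)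

theory Defs
  imports "HOL-Analysis.Analysis" "HOL-Library.Landau_Symbols"
begin

text \<open>
  A function on the circle of length \<open>2\<pi>\<close> is a \<open>2\<pi>\<close>-periodic function on the real line.
  An element of the Lebesgue space is represented by a Borel function; two functions represent
  the same element iff they agree almost everywhere with respect to \<open>lborel\<close>.
\<close>

definition smooth :: "(real \<Rightarrow> 'b::real_normed_vector) \<Rightarrow> bool" where
  "smooth f \<longleftrightarrow> (\<exists>D :: nat \<Rightarrow> real \<Rightarrow> 'b. D 0 = f \<and>
     (\<forall>n x. (D n has_vector_derivative D (Suc n) x) (at x)))"

definition L2T :: "(real \<Rightarrow> complex) set" where
  "L2T = {f. periodic_fun_simple f (2 * pi) \<and> f \<in> borel_measurable borel \<and>
             set_integrable lborel {0..2 * pi} (\<lambda>z. (cmod (f z))\<^sup>2)}"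

definition norm_L2T :: "(real \<Rightarrow> complex) \<Rightarrow> real" where
  "norm_L2T f = sqrt (LBINT z:{0..2 * pi}. (cmod (f z))\<^sup>2)"

definition has_weak_deriv :: "(real \<Rightarrow> complex) \<Rightarrow> (real \<Rightarrow> complex) \<Rightarrow> bool" where
  "has_weak_deriv f g \<longleftrightarrow>
     (\<forall>\<phi> :: real \<Rightarrow> complex. smooth \<phi> \<and> periodic_fun_simple \<phi> (2 * pi) \<longrightarrow>
        (LBINT z:{0..2 * pi}. f z * vector_derivative \<phi> (at z))
          = - (LBINT z:{0..2 * pi}. g z * \<phi> z))"

definition H2T :: "(real \<Rightarrow> complex) set" where
  "H2T = {f \<in> L2T. \<exists>g\<in>L2T. \<exists>h\<in>L2T. has_weak_deriv f g \<and> has_weak_deriv g h}"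

text \<open>
  The weak derivative is unique only up to equality almost everywhere; \<open>wderiv\<close> picks a
  representative. It is only meaningful for functions having a weak derivative in \<open>L2T\<close>.
\<close>

definition wderiv :: "(real \<Rightarrow> complex) \<Rightarrow> real \<Rightarrow> complex" where
  "wderiv f = (SOME g. g \<in> L2T \<and> has_weak_deriv f g)"

definition norm_H2T :: "(real \<Rightarrow> complex) \<Rightarrow> real" where
  "norm_H2T f = sqrt ((norm_L2T f)\<^sup>2 + (norm_L2T (wderiv f))\<^sup>2 + (norm_L2T (wderiv (wderiv f)))\<^sup>2)"

definition shifted_deriv :: "real \<Rightarrow> (real \<Rightarrow> complex) \<Rightarrow> real \<Rightarrow> complex" where
  "shifted_deriv \<mu> f = (\<lambda>z. wderiv f z + \<i> * of_real \<mu> * f z)"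

definition bloch_op ::
    "real \<Rightarrow> (real \<Rightarrow> real) \<Rightarrow> real \<Rightarrow> complex \<Rightarrow> real \<Rightarrow> (real \<Rightarrow> complex) \<Rightarrow> real \<Rightarrow> complex" where
  "bloch_op k \<eta> c \<Lambda> \<mu> V = (\<lambda>z.
       2 * (of_real c * \<Lambda> - of_real (k\<^sup>2 * deriv \<eta> z)) * shifted_deriv \<mu> V z
     + of_real (k\<^sup>2) *
         shifted_deriv \<mu> (shifted_deriv \<mu> (\<lambda>y. of_real (- 3 * c\<^sup>2 + 2 * \<eta> y) * V y)) z
     - V z)"

text \<open>
  \<open>S\<close> is a bounded two-sided inverse of \<open>T\<close>, all identities being identities of equivalence
  classes. For \<open>T\<close> linear up to null sets, \<open>S\<close> is then automatically linear and compatible with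
  equality almost everywhere.
\<close>

definition boundedly_invertible :: "((real \<Rightarrow> complex) \<Rightarrow> (real \<Rightarrow> complex)) \<Rightarrow> bool" where
  "boundedly_invertible T \<longleftrightarrow>
     (\<forall>V\<in>H2T. T V \<in> L2T) \<and>
     (\<exists>S C. (\<forall>f\<in>L2T. S f \<in> H2T \<and> (AE z in lborel. T (S f) z = f z)) \<and>
            (\<forall>V\<in>H2T. AE z in lborel. S (T V) z = V z) \<and>
            (\<forall>f\<in>L2T. norm_H2T (S f) \<le> C * norm_L2T f))"

definition modulationally_stable :: "real \<Rightarrow> (real \<Rightarrow> real) \<Rightarrow> real \<Rightarrow> bool" where
  "modulationally_stable k \<eta> c \<longleftrightarrow>
     (\<exists>\<delta>>0. \<forall>\<Lambda>::complex. \<forall>\<mu>\<in>{-1/2<..1/2}. norm (\<Lambda>, \<mu>) < \<delta> \<and> Re \<Lambda> \<noteq> 0 \<longrightarrow>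
        boundedly_invertible (bloch_op k \<eta> c \<Lambda> \<mu>))"

text \<open>
  Real-analytic dependence on \<open>(a, k)\<close> near \<open>(a\<^sub>0, k\<^sub>0)\<close> with values in the bounded functions of a
  further variable \<open>z\<close>, in the supremum norm: the geometric bound on the coefficients is uniform
  in \<open>z\<close>. This is the weakest of the usual choices of a target space for the profiles.
\<close>

definition analytic_family_at :: "(real \<Rightarrow> real \<Rightarrow> 'z \<Rightarrow> real) \<Rightarrow> real \<Rightarrow> real \<Rightarrow> bool" where
  "analytic_family_at F a\<^sub>0 k\<^sub>0 \<longleftrightarrow>
     (\<exists>r>0. \<exists>B. \<exists>e :: nat \<Rightarrow> nat \<Rightarrow> 'z \<Rightarrow> real.
        (\<forall>m n z. \<bar>e m n z\<bar> * r ^ (m + n) \<le> B) \<and>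
        (\<forall>a k z. \<bar>a - a\<^sub>0\<bar> < r \<and> \<bar>k - k\<^sub>0\<bar> < r \<longrightarrow>
           ((\<lambda>(m, n). e m n z * (a - a\<^sub>0) ^ m * (k - k\<^sub>0) ^ n) has_sum F a k z) UNIV))"

text \<open>
  The family lives on \<open>k > 0\<close>, \<open>\<bar>a\<bar> < A k\<close>, and is analytic on a neighbourhood of each such \<open>(a, k)\<close>;
  the values of the total functions \<open>\<eta>\<close> and \<open>c\<close> elsewhere are arbitrary.
  The remainder in the expansion of \<open>\<eta>\<close> is uniform in \<open>z\<close>.
\<close>

definition wave_family ::
    "(real \<Rightarrow> real \<Rightarrow> real \<Rightarrow> real) \<Rightarrow> (real \<Rightarrow> real \<Rightarrow> real) \<Rightarrow> bool" where
  "wave_family \<eta> c \<longleftrightarrow> (\<exists>A :: real \<Rightarrow> real. \<forall>k>0. A k > 0 \<and>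
     (\<forall>a. \<bar>a\<bar> < A k \<longrightarrow>
        smooth (\<eta> a k) \<and> periodic_fun_simple (\<eta> a k) (2 * pi) \<and>
        (\<forall>z. \<eta> a k (- z) = \<eta> a k z) \<and>
        c a k > 0 \<and> c (- a) k = c a k \<and>
        (\<forall>z. (3 * (c a k)\<^sup>2 - 2 * \<eta> a k z) * k\<^sup>2 * deriv (deriv (\<eta> a k)) z
              - k\<^sup>2 * (deriv (\<eta> a k) z)\<^sup>2 + \<eta> a k z = 0) \<and>
        analytic_family_at \<eta> a k \<and>
        analytic_family_at (\<lambda>a' k' (_::unit). c a' k') a k) \<and>
     (\<exists>M. \<forall>\<^sub>F a in at 0. \<forall>z.
        \<bar>\<eta> a k z - (a * cos z + a\<^sup>2 * (- k\<^sup>2 / 2 + k\<^sup>2 / 2 * cos (2 * z))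
                     + 7 * k ^ 4 / 16 * a ^ 3 * cos (3 * z))\<bar> \<le> M * \<bar>a\<bar> ^ 4) \<and>
     (\<lambda>a. c a k - (1 / (sqrt 3 * k) + k ^ 3 / (4 * sqrt 3) * a\<^sup>2)) \<in> O[at 0](\<lambda>a. a ^ 4))"

end

theory Submission
  imports Defs
begin

text \<open>
  Put \<open>p = 3 c\<^sup>2 - 2 \<eta>\<close>, \<open>g = c \<Lambda> / k\<^sup>2\<close> and \<open>V(z) = exp (g \<integral>\<^sub>0\<^sup>z 1/p - \<i> \<mu> z) u(z)\<close>. This removes both the
  Floquet parameter and the first order term from the Bloch operator:
  \<open>T V = 0\<close> becomes the self-adjoint Hill equation
  \<open>(p u')' + (p'' + 1/k\<^sup>2) u = g\<^sup>2 u / p\<close>, and periodicity of \<open>V\<close> becomes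
  \<open>u(z + 2 \<pi>) = exp (- x) u(z)\<close> with \<open>x = P g - 2 \<pi> \<i> \<mu>\<close> and \<open>P = \<integral> 1/p\<close> over a period. The Wronskian
  \<open>p (u v' - u' v)\<close> is constant, so the monodromy matrix has determinant 1. Hence the Bloch operator is
  invertible unless \<open>exp x + exp (- x) = \<Delta>(g\<^sup>2)\<close>, where the trace \<open>\<Delta>\<close> of the monodromy matrix is a power
  series with real coefficients.

  At \<open>g = 0\<close> two solutions are explicit: \<open>\<eta>'\<close> and \<open>\<psi> = \<eta> + \<eta>' \<integral>\<^sub>0\<^sup>z \<eta>/p\<close>, with Wronskian the energy
  \<open>w = p \<eta>'\<^sup>2 + \<eta>\<^sup>2/k\<^sup>2\<close>. The second is not periodic; it gains \<open>q0 \<eta>'\<close> over a period, where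
  \<open>q0 = \<integral> \<eta>/p\<close>. The profile equation says \<open>\<eta>/p = k\<^sup>2 (\<eta>'\<^sup>2/p - \<eta>'')\<close>, so \<open>q0 = k\<^sup>2 N\<close> with
  \<open>N = \<integral> \<eta>'\<^sup>2/p > 0\<close>. First order perturbation theory then gives
  \<open>\<Delta>(\<nu>) = 2 + s\<^sup>2 \<nu> + O(\<nu>\<^sup>2)\<close> with \<open>s\<^sup>2 = q0 N / w\<close>, that is \<open>s = k N / \<surd>w > 0\<close>. This sign is what
  makes the waves stable. Smallness of the wave enters through \<open>\<bar>\<eta>\<bar> \<le> m < c\<^sup>2\<close>, which gives \<open>s < P\<close>.

  A resonance therefore satisfies \<open>2 sinh (x/2) = \<plusminus> g \<rho>(g)\<close> with \<open>\<rho>(0) = s\<close> and \<open>\<rho>\<close> even and real. The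
  difference of the two sides has \<open>g\<close>-derivative close to \<open>P \<minusplus> s \<noteq> 0\<close>, so it is injective in \<open>g\<close>, and its zeros
  are invariant under \<open>g \<mapsto> - cnj g\<close>. Its zero is thus fixed by this reflection, so \<open>Re g = 0\<close>
  and \<open>Re \<Lambda> = 0\<close>: see \<open>resonance_imaginary\<close>.

  The passage from the Hill equation to operators on \<open>L2T\<close> rests on the correspondence between weak
  derivatives and absolutely continuous functions with periodic boundary values
  (\<open>has_weak_deriv_imp_primitive\<close>, \<open>has_weak_deriv_if_primitive\<close>); off resonance the bounded inverse is then
  written down by variation of constants (\<open>periodic_solution_exists\<close>).
\<close>

section \<open>Smooth functions\<close>

text \<open>A set of functions that contains a derivative of each of its members consists of smooth functions; this
  replaces formulas for the \<open>n\<close>-th derivative by closure properties.\<close>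

lemma smooth_coinduct:
  assumes "f \<in> S" and "\<And>g. g \<in> S \<Longrightarrow> \<exists>g'\<in>S. \<forall>x. (g has_vector_derivative g' x) (at x)"
  shows "smooth f"
proof -
  have "\<exists>D. \<forall>n::nat. (D n \<in> S \<and> (n = 0 \<longrightarrow> D n = f)) \<and>
          (\<forall>x. (D n has_vector_derivative D (Suc n) x) (at x))"
    by (rule dependent_nat_choice) (use assms in auto)
  then show ?thesis unfolding smooth_def by blast
qed

lemma smooth_derivE:
  assumes "smooth f"
  obtains f' where "smooth f'" "\<And>x. (f has_vector_derivative f' x) (at x)"
proof -
  obtain D where D: "D 0 = f" "\<And>n x. (D n has_vector_derivative D (Suc n) x) (at x)"
    using assms unfolding smooth_def by blast
  have "smooth (D 1)" unfolding smooth_def by (rule exI[of _ "\<lambda>n. D (Suc n)"]) (use D in auto)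
  then show ?thesis using that[of "D 1"] D(2)[of 0] D(1) by auto
qed

lemma smooth_vector_derivative:
  assumes "smooth f"
  shows "smooth (\<lambda>x. vector_derivative f (at x))"
    and "(f has_vector_derivative vector_derivative f (at x)) (at x)"
proof -
  obtain f' where f': "smooth f'" "\<And>x. (f has_vector_derivative f' x) (at x)"
    using smooth_derivE[OF assms] by blast
  then have "(\<lambda>x. vector_derivative f (at x)) = f'" by (auto intro: vector_derivative_at)
  with f' show "smooth (\<lambda>x. vector_derivative f (at x))"
    and "(f has_vector_derivative vector_derivative f (at x)) (at x)" by (auto dest: fun_cong)
qed

lemma smooth_imp_continuous:
  assumes "smooth f" shows "continuous_on A f"
  using smooth_vector_derivative(2)[OF assms] has_vector_derivative_continuous
  by (blast intro: continuous_at_imp_continuous_on)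

lemma smooth_const: "smooth (\<lambda>_. c)"
  by (rule smooth_coinduct[where S = "range (\<lambda>c _. c)"]) (auto intro!: exI[of _ 0])

lemma smooth_bounded_linear:
  assumes "bounded_linear h" "smooth f" shows "smooth (\<lambda>x. h (f x))"
proof (rule smooth_coinduct[where S = "{\<lambda>x. h (f x) | f. smooth f}"])
  fix g assume "g \<in> {\<lambda>x. h (f x) | f. smooth f}"
  then obtain f where f: "smooth f" "g = (\<lambda>x. h (f x))" by blast
  obtain f' where f': "smooth f'" "\<And>x. (f has_vector_derivative f' x) (at x)"
    using smooth_derivE[OF f(1)] by blast
  show "\<exists>g'\<in>{\<lambda>x. h (f x) | f. smooth f}. \<forall>x. (g has_vector_derivative g' x) (at x)"
    using f f' bounded_linear.has_vector_derivative[OF assms(1)] by fast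
qed (use assms in blast)

lemma smooth_add:
  assumes "smooth f" "smooth g" shows "smooth (\<lambda>x. f x + g x)"
proof -
  obtain D where D: "D 0 = f" "\<And>n x. (D n has_vector_derivative D (Suc n) x) (at x)"
    using assms(1) unfolding smooth_def by blast
  obtain E where E: "E 0 = g" "\<And>n x. (E n has_vector_derivative E (Suc n) x) (at x)"
    using assms(2) unfolding smooth_def by blast
  show ?thesis unfolding smooth_def
    by (rule exI[of _ "\<lambda>n x. D n x + E n x"]) (use D E in \<open>auto intro!: derivative_intros\<close>)
qed

text \<open>Sums of products of smooth functions are closed under differentiation, so the Leibniz
  formula for higher derivatives is not needed.\<close>

inductive_set product_sums :: "(real \<Rightarrow> 'b::real_normed_algebra) set" where
  prod: "smooth f \<Longrightarrow> smooth g \<Longrightarrow> (\<lambda>x. f x * g x) \<in> product_sums"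
| add: "u \<in> product_sums \<Longrightarrow> v \<in> product_sums \<Longrightarrow> (\<lambda>x. u x + v x) \<in> product_sums"

lemma smooth_mult:
  fixes f g :: "real \<Rightarrow> 'b::real_normed_algebra"
  assumes "smooth f" "smooth g" shows "smooth (\<lambda>x. f x * g x)"
proof (rule smooth_coinduct[where S = product_sums])
  show "(\<lambda>x. f x * g x) \<in> product_sums" using assms by (rule product_sums.prod)
  fix u :: "real \<Rightarrow> 'b" assume "u \<in> product_sums"
  then show "\<exists>u'\<in>product_sums. \<forall>x. (u has_vector_derivative u' x) (at x)"
  proof induction
    case (prod f g)
    obtain f' where f': "smooth f'" "\<And>x. (f has_vector_derivative f' x) (at x)"
      using smooth_derivE[OF prod(1)] by blast
    obtain g' where g': "smooth g'" "\<And>x. (g has_vector_derivative g' x) (at x)"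
      using smooth_derivE[OF prod(2)] by blast
    have "(\<lambda>x. f x * g' x + f' x * g x) \<in> product_sums"
      using prod f' g' by (intro product_sums.intros)
    then show ?case using f'(2) g'(2)
      by (intro bexI[of _ "\<lambda>x. f x * g' x + f' x * g x"]) (auto intro!: has_vector_derivative_mult)
  next
    case (add u v)
    then obtain u' v' where "u' \<in> product_sums" "v' \<in> product_sums"
      "\<And>x. (u has_vector_derivative u' x) (at x)" "\<And>x. (v has_vector_derivative v' x) (at x)" by blast
    then show ?case
      by (intro bexI[of _ "\<lambda>x. u' x + v' x"]) (auto intro!: product_sums.intros derivative_intros)
  qed
qed

lemma smooth_cos: "smooth (cos :: real \<Rightarrow> real)" and smooth_sin: "smooth (sin :: real \<Rightarrow> real)"
proof -
  have *: "((\<lambda>x. cos (x + d)) has_vector_derivative - sin (x + d)) (at x)"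
    "((\<lambda>x. sin (x + d)) has_vector_derivative cos (x + d)) (at x)" for x d :: real
    by (auto intro!: derivative_eq_intros simp: has_real_derivative_iff_has_vector_derivative[symmetric])
  have shift: "x + (1 + real n) * pi / 2 = (x + real n * pi / 2) + pi / 2" for x n
    by (simp add: field_simps)
  show "smooth (cos :: real \<Rightarrow> real)" unfolding smooth_def
    using *(1) by (intro exI[of _ "\<lambda>n x. cos (x + of_nat n * pi / 2)"])
      (auto simp: shift cos_add[of _ "pi/2"])
  show "smooth (sin :: real \<Rightarrow> real)" unfolding smooth_def
    using *(2) by (intro exI[of _ "\<lambda>n x. sin (x + of_nat n * pi / 2)"])
      (auto simp: shift sin_add[of _ "pi/2"])
qed

section \<open>Integrable functions orthogonal to all smooth periodic functions\<close>

text \<open>Stone--Weierstrass for those functions on the unit circle whose pullback along \<open>cis\<close> is smooth: they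
  form an algebra, and the two coordinate functions separate points. The pullbacks are periodic, so they
  are admissible test functions.\<close>

lemma continuous_circle_approx:
  fixes F :: "complex \<Rightarrow> real"
  assumes "continuous_on (sphere 0 1) F" "e > 0"
  obtains G where "smooth (\<lambda>z. G (cis z))" "\<And>z. \<bar>F (cis z) - G (cis z)\<bar> < e"
proof -
  let ?P = "\<lambda>G :: complex \<Rightarrow> real. continuous_on (sphere 0 1) G \<and> smooth (\<lambda>z. G (cis z))"
  have "\<exists>G. ?P G \<and> (\<forall>w\<in>sphere 0 1. \<bar>F w - G w\<bar> < e)"
  proof (rule Stone_Weierstrass_HOL)
    fix x y :: complex assume "x \<in> sphere 0 1 \<and> y \<in> sphere 0 1 \<and> x \<noteq> y"
    then have "Re x \<noteq> Re y \<or> Im x \<noteq> Im y" by (auto simp: complex_eq_iff)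
    moreover have "?P Re" "?P Im" using smooth_cos smooth_sin by (auto intro!: continuous_intros)
    ultimately show "\<exists>f. ?P f \<and> f x \<noteq> f y" by blast
  qed (use assms in \<open>auto intro!: continuous_intros smooth_const smooth_add smooth_mult\<close>)
  then show ?thesis using that by (auto simp: norm_cis)
qed

lemma smooth_of_real: "smooth f \<Longrightarrow> smooth (\<lambda>x. complex_of_real (f x))"
  by (rule smooth_bounded_linear[OF bounded_linear_of_real])

lemma periodic_fun_simple_cis: "periodic_fun_simple (\<lambda>z. G (cis z)) (2 * pi)"
  by standard (simp add: cis.ctr)

text \<open>The half-lines are an intersection-stable generator of the Borel sets, so the integral of \<open>h\<close> vanishes
  over every Borel set.\<close>

lemma AE_zero_if_initial_integrals_zero:
  fixes h :: "real \<Rightarrow> complex"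
  assumes int: "set_integrable lborel {a..b} h"
    and zero: "\<And>x. x \<in> {a..b} \<Longrightarrow> (LBINT t:{a..x}. h t) = 0" and "a \<le> b"
  shows "AE t in lborel. t \<in> {a..b} \<longrightarrow> h t = 0"
proof -
  let ?f = "\<lambda>t. indicator {a..b} t *\<^sub>R h t"
  have intf: "integrable lborel ?f" using int by (simp add: set_integrable_def)
  have intA: "set_integrable lborel A ?f" if "A \<in> sets borel" for A
    unfolding set_integrable_def using that by (intro integrable_mult_indicator intf) auto
  have whole: "(LINT t|lborel. ?f t) = 0"
    using zero[of b] \<open>a \<le> b\<close> by (simp add: set_lebesgue_integral_def)
  have stable: "Int_stable (range (\<lambda>a. {..a::real}))"
    by (auto simp: Int_stable_def intro!: exI[of _ "min _ _"])
  have below: "range (\<lambda>a. {..a::real}) \<subseteq> Pow UNIV" by simp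
  have sets: "(LBINT t:A. ?f t) = 0" if "A \<in> sigma_sets UNIV (range (\<lambda>a. {..a::real}))" for A
    using that
  proof (induction rule: sigma_sets_induct_disjoint
      [OF stable below, consumes 1, case_names basic empty compl union])
    case (basic A)
    then obtain x where A: "A = {..x}" by blast
    consider "x < a" | "x \<in> {a..b}" | "x > b" by fastforce
    then show ?case
    proof cases
      case 1
      then have "(\<lambda>t. indicator A t *\<^sub>R ?f t) = (\<lambda>t. 0)" by (auto simp: A indicator_def)
      then show ?thesis by (simp add: set_lebesgue_integral_def)
    next
      case 2
      then have "(\<lambda>t. indicator A t *\<^sub>R ?f t) = (\<lambda>t. indicator {a..x} t *\<^sub>R h t)"
        by (auto simp: A indicator_def)
      then show ?thesis using zero[OF 2] by (simp add: set_lebesgue_integral_def)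
    next
      case 3
      then have "(\<lambda>t. indicator A t *\<^sub>R ?f t) = ?f" by (auto simp: A indicator_def)
      then show ?thesis using whole by (simp add: set_lebesgue_integral_def)
    qed
  next
    case (compl A)
    then have "A \<in> sets borel" by (simp add: borel_eq_atMost)
    then have "(LBINT t:A \<union> (UNIV - A). ?f t) = (LBINT t:A. ?f t) + (LBINT t:(UNIV - A). ?f t)"
      by (intro set_integral_Un intA) auto
    then show ?case using compl whole by (simp add: set_lebesgue_integral_def)
  next
    case (union A)
    then have A: "\<And>i. A i \<in> sets borel" by (auto simp: borel_eq_atMost)
    have "(LBINT t:(\<Union>i. A i). ?f t) = (\<Sum>i. (LBINT t:A i. ?f t))"
      using A union by (intro lebesgue_integral_countable_add intA) (auto simp: disjoint_family_on_def)
    then show ?case using union by simp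
  qed (simp add: set_lebesgue_integral_def)
  have "AE t in lborel. ?f t = 0"
    by (rule sigma_finite_measure.density_zero[OF lborel.sigma_finite_measure_axioms intf]) (use sets in \<open>simp add: borel_eq_atMost\<close>)
  then show ?thesis by (auto simp: indicator_def)
qed

lemma set_integrable_mult_continuous:
  fixes h \<phi> :: "real \<Rightarrow> complex"
  assumes "set_integrable lborel {a..b} h" "continuous_on {a..b} \<phi>"
  shows "set_integrable lborel {a..b} (\<lambda>t. \<phi> t * h t)" "set_integrable lborel {a..b} (\<lambda>t. h t * \<phi> t)"
proof -
  obtain B where B: "\<And>t. t \<in> {a..b} \<Longrightarrow> cmod (\<phi> t) \<le> B"
    using compact_imp_bounded[OF compact_continuous_image[OF assms(2)]]
    by (fastforce simp: bounded_iff)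
  have eq: "(\<lambda>t. indicator {a..b} t *\<^sub>R (\<phi> t * h t))
     = (\<lambda>t. (indicator {a..b} t *\<^sub>R \<phi> t) * (indicator {a..b} t *\<^sub>R h t))" by (auto simp: indicator_def)
  have m: "(\<lambda>t. indicator {a..b} t *\<^sub>R \<phi> t) \<in> borel_measurable lborel"
    using assms(2) by (simp add: borel_measurable_continuous_on_indicator)
  have h: "integrable lborel (\<lambda>t. indicator {a..b} t *\<^sub>R h t)"
    using assms(1) by (simp add: set_integrable_def)
  show *: "set_integrable lborel {a..b} (\<lambda>t. \<phi> t * h t)"
    unfolding set_integrable_def
  proof (rule Bochner_Integration.integrable_bound[of _ "\<lambda>t. B * norm (indicator {a..b} t *\<^sub>R h t)"])
    show "(\<lambda>t. indicator {a..b} t *\<^sub>R (\<phi> t * h t)) \<in> borel_measurable lborel"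
      unfolding eq using m h by (intro borel_measurable_times) auto
    show "AE t in lborel. norm (indicator {a..b} t *\<^sub>R (\<phi> t * h t))
        \<le> norm (B * norm (indicator {a..b} t *\<^sub>R h t))"
    proof (rule AE_I2)
      fix t
      show "norm (indicator {a..b} t *\<^sub>R (\<phi> t * h t))
        \<le> norm (B * norm (indicator {a..b} t *\<^sub>R h t))"
        using B[of t] by (auto simp: indicator_def norm_mult intro!: order_trans[OF mult_right_mono abs_ge_self])
    qed
  qed (use integrable_norm[OF h] in \<open>intro integrable_mult_right\<close>)
  show "set_integrable lborel {a..b} (\<lambda>t. h t * \<phi> t)" using * by (simp add: mult.commute)
qed

lemma norm_set_integral_le:
  fixes h :: "real \<Rightarrow> complex"
  assumes "set_integrable lborel A h"
  shows "cmod (LBINT t:A. h t) \<le> (LBINT t:A. cmod (h t))"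
  using integral_norm_bound[of lborel "\<lambda>t. indicator A t *\<^sub>R h t"]
  by (simp add: set_lebesgue_integral_def)

lemma set_integrable_cmod:
  fixes h :: "real \<Rightarrow> complex"
  assumes "set_integrable lborel A h"
  shows "set_integrable lborel A (\<lambda>t. cmod (h t))"
  using integrable_norm[OF assms[unfolded set_integrable_def]] by (simp add: set_integrable_def)

lemma set_integrable_cis:
  fixes F :: "complex \<Rightarrow> real"
  assumes "set_integrable lborel {a..b} h" "continuous_on (sphere 0 1) F"
  shows "set_integrable lborel {a..b} (\<lambda>t. h t * complex_of_real (F (cis t)))"
  by (rule set_integrable_mult_continuous(2)[OF assms(1)])
    (auto intro!: continuous_intros continuous_on_compose2[OF assms(2)])

text \<open>By Stone--Weierstrass the integral vanishes against every continuous function on the circle,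
  hence, by dominated convergence, over every arc; the arcs determine the density.\<close>

lemma AE_zero_if_orthogonal_to_smooth:
  fixes h :: "real \<Rightarrow> complex"
  assumes int: "set_integrable lborel {0..2 * pi} h"
    and orth: "\<And>\<phi>. smooth \<phi> \<Longrightarrow> periodic_fun_simple \<phi> (2 * pi) \<Longrightarrow>
                  (LBINT z:{0..2 * pi}. h z * \<phi> z) = 0"
  shows "AE t in lborel. t \<in> {0..2 * pi} \<longrightarrow> h t = 0"
proof (rule AE_zero_if_initial_integrals_zero[OF int])
  have cont: "(LBINT t:{0..2*pi}. h t * complex_of_real (F (cis t))) = 0"
    if F: "continuous_on (sphere 0 1) F" for F :: "complex \<Rightarrow> real"
  proof -
    define I where "I = (LBINT t:{0..2*pi}. cmod (h t))"
    have I: "I \<ge> 0" unfolding I_def by (auto simp: set_lebesgue_integral_def)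
    have "cmod (LBINT t:{0..2*pi}. h t * complex_of_real (F (cis t))) \<le> 0 + e" if "e > 0" for e
    proof -
      obtain G where G: "smooth (\<lambda>z. G (cis z))" "\<And>z. \<bar>F (cis z) - G (cis z)\<bar> < e / (I + 1)"
        using continuous_circle_approx[OF F, of "e / (I + 1)"] \<open>e > 0\<close> I by (auto simp: field_simps)
      have Gc: "continuous_on {0..2*pi} (\<lambda>t. complex_of_real (G (cis t)))"
        using smooth_imp_continuous[OF smooth_of_real[OF G(1)]] .
      have "smooth (\<lambda>t. complex_of_real (G (cis t)))" using smooth_of_real[OF G(1)] .
      then have "(LBINT t:{0..2*pi}. h t * complex_of_real (G (cis t))) = 0"
        by (rule orth) (rule periodic_fun_simple_cis)
      then have "(LBINT t:{0..2*pi}. h t * complex_of_real (F (cis t))) =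
          (LBINT t:{0..2*pi}. h t * complex_of_real (F (cis t)))
          - (LBINT t:{0..2*pi}. h t * complex_of_real (G (cis t)))" by simp
      also have "\<dots> = (LBINT t:{0..2*pi}. h t * complex_of_real (F (cis t)) - h t * complex_of_real (G (cis t)))"
        using set_integrable_cis[OF int F] set_integrable_mult_continuous(2)[OF int Gc]
        by (intro set_integral_diff(2)[symmetric]) auto
      also have "cmod \<dots> \<le> (LBINT t:{0..2*pi}. cmod (h t * complex_of_real (F (cis t)) - h t * complex_of_real (G (cis t))))"
        using set_integrable_cis[OF int F] set_integrable_mult_continuous(2)[OF int Gc]
        by (intro norm_set_integral_le set_integral_diff(1)) auto
      also have "\<dots> \<le> (LBINT t:{0..2*pi}. (e / (I + 1)) * cmod (h t))"
      proof (rule set_integral_mono)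
        show "set_integrable lborel {0..2*pi} (\<lambda>t. cmod (h t * complex_of_real (F (cis t)) - h t * complex_of_real (G (cis t))))"
          using set_integrable_cis[OF int F] set_integrable_mult_continuous(2)[OF int Gc]
          by (intro set_integrable_cmod set_integral_diff(1)) auto
        show "set_integrable lborel {0..2*pi} (\<lambda>t. (e / (I + 1)) * cmod (h t))"
          using set_integrable_cmod[OF int] by (intro set_integrable_mult_right) 
        fix t
        have "cmod (h t * complex_of_real (F (cis t)) - h t * complex_of_real (G (cis t)))
          = cmod (h t) * \<bar>F (cis t) - G (cis t)\<bar>"
          by (metis norm_mult norm_of_real of_real_diff right_diff_distrib)
        also have "\<dots> \<le> cmod (h t) * (e / (I + 1))" using G(2)[of t] by (intro mult_left_mono) auto
        finally show "cmod (h t * complex_of_real (F (cis t)) - h t * complex_of_real (G (cis t)))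
          \<le> (e / (I + 1)) * cmod (h t)" by (simp add: mult.commute)
      qed
      also have "\<dots> = e / (I + 1) * I" by (simp add: I_def)
      also have "\<dots> \<le> e" using \<open>e > 0\<close> I by (simp add: field_simps)
      finally show ?thesis by simp
    qed
    then have "cmod (LBINT t:{0..2*pi}. h t * complex_of_real (F (cis t))) \<le> 0"
      by (rule field_le_epsilon)
    then show ?thesis by simp
  qed
  fix x assume x: "x \<in> {0..2 * pi}"
  show "(LBINT t:{0..x}. h t) = 0"
  proof (cases "x = 2 * pi")
    case True
    then show ?thesis using cont[of "\<lambda>_. 1"] by simp
  next
    case False
    \<comment> \<open>The functions \<open>F n\<close> below are continuous and decrease to the indicator of the arc \<open>C\<close>.\<close>
  define C where "C = cis ` {0..x}"
    have C: "closed C" "C \<noteq> {}" unfolding C_def using x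
      by (auto intro!: compact_imp_closed compact_continuous_image continuous_intros)
    have cisC: "cis t \<in> C \<longleftrightarrow> t \<le> x" if "t \<in> {0..<2*pi}" for t
    proof
      assume "cis t \<in> C"
      then obtain s where s: "s \<in> {0..x}" "cis t = cis s" by (auto simp: C_def)
      have "Arg2pi (cis t) = t" "Arg2pi (cis s) = s"
        using s(1) that x False
        by (auto intro!: Arg2pi_unique[of 1] simp: cis_conv_exp order_le_less)
      then have "t = s" using s(2) by metis
      then show "t \<le> x" using s(1) by simp
    qed (use that in \<open>auto simp: C_def\<close>)
    define F where "F n w = max 0 (1 - real n * infdist w C)" for n w
    have Fc: "continuous_on (sphere 0 1) (F n)" for n unfolding F_def by (intro continuous_intros)
    have Flim: "(\<lambda>n. F n w) \<longlonglongrightarrow> (if w \<in> C then 1 else 0)" for w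
    proof (cases "w \<in> C")
      case True then show ?thesis by (simp add: F_def)
    next
      case False
      then have d: "infdist w C > 0"
        using C by (metis in_closed_iff_infdist_zero infdist_nonneg order_le_less)
      have "\<forall>\<^sub>F n in sequentially. F n w = 0"
      proof (rule eventually_sequentiallyI[of "nat \<lceil>1 / infdist w C\<rceil>"])
        fix n assume "n \<ge> nat \<lceil>1 / infdist w C\<rceil>"
        then have "real n \<ge> 1 / infdist w C" by linarith
        then show "F n w = 0" using d by (simp add: F_def field_simps)
      qed
      then show ?thesis using False by (simp add: tendsto_eventually)
    qed
    have "(\<lambda>n. LINT t|lborel. indicator {0..2*pi} t *\<^sub>R (h t * complex_of_real (F n (cis t))))
       \<longlonglongrightarrow> (LINT t|lborel. indicator {0..x} t *\<^sub>R h t)"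
    proof (rule integral_dominated_convergence[where w="\<lambda>t. indicator {0..2*pi} t *\<^sub>R cmod (h t)"])
      show "(\<lambda>t. indicator {0..x} t *\<^sub>R h t) \<in> borel_measurable lborel"
        using set_integrable_subset[OF int, of "{0..x}"] x by (auto simp: set_integrable_def)
      show "(\<lambda>t. indicator {0..2*pi} t *\<^sub>R (h t * complex_of_real (F n (cis t)))) \<in> borel_measurable lborel" for n
        using set_integrable_cis[OF int Fc] by (auto simp: set_integrable_def)
      show "integrable lborel (\<lambda>t. indicator {0..2*pi} t *\<^sub>R cmod (h t))"
        using set_integrable_cmod[OF int] by (simp add: set_integrable_def)
      show "AE t in lborel. (\<lambda>n. indicator {0..2*pi} t *\<^sub>R (h t * complex_of_real (F n (cis t))))
        \<longlonglongrightarrow> indicator {0..x} t *\<^sub>R h t"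
        using AE_lborel_singleton[of "2*pi"]
      proof eventually_elim
        case (elim t)
        have "(\<lambda>n. indicator {0..2*pi} t *\<^sub>R (h t * complex_of_real (F n (cis t))))
          \<longlonglongrightarrow> indicator {0..2*pi} t *\<^sub>R (h t * complex_of_real (if cis t \<in> C then 1 else 0))"
          by (intro tendsto_intros Flim)
        moreover have "indicator {0..2*pi} t *\<^sub>R (h t * complex_of_real (if cis t \<in> C then 1 else 0))
          = indicator {0..x} t *\<^sub>R h t"
          using elim x cisC[of t] by (auto simp: indicator_def)
        ultimately show ?case by simp
      qed
      show "AE t in lborel. norm (indicator {0..2*pi} t *\<^sub>R (h t * complex_of_real (F n (cis t))))
        \<le> indicator {0..2*pi} t *\<^sub>R cmod (h t)" for n
        by (rule AE_I2) (auto simp: indicator_def norm_mult F_def infdist_nonneg intro!: mult_left_le)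
    qed
    moreover have "(LINT t|lborel. indicator {0..2*pi} t *\<^sub>R (h t * complex_of_real (F n (cis t)))) = 0" for n
      using cont[OF Fc[of n]] by (simp add: set_lebesgue_integral_def)
    ultimately show ?thesis by (simp add: set_lebesgue_integral_def LIMSEQ_const_iff)
  qed
qed simp

text \<open>An antiderivative of \<open>g\<close> changes by a constant over each period, and this constant is the integral of \<open>g\<close>.\<close>

lemma periodic_antiderivative:
  fixes g :: "real \<Rightarrow> complex"
  assumes "smooth g" "periodic_fun_simple g (2 * pi)" "(LBINT z:{0..2 * pi}. g z) = 0"
  obtains f where "smooth f" "periodic_fun_simple f (2 * pi)" "\<And>x. (f has_vector_derivative g x) (at x)"
proof -
  have "\<exists>F. \<forall>x. - \<infinity> < ereal x \<longrightarrow> ereal x < \<infinity> \<longrightarrow> (F has_vector_derivative g x) (at x)"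
    by (rule einterval_antiderivative) 
      (use smooth_imp_continuous[OF assms(1)] continuous_on_eq_continuous_at[of UNIV] in auto)
  then obtain f where f: "\<And>x. (f has_vector_derivative g x) (at x)" by auto
  obtain D where D: "D 0 = g" "\<And>n x. (D n has_vector_derivative D (Suc n) x) (at x)"
    using assms(1) unfolding smooth_def by blast
  have sm: "smooth f" unfolding smooth_def
    by (rule exI[of _ "\<lambda>n. case n of 0 \<Rightarrow> f | Suc n \<Rightarrow> D n"]) (use f D in \<open>auto split: nat.splits\<close>)
  have fun_per: "g (x + 2 * pi) = g x" for x
    using assms(2) by (simp add: periodic_fun_simple_def periodic_fun_def periodic_fun_simple.plus_period)
  have "\<exists>c. \<forall>x. f (x + 2 * pi) - f x = c"
  proof -
    have "((\<lambda>x. f (x + 2 * pi) - f x) has_vector_derivative 0) (at x)" for x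
    proof -
      have "((\<lambda>x. f (x + 2 * pi)) has_vector_derivative g (x + 2 * pi)) (at x)"
        using vector_diff_chain_at[of "\<lambda>x. x + 2 * pi" 1 x f "g (x + 2 * pi)"] f[of "x + 2 * pi"]
        by (simp add: o_def has_vector_derivative_add_const)
      then show ?thesis using f[of x] fun_per[of x]
        by (auto intro!: derivative_eq_intros)
    qed
    then show ?thesis
      using has_vector_derivative_zero_constant[of UNIV "\<lambda>x. f (x + 2 * pi) - f x"] by fastforce
  qed
  then obtain c where c: "\<And>x. f (x + 2 * pi) - f x = c" by blast
  have "(LBINT z:{0..2 * pi}. g z) = f (2 * pi) - f 0" unfolding set_lebesgue_integral_def
    by (rule integral_FTC_atLeastAtMost)
      (use f smooth_imp_continuous[OF assms(1)] in \<open>auto intro: has_vector_derivative_at_within\<close>)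
  then have "c = 0" using assms(3) c[of 0] by simp
  then have "periodic_fun_simple f (2 * pi)" using c by (unfold_locales) simp
  then show ?thesis using that sm f by blast
qed

text \<open>The derivatives of smooth periodic functions are the smooth periodic functions of mean
  zero.\<close>

lemma AE_constant_if_orthogonal_to_derivatives:
  fixes h :: "real \<Rightarrow> complex"
  assumes int: "set_integrable lborel {0..2 * pi} h"
    and orth: "\<And>\<phi>. smooth \<phi> \<Longrightarrow> periodic_fun_simple \<phi> (2 * pi) \<Longrightarrow>
                  (LBINT z:{0..2 * pi}. h z * vector_derivative \<phi> (at z)) = 0"
  shows "\<exists>C. AE t in lborel. t \<in> {0..2 * pi} \<longrightarrow> h t = C"
proof -
  define C where "C = (LBINT z:{0..2 * pi}. h z) / (2 * pi)"
  have I1: "set_integrable lborel {0..2 * pi} (\<lambda>z. c)" for c :: complex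
    by (intro borel_integrable_atLeastAtMost' continuous_intros)
  have I1': "(LBINT z:{0..2 * pi}. c) = 2 * pi * c" for c :: complex
    by (simp add: set_lebesgue_integral_def scaleR_conv_of_real)
  have "AE t in lborel. t \<in> {0..2 * pi} \<longrightarrow> h t - C = 0"
  proof (rule AE_zero_if_orthogonal_to_smooth)
    show "set_integrable lborel {0..2 * pi} (\<lambda>z. h z - C)" using int I1 by auto
    fix \<phi> :: "real \<Rightarrow> complex"
    assume \<phi>: "smooth \<phi>" "periodic_fun_simple \<phi> (2 * pi)"
    define m where "m = (LBINT z:{0..2 * pi}. \<phi> z) / (2 * pi)"
    have I\<phi>: "set_integrable lborel {0..2 * pi} \<phi>"
      using smooth_imp_continuous[OF \<phi>(1)] by (rule borel_integrable_atLeastAtMost')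
    have Ih\<phi>: "set_integrable lborel {0..2 * pi} (\<lambda>z. h z * \<phi> z)"
      using set_integrable_mult_continuous(2)[OF int smooth_imp_continuous[OF \<phi>(1)]] .
    have Ihm: "set_integrable lborel {0..2 * pi} (\<lambda>z. h z * m)" using int by auto
    interpret per: periodic_fun_simple \<phi> "2 * pi" by fact
    have 1: "smooth (\<lambda>z. \<phi> z - m)" using smooth_add[OF \<phi>(1) smooth_const[of "-m"]] by simp
    have 2: "periodic_fun_simple (\<lambda>z. \<phi> z - m) (2 * pi)" by unfold_locales (simp add: per.plus_1)
    have 3: "(LBINT z:{0..2 * pi}. \<phi> z - m) = 0"
      using I\<phi> I1 I1' by (subst set_integral_diff(2)) (auto simp: m_def)
    obtain f where f: "smooth f" "periodic_fun_simple f (2 * pi)"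
      "\<And>x. (f has_vector_derivative (\<phi> x - m)) (at x)"
      using periodic_antiderivative[OF 1 2 3] by blast
    have "(LBINT z:{0..2 * pi}. h z * (\<phi> z - m)) = 0"
      using orth[OF f(1,2)] vector_derivative_at[OF f(3)] by simp
    moreover have "(LBINT z:{0..2 * pi}. h z * (\<phi> z - m)) = (LBINT z:{0..2 * pi}. h z * \<phi> z) - C * 2 * pi * m"
      using Ih\<phi> Ihm by (simp add: right_diff_distrib set_integral_diff(2) C_def)
    moreover have "(LBINT z:{0..2 * pi}. (h z - C) * \<phi> z) = (LBINT z:{0..2 * pi}. h z * \<phi> z) - C * (2 * pi * m)"
      using Ih\<phi> I\<phi> by (simp add: left_diff_distrib set_integral_diff(2) m_def)
    ultimately show "(LBINT z:{0..2 * pi}. (h z - C) * \<phi> z) = 0" by simp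
  qed
  then show ?thesis by auto
qed

section \<open>Absolutely continuous functions on an interval\<close>

text \<open>On \<open>{0..b}\<close> the function \<open>G\<close> is absolutely continuous with almost-everywhere derivative \<open>h\<close>. The
  integrated form is the definition, since it is what the weak derivative provides.\<close>

definition primitive_on :: "real \<Rightarrow> (real \<Rightarrow> complex) \<Rightarrow> (real \<Rightarrow> complex) \<Rightarrow> bool" where
  "primitive_on b G h \<longleftrightarrow> set_integrable lborel {0..b} h \<and>
     (\<forall>z\<in>{0..b}. G z = G 0 + (LBINT t:{0..z}. h t))"

lemma primitive_on_integrable: "primitive_on b G h \<Longrightarrow> set_integrable lborel {0..b} h"
  by (simp add: primitive_on_def)

lemma primitive_on_integral:
  "primitive_on b G h \<Longrightarrow> z \<in> {0..b} \<Longrightarrow> (LBINT t:{0..z}. h t) = G z - G 0"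
  unfolding primitive_on_def by (metis add_diff_cancel_left')

lemma primitive_onI:
  assumes "set_integrable lborel {0..b} h"
    and "\<And>z. z \<in> {0..b} \<Longrightarrow> (LBINT t:{0..z}. h t) = G z - G 0"
  shows "primitive_on b G h"
  unfolding primitive_on_def using assms by (metis add.commute diff_add_cancel)

lemma initial_set_integrable:
  fixes h :: "real \<Rightarrow> complex"
  assumes "set_integrable lborel {0..b} h" "z \<in> {0..b}"
  shows "set_integrable lborel {0..z} h"
  using assms by (auto intro: set_integrable_subset)

lemma primitive_on_continuous:
  assumes "primitive_on b G h" shows "continuous_on {0..b} G"
proof -
  have h: "set_integrable lborel {0..b} h" using primitive_on_integrable[OF assms(1)] .
  have *: "G 0 + integral {0..z} h = G z" if "z \<in> {0..b}" for z
    using primitive_on_integral[OF assms that] set_borel_integral_eq_integral(2)[OF initial_set_integrable[OF h that]]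
    by simp
  have "continuous_on {0..b} (\<lambda>z. G 0 + integral {0..z} h)"
    by (intro continuous_intros indefinite_integral_continuous_1 set_borel_integral_eq_integral(1) h)
  then show ?thesis by (rule continuous_on_eq) (rule *)
qed

lemma primitive_on_add:
  assumes "primitive_on b F f" "primitive_on b G g"
  shows "primitive_on b (\<lambda>z. F z + G z) (\<lambda>z. f z + g z)"
proof -
  have fg: "set_integrable lborel {0..b} f" "set_integrable lborel {0..b} g"
    using assms primitive_on_integrable by blast+
  have "(LBINT t:{0..z}. f t + g t) = (LBINT t:{0..z}. f t) + (LBINT t:{0..z}. g t)"
    if "z \<in> {0..b}" for z
    using initial_set_integrable[OF fg(1) that] initial_set_integrable[OF fg(2) that]
    by (rule set_integral_add(2))
  then show ?thesis using fg assms
    by (intro primitive_onI) (auto simp: primitive_on_integral)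
qed

lemma primitive_on_cong_AE:
  assumes "primitive_on b G h" "set_integrable lborel {0..b} h'"
    and "AE t in lborel. t \<in> {0..b} \<longrightarrow> h t = h' t"
  shows "primitive_on b G h'"
proof -
  have h: "set_integrable lborel {0..b} h" using primitive_on_integrable[OF assms(1)] .
  have "(LBINT t:{0..z}. h t) = (LBINT t:{0..z}. h' t)" if z: "z \<in> {0..b}" for z
  proof -
    have "AE t in lborel. indicator {0..z} t *\<^sub>R h t = indicator {0..z} t *\<^sub>R h' t"
      using assms(3) by eventually_elim (use z in \<open>auto simp: indicator_def\<close>)
    then show ?thesis
      using initial_set_integrable[OF h z] initial_set_integrable[OF assms(2) z]
      unfolding set_lebesgue_integral_def set_integrable_def by (intro integral_cong_AE) auto
  qed
  then show ?thesis using assms(2) primitive_on_integral[OF assms(1)]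
    by (intro primitive_onI) auto
qed

lemma primitive_on_cong:
  assumes "primitive_on b G h" "\<And>z. z \<in> {0..b} \<Longrightarrow> G z = G' z" "\<And>z. z \<in> {0..b} \<Longrightarrow> h z = h' z"
  shows "primitive_on b G' h'"
proof -
  have h: "set_integrable lborel {0..b} h" using primitive_on_integrable[OF assms(1)] .
  have h': "set_integrable lborel {0..b} h'"
    using h assms(3) by (metis (no_types, lifting) set_integrable_cong)
  have 1: "primitive_on b G h'" by (rule primitive_on_cong_AE[OF assms(1) h']) (use assms(3) in auto)
  show ?thesis
  proof (rule primitive_onI[OF h'])
    fix z assume "z \<in> {0..b}"
    then show "(LBINT t:{0..z}. h' t) = G' z - G' 0"
      using primitive_on_integral[OF 1] assms(2)[of z] assms(2)[of 0] by auto
  qed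
qed

lemma primitive_on_C1:
  assumes "continuous_on {0..b} h"
    and "\<And>z. z \<in> {0..b} \<Longrightarrow> (G has_vector_derivative h z) (at z within {0..b})"
  shows "primitive_on b G h"
proof -
  have "(LBINT t:{0..z}. h t) = G z - G 0" if z: "z \<in> {0..b}" for z
    unfolding set_lebesgue_integral_def
  proof (rule integral_FTC_atLeastAtMost)
    show "continuous_on {0..z} h" using assms(1) by (rule continuous_on_subset) (use z in auto)
    show "(G has_vector_derivative h x) (at x within {0..z})" if "0 \<le> x" "x \<le> z" for x
      using assms(2)[of x] by (rule has_vector_derivative_within_subset) (use z that in auto)
  qed (use z in auto)
  then show ?thesis using borel_integrable_atLeastAtMost'[OF assms(1)] by (rule primitive_onI[rotated])
qed

lemma integral_triangle_swap:
  fixes h k :: "real \<Rightarrow> complex"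
  assumes "set_integrable lborel {0..z} k" "set_integrable lborel {0..z} h"
  shows "(LBINT t:{0..z}. k t * (LBINT s:{0..t}. h s)) = (LBINT s:{0..z}. (LBINT t:{s..z}. k t) * h s)"
proof -
  define K where "K t = indicator {0..z} t *\<^sub>R k t" for t
  define H where "H t = indicator {0..z} t *\<^sub>R h t" for t
  have K: "integrable lborel K" and H: "integrable lborel H"
    using assms by (simp_all add: K_def[abs_def] H_def[abs_def] set_integrable_def)
  have meas[measurable]: "K \<in> borel_measurable borel" "H \<in> borel_measurable borel" using K H by auto
  have "integrable (lborel \<Otimes>\<^sub>M lborel) (\<lambda>p. K (fst p) * H (snd p))"
  proof (rule lborel_pair.Fubini_integrable)
    show "(\<lambda>p. K (fst p) * H (snd p)) \<in> borel_measurable (lborel \<Otimes>\<^sub>M lborel)" by measurable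
    show "integrable lborel (\<lambda>x. LINT y|lborel. norm (K (fst (x, y)) * H (snd (x, y))))"
      using K by (simp add: norm_mult)
    show "AE x in lborel. integrable lborel (\<lambda>y. K (fst (x, y)) * H (snd (x, y)))"
      using H by simp
  qed
  moreover have "{p. snd p \<le> (fst p :: real)} \<in> sets (lborel \<Otimes>\<^sub>M lborel)"
  proof -
    have "{p \<in> space (lborel \<Otimes>\<^sub>M lborel). snd p \<le> (fst p :: real)} \<in> sets (lborel \<Otimes>\<^sub>M lborel)"
      by measurable
    then show ?thesis by (simp add: space_pair_measure)
  qed
  ultimately have "integrable (lborel \<Otimes>\<^sub>M lborel)
      (\<lambda>p. indicator {p. snd p \<le> (fst p :: real)} p *\<^sub>R (K (fst p) * H (snd p)))"
    by (intro integrable_mult_indicator)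
  moreover have "(\<lambda>p. indicator {p. snd p \<le> (fst p :: real)} p *\<^sub>R (K (fst p) * H (snd p)))
      = (\<lambda>(t, s). indicator {..t} s *\<^sub>R (K t * H s))" by (auto simp: indicator_def fun_eq_iff)
  ultimately have int: "integrable (lborel \<Otimes>\<^sub>M lborel)
      (\<lambda>(t, s). indicator {..t} s *\<^sub>R (K t * H s))" by simp
  have swap: "(LINT s|lborel. LINT t|lborel. indicator {..t} s *\<^sub>R (K t * H s))
      = (LINT t|lborel. LINT s|lborel. indicator {..t} s *\<^sub>R (K t * H s))"
    using lborel_pair.Fubini_integral[OF int] .
  have "(LINT s|lborel. indicator {..t} s *\<^sub>R (K t * H s))
      = indicator {0..z} t *\<^sub>R (k t * (LBINT s:{0..t}. h s))" for t
  proof (cases "t \<in> {0..z}")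
    case True
    then have "(\<lambda>s. indicator {..t} s *\<^sub>R (K t * H s)) = (\<lambda>s. k t * (indicator {0..t} s *\<^sub>R h s))"
      by (auto simp: K_def H_def indicator_def)
    then have "(LINT s|lborel. indicator {..t} s *\<^sub>R (K t * H s))
        = (LINT s|lborel. k t * (indicator {0..t} s *\<^sub>R h s))" by (rule arg_cong)
    also have "\<dots> = k t * (LBINT s:{0..t}. h s)"
      unfolding set_lebesgue_integral_def by (rule integral_mult_right_zero)
    finally show ?thesis using True by simp
  qed (simp add: K_def)
  moreover have "(LINT t|lborel. indicator {..t} s *\<^sub>R (K t * H s))
      = indicator {0..z} s *\<^sub>R ((LBINT t:{s..z}. k t) * h s)" for s
  proof (cases "s \<in> {0..z}")
    case True
    then have "(\<lambda>t. indicator {..t} s *\<^sub>R (K t * H s)) = (\<lambda>t. (indicator {s..z} t *\<^sub>R k t) * h s)"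
      by (auto simp: K_def H_def indicator_def)
    then have "(LINT t|lborel. indicator {..t} s *\<^sub>R (K t * H s))
        = (LINT t|lborel. (indicator {s..z} t *\<^sub>R k t) * h s)" by (rule arg_cong)
    also have "\<dots> = (LBINT t:{s..z}. k t) * h s"
      unfolding set_lebesgue_integral_def by (rule integral_mult_left_zero)
    finally show ?thesis using True by simp
  qed (simp add: H_def)
  ultimately show ?thesis using swap by (simp add: set_lebesgue_integral_def)
qed

text \<open>Integrating \<open>\<phi>' G\<close> over a triangle in the other order gives the product rule for an integrable
  derivative, where no pointwise differentiation is available.\<close>

lemma primitive_on_mult:
  assumes G: "primitive_on b G h"
    and \<phi>': "continuous_on {0..b} \<phi>'"
    and \<phi>: "\<And>z. z \<in> {0..b} \<Longrightarrow> (\<phi> has_vector_derivative \<phi>' z) (at z within {0..b})"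
  shows "primitive_on b (\<lambda>z. \<phi> z * G z) (\<lambda>z. \<phi>' z * G z + \<phi> z * h z)"
proof -
  have h: "set_integrable lborel {0..b} h" using primitive_on_integrable[OF G] .
  have Gz: "(LBINT s:{0..t}. h s) = G t - G 0" if "t \<in> {0..b}" for t
    using primitive_on_integral[OF G that] .
  have \<phi>c: "continuous_on {0..b} \<phi>" 
    using \<phi> by (simp only: continuous_on_eq_continuous_within) (blast intro: has_vector_derivative_continuous)
  have \<phi>p: "primitive_on b \<phi> \<phi>'" by (rule primitive_on_C1[OF \<phi>' \<phi>])
  have i1: "set_integrable lborel {0..b} (\<lambda>z. \<phi>' z * G z)"
    by (intro borel_integrable_atLeastAtMost' continuous_intros \<phi>' primitive_on_continuous[OF G])
  have i2: "set_integrable lborel {0..b} (\<lambda>z. \<phi> z * h z)"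
    by (rule set_integrable_mult_continuous(1)[OF h \<phi>c])
  have "(LBINT t:{0..z}. \<phi>' t * G t + \<phi> t * h t) = \<phi> z * G z - \<phi> 0 * G 0" if z: "z \<in> {0..b}" for z
  proof -
    have iz: "set_integrable lborel {0..z} h" "set_integrable lborel {0..z} (\<lambda>z. \<phi>' z * G z)"
      "set_integrable lborel {0..z} (\<lambda>z. \<phi> z * h z)" "set_integrable lborel {0..z} \<phi>'"
      using h i1 i2 z borel_integrable_atLeastAtMost'[OF \<phi>'] initial_set_integrable by blast+
    have iz2: "set_integrable lborel {0..z} (\<lambda>t. \<phi>' t * (LBINT s:{0..t}. h s))"
    proof -
      have "set_integrable lborel {0..z} (\<lambda>t. \<phi>' t * G t - \<phi>' t * G 0)"
        using iz by auto
      then show ?thesis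
        by (rule set_integrable_cong[THEN iffD1, rotated -1])
          (use z in \<open>auto simp: Gz algebra_simps\<close>)
    qed
    have "(LBINT t:{0..z}. \<phi>' t * G t) = (LBINT t:{0..z}. \<phi>' t * G 0 + \<phi>' t * (LBINT s:{0..t}. h s))"
      using z by (intro set_lebesgue_integral_cong) (auto simp: Gz algebra_simps)
    also have "\<dots> = (LBINT t:{0..z}. \<phi>' t * G 0) + (LBINT t:{0..z}. \<phi>' t * (LBINT s:{0..t}. h s))"
      using iz iz2 by (intro set_integral_add(2)) auto
    also have "(LBINT t:{0..z}. \<phi>' t * (LBINT s:{0..t}. h s)) = (LBINT s:{0..z}. (LBINT t:{s..z}. \<phi>' t) * h s)"
      by (rule integral_triangle_swap) (use iz in auto)
    also have "\<dots> = (LBINT s:{0..z}. \<phi> z * h s - \<phi> s * h s)"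
    proof (intro set_lebesgue_integral_cong)
      have "(LBINT t:{s..z}. \<phi>' t) = \<phi> z - \<phi> s" if s: "s \<in> {0..z}" for s
        unfolding set_lebesgue_integral_def
      proof (rule integral_FTC_atLeastAtMost)
        show "continuous_on {s..z} \<phi>'" using \<phi>' by (rule continuous_on_subset) (use z s in auto)
        show "(\<phi> has_vector_derivative \<phi>' x) (at x within {s..z})" if "s \<le> x" "x \<le> z" for x
          using \<phi>[of x] by (rule has_vector_derivative_within_subset) (use z s that in auto)
      qed (use s in auto)
      then show "\<forall>s. s \<in> {0..z} \<longrightarrow> (LBINT t:{s..z}. \<phi>' t) * h s = \<phi> z * h s - \<phi> s * h s"
        by (simp add: left_diff_distrib)
    qed auto
    also have "\<dots> = \<phi> z * (LBINT s:{0..z}. h s) - (LBINT s:{0..z}. \<phi> s * h s)"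
      using iz by (subst set_integral_diff(2)) auto
    finally have "(LBINT t:{0..z}. \<phi>' t * G t) = (\<phi> z - \<phi> 0) * G 0 + \<phi> z * (G z - G 0) - (LBINT s:{0..z}. \<phi> s * h s)"
      using primitive_on_integral[OF \<phi>p z] Gz[OF z] by simp
    moreover have "(LBINT t:{0..z}. \<phi>' t * G t + \<phi> t * h t)
        = (LBINT t:{0..z}. \<phi>' t * G t) + (LBINT t:{0..z}. \<phi> t * h t)"
      using iz by (intro set_integral_add(2)) auto
    ultimately show ?thesis by (simp add: algebra_simps)
  qed
  moreover have "set_integrable lborel {0..b} (\<lambda>z. \<phi>' z * G z + \<phi> z * h z)" using i1 i2 by auto
  ultimately show ?thesis by (intro primitive_onI) auto
qed

lemma primitive_on_zero_const:
  assumes "primitive_on b G h" "AE t in lborel. t \<in> {0..b} \<longrightarrow> h t = 0" "z \<in> {0..b}"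
  shows "G z = G 0"
proof -
  have "primitive_on b G (\<lambda>_. 0)" by (rule primitive_on_cong_AE[OF assms(1) _ assms(2)])
      (simp add: set_integrable_def)
  then show ?thesis using primitive_on_integral[OF _ assms(3)] by fastforce
qed

lemma primitive_on_diff:
  assumes "primitive_on b F f" "primitive_on b G g"
  shows "primitive_on b (\<lambda>z. F z - G z) (\<lambda>z. f z - g z)"
proof -
  have "primitive_on b (\<lambda>z. (-1) * G z) (\<lambda>z. 0 * G z + (-1) * g z)"
    by (rule primitive_on_mult[OF assms(2)]) auto
  from primitive_on_add[OF assms(1) this] show ?thesis by (rule primitive_on_cong) auto
qed

lemma primitive_on_indefinite:
  assumes "set_integrable lborel {0..b} k"
  shows "primitive_on (b) (\<lambda>z. c + (LBINT t:{0..z}. k t)) k"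
    and "(LBINT t:{0..0}. k t) = (0::complex)"
proof -
  show 0: "(LBINT t:{0..0}. k t) = (0::complex)" unfolding set_lebesgue_integral_def
  proof (rule integral_eq_zero_AE)
    show "AE t in lborel. indicator {0..0} t *\<^sub>R k t = 0"
      using AE_lborel_singleton[of 0] by eventually_elim (auto simp: indicator_def)
  qed
  show "primitive_on (b) (\<lambda>z. c + (LBINT t:{0..z}. k t)) k"
    using 0 by (intro primitive_onI[OF assms]) simp
qed

section \<open>Square integrable periodic functions\<close>

lemma L2T_D:
  assumes "f \<in> L2T"
  shows "f (z + 2 * pi) = f z" "f \<in> borel_measurable borel"
    "set_integrable lborel {0..2 * pi} (\<lambda>z. (cmod (f z))\<^sup>2)"
  using assms by (auto simp: L2T_def periodic_fun_simple_def)

lemma L2T_I: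
  assumes "\<And>z. f (z + 2 * pi) = f z" "f \<in> borel_measurable borel"
    "set_integrable lborel {0..2 * pi} (\<lambda>z. (cmod (f z))\<^sup>2)"
  shows "f \<in> L2T"
  using assms by (auto simp: L2T_def periodic_fun_simple_def)

lemma set_integrable_le:
  fixes f :: "real \<Rightarrow> 'a::{banach,second_countable_topology}" and g :: "real \<Rightarrow> real"
  assumes "set_integrable lborel A g" "f \<in> borel_measurable borel" "A \<in> sets borel"
    and "\<And>z. z \<in> A \<Longrightarrow> norm (f z) \<le> g z"
  shows "set_integrable lborel A f"
  unfolding set_integrable_def
proof (rule Bochner_Integration.integrable_bound[OF assms(1)[unfolded set_integrable_def]])
  show "(\<lambda>x. indicat_real A x *\<^sub>R f x) \<in> borel_measurable lborel"
    using assms by measurable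
qed (use assms(4) in \<open>auto simp: indicator_def intro!: AE_I2 order_trans[OF assms(4) abs_ge_self]\<close>)

lemma set_integrable_const_circle: "set_integrable lborel {0..2 * pi} (\<lambda>z. c::real)"
  by (intro borel_integrable_atLeastAtMost' continuous_intros)

lemma L2T_set_integrable:
  assumes "f \<in> L2T" shows "set_integrable lborel {0..2 * pi} f"
proof (rule set_integrable_le)
  show "set_integrable lborel {0..2 * pi} (\<lambda>z. 1 + (cmod (f z))\<^sup>2)"
    by (intro set_integral_add(1) set_integrable_const_circle L2T_D(3) assms)
  show "cmod (f z) \<le> 1 + (cmod (f z))\<^sup>2" for z
    using sum_power2_ge_zero[of "cmod (f z) - 1" 0] by (simp add: power2_diff)
      (smt (verit) norm_ge_zero)
qed (use L2T_D[OF assms] in auto)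

lemma L2T_add:
  assumes "f \<in> L2T" "g \<in> L2T" shows "(\<lambda>z. f z + g z) \<in> L2T"
proof (rule L2T_I)
  show "set_integrable lborel {0..2 * pi} (\<lambda>z. (cmod (f z + g z))\<^sup>2)"
  proof (rule set_integrable_le)
    show "set_integrable lborel {0..2 * pi} (\<lambda>z. 2 * (cmod (f z))\<^sup>2 + 2 * (cmod (g z))\<^sup>2)"
      using L2T_D(3)[OF assms(1)] L2T_D(3)[OF assms(2)] by auto
    show "norm ((cmod (f z + g z))\<^sup>2) \<le> 2 * (cmod (f z))\<^sup>2 + 2 * (cmod (g z))\<^sup>2" for z
    proof -
      have "(cmod (f z + g z))\<^sup>2 \<le> (cmod (f z) + cmod (g z))\<^sup>2"
        by (intro power_mono norm_triangle_ineq) simp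
      also have "\<dots> \<le> 2 * (cmod (f z))\<^sup>2 + 2 * (cmod (g z))\<^sup>2"
        using sum_squares_bound[of "cmod (f z)" "cmod (g z)"] by (simp add: power2_sum)
      finally show ?thesis by simp
    qed
  qed (use L2T_D(2)[OF assms(1)] L2T_D(2)[OF assms(2)] in auto)
qed (use L2T_D(1,2)[OF assms(1)] L2T_D(1,2)[OF assms(2)] in auto)

lemma reduce_mod_period:
  "z - of_int \<lfloor>z / (2 * pi)\<rfloor> * (2 * pi) \<in> {0..2 * pi}"
  using floor_divide_lower[of "2 * pi" z] floor_divide_upper[of "2 * pi" z] by (simp add: algebra_simps)

lemma periodic_continuous_bounded:
  fixes m :: "real \<Rightarrow> complex"
  assumes "continuous_on UNIV m" "\<And>z. m (z + 2 * pi) = m z"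
  obtains B where "B > 0" "\<And>z. cmod (m z) \<le> B"
proof -
  interpret periodic_fun_simple m "2 * pi" using assms(2) by unfold_locales
  have "bounded (m ` {0..2 * pi})"
    by (intro compact_imp_bounded compact_continuous_image continuous_on_subset[OF assms(1)]) auto
  then obtain B where B: "B > 0" "\<And>z. z \<in> {0..2 * pi} \<Longrightarrow> cmod (m z) \<le> B"
    by (auto simp: bounded_pos)
  have "cmod (m z) \<le> B" for z
  proof -
    have "m z = m (z - of_int \<lfloor>z / (2 * pi)\<rfloor> * (2 * pi))" by (simp add: minus_of_int)
    moreover have "z - of_int \<lfloor>z / (2 * pi)\<rfloor> * (2 * pi) \<in> {0..2 * pi}"
      by (rule reduce_mod_period)
    ultimately show ?thesis using B by metis
  qed
  then show ?thesis using that B by blast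
qed

lemma L2T_mult:
  assumes "f \<in> L2T" "continuous_on UNIV m" "\<And>z. m (z + 2 * pi) = m z"
  shows "(\<lambda>z. m z * f z) \<in> L2T"
proof (rule L2T_I)
  obtain B where B: "B > 0" "\<And>z. cmod (m z) \<le> B" using periodic_continuous_bounded assms(2,3) by blast
  have m[measurable]: "m \<in> borel_measurable borel" using assms(2) by (rule borel_measurable_continuous_onI)
  show "set_integrable lborel {0..2 * pi} (\<lambda>z. (cmod (m z * f z))\<^sup>2)"
  proof (rule set_integrable_le)
    show "set_integrable lborel {0..2 * pi} (\<lambda>z. B\<^sup>2 * (cmod (f z))\<^sup>2)"
      using L2T_D(3)[OF assms(1)] by auto
    show "norm ((cmod (m z * f z))\<^sup>2) \<le> B\<^sup>2 * (cmod (f z))\<^sup>2" for z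
      using B(2)[of z] by (simp add: norm_mult power_mult_distrib mult_right_mono power_mono)
  qed (use L2T_D(2)[OF assms(1)] in auto)
qed (use L2T_D(1,2)[OF assms(1)] assms borel_measurable_continuous_onI[OF assms(2)] in auto)

lemma L2T_cmult: "f \<in> L2T \<Longrightarrow> (\<lambda>z. c * f z) \<in> L2T"
  by (rule L2T_mult) auto

lemma L2T_diff: "f \<in> L2T \<Longrightarrow> g \<in> L2T \<Longrightarrow> (\<lambda>z. f z - g z) \<in> L2T"
  using L2T_add[of f "\<lambda>z. - 1 * g z"] L2T_cmult[of g "-1"] by simp

text \<open>The line is a countable union of translates of one period, and translations preserve null sets.\<close>

lemma AE_of_AE_period:
  fixes f g :: "real \<Rightarrow> complex"
  assumes f: "f \<in> borel_measurable borel" "\<And>z. f (z + 2 * pi) = f z"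
    and g: "g \<in> borel_measurable borel" "\<And>z. g (z + 2 * pi) = g z"
    and ae: "AE z in lborel. z \<in> {0..2 * pi} \<longrightarrow> f z = g z"
  shows "AE z in lborel. f z = g z"
proof -
  interpret f: periodic_fun_simple f "2 * pi" using f(2) by unfold_locales
  interpret g: periodic_fun_simple g "2 * pi" using g(2) by unfold_locales
  note [measurable] = f(1) g(1)
  have pr: "Measurable.pred borel (\<lambda>z. z \<in> {0..2 * pi} \<longrightarrow> f z = g z)" by measurable
  have "AE z in lborel. (- (of_int n * (2 * pi)) + 1 * z \<in> {0..2 * pi}
      \<longrightarrow> f (- (of_int n * (2 * pi)) + 1 * z) = g (- (of_int n * (2 * pi)) + 1 * z))" for n :: int
    using AE_borel_affine[OF _ pr ae, of 1 "- (of_int n * (2 * pi))"] by simp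
  then have "AE z in lborel. \<forall>n::int. (z - of_int n * (2 * pi) \<in> {0..2 * pi}
      \<longrightarrow> f (z - of_int n * (2 * pi)) = g (z - of_int n * (2 * pi)))"
    by (simp add: AE_all_countable)
  then show ?thesis
  proof eventually_elim
    case (elim z)
    have "z - of_int \<lfloor>z / (2 * pi)\<rfloor> * (2 * pi) \<in> {0..2 * pi}"
      by (rule reduce_mod_period)
    with elim show ?case by (metis f.minus_of_int g.minus_of_int)
  qed
qed

lemma norm_L2T_power2: "(norm_L2T f)\<^sup>2 = (LBINT z:{0..2 * pi}. (cmod (f z))\<^sup>2)"
  by (auto simp: norm_L2T_def set_lebesgue_integral_def)

lemma norm_L2T_nonneg: "norm_L2T f \<ge> 0"
  by (auto simp: norm_L2T_def set_lebesgue_integral_def)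

lemma norm_L2T_le:
  assumes "f \<in> L2T" "set_integrable lborel {0..2 * pi} g"
    "AE z in lborel. z \<in> {0..2 * pi} \<longrightarrow> (cmod (f z))\<^sup>2 \<le> g z"
  shows "(norm_L2T f)\<^sup>2 \<le> (LBINT z:{0..2 * pi}. g z)"
  unfolding norm_L2T_power2 by (rule set_integral_mono_AE[OF L2T_D(3)[OF assms(1)] assms(2,3)])

text \<open>The nonnegative integral of \<open>(\<bar>f\<bar> - m)\<^sup>2\<close>, where \<open>m\<close> is the mean of \<open>\<bar>f\<bar>\<close>, compares the two
  norms.\<close>

lemma L1_le_norm_L2T:
  assumes "f \<in> L2T"
  shows "(LBINT z:{0..2 * pi}. cmod (f z)) \<le> sqrt (2 * pi) * norm_L2T f"
proof -
  define I where "I = (LBINT z:{0..2 * pi}. cmod (f z))"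
  define m where "m = I / (2 * pi)"
  have i1: "set_integrable lborel {0..2 * pi} (\<lambda>z. cmod (f z))"
    using set_integrable_cmod[OF L2T_set_integrable[OF assms]] .
  have i2: "set_integrable lborel {0..2 * pi} (\<lambda>z. (cmod (f z))\<^sup>2)" using L2T_D(3)[OF assms] .
  have "0 \<le> (LBINT z:{0..2 * pi}. (cmod (f z) - m)\<^sup>2)" by (auto simp: set_lebesgue_integral_def)
  also have "\<dots> = (LBINT z:{0..2 * pi}. ((cmod (f z))\<^sup>2 - (2 * m) * cmod (f z)) + m\<^sup>2)"
    by (simp add: power2_diff algebra_simps)
  also have "\<dots> = (LBINT z:{0..2 * pi}. (cmod (f z))\<^sup>2 - (2 * m) * cmod (f z)) + (LBINT z:{0..2 * pi}. m\<^sup>2)"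
    using i1 i2 by (intro set_integral_add(2) set_integral_diff(1) set_integrable_const_circle) auto
  also have "(LBINT z:{0..2 * pi}. (cmod (f z))\<^sup>2 - (2 * m) * cmod (f z)) = (norm_L2T f)\<^sup>2 - 2 * m * I"
    using i1 i2 by (subst set_integral_diff(2)) (auto simp: norm_L2T_power2 I_def)
  also have "(LBINT z:{0..2 * pi}. m\<^sup>2) = 2 * pi * m\<^sup>2" by (simp add: set_lebesgue_integral_def)
  also have "(norm_L2T f)\<^sup>2 - 2 * m * I + 2 * pi * m\<^sup>2 = (norm_L2T f)\<^sup>2 - I\<^sup>2 / (2 * pi)"
    by (simp add: m_def power2_eq_square field_simps)
  finally have "I\<^sup>2 \<le> 2 * pi * (norm_L2T f)\<^sup>2" by (simp add: field_simps)
  also have "\<dots> = (sqrt (2 * pi) * norm_L2T f)\<^sup>2" by (simp add: power_mult_distrib)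
  finally show ?thesis unfolding I_def by (rule power2_le_imp_le) (simp add: norm_L2T_nonneg)
qed

text \<open>Solutions are constructed on a single period; periodizing them gives elements of \<open>L2T\<close>, whatever their
  values outside that period.\<close>

definition periodize :: "(real \<Rightarrow> complex) \<Rightarrow> real \<Rightarrow> complex" where
  "periodize G z = G (z - of_int \<lfloor>z / (2 * pi)\<rfloor> * (2 * pi))"

lemma periodize_eq:
  assumes "z \<in> {0..<2 * pi}" shows "periodize G z = G z"
proof -
  have "\<lfloor>z / (2 * pi)\<rfloor> = 0" using assms by (simp add: floor_eq_iff)
  then show ?thesis by (simp add: periodize_def)
qed

lemma AE_periodize: "AE z in lborel. z \<in> {0..2 * pi} \<longrightarrow> periodize G z = G z"
  using AE_lborel_singleton[of "2 * pi"] by eventually_elim (auto simp: periodize_eq)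

lemma periodize_periodic: "periodize G (z + 2 * pi) = periodize G z"
proof -
  have "\<lfloor>(z + 2 * pi) / (2 * pi)\<rfloor> = \<lfloor>z / (2 * pi)\<rfloor> + 1" by (simp add: add_divide_distrib)
  then show ?thesis by (simp add: periodize_def algebra_simps)
qed

lemma periodize_L2T:
  assumes "continuous_on {0..2 * pi} G" shows "periodize G \<in> L2T"
proof (rule L2T_I)
  obtain B where B: "\<And>z. z \<in> {0..2 * pi} \<Longrightarrow> cmod (G z) \<le> B"
    using compact_imp_bounded[OF compact_continuous_image[OF assms]] by (fastforce simp: bounded_iff)
  have [measurable]: "(\<lambda>z. indicator {0..2 * pi} z *\<^sub>R G z) \<in> borel_measurable borel"
    using assms by (simp add: borel_measurable_continuous_on_indicator)
  have "(\<lambda>z. (\<lambda>z. indicator {0..2 * pi} z *\<^sub>R G z) (z - of_int \<lfloor>z / (2 * pi)\<rfloor> * (2 * pi))) \<in> borel_measurable borel"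
    by measurable
  then show m: "periodize G \<in> borel_measurable borel"
    using reduce_mod_period by (simp add: periodize_def[abs_def] indicator_def)
  show "set_integrable lborel {0..2 * pi} (\<lambda>z. (cmod (periodize G z))\<^sup>2)"
  proof (rule set_integrable_le)
    show "norm ((cmod (periodize G z))\<^sup>2) \<le> B\<^sup>2" for z
      using B[OF reduce_mod_period[of z]] by (simp add: periodize_def power_mono)
  qed (use m in \<open>auto intro: set_integrable_const_circle\<close>)
qed (rule periodize_periodic)

section \<open>Weak derivatives of periodic functions\<close>

lemma primitive_on_periodic_by_parts:
  assumes G: "primitive_on (2 * pi) G g" "G (2 * pi) = G 0"
    and \<phi>: "smooth \<phi>" "periodic_fun_simple \<phi> (2 * pi)"
  shows "(LBINT z:{0..2 * pi}. G z * vector_derivative \<phi> (at z)) = - (LBINT z:{0..2 * pi}. g z * \<phi> z)"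
proof -
  let ?\<phi>' = "\<lambda>z. vector_derivative \<phi> (at z)"
  have c: "continuous_on {0..2 * pi} ?\<phi>'" "continuous_on {0..2 * pi} \<phi>"
    using smooth_imp_continuous smooth_vector_derivative(1)[OF \<phi>(1)] \<phi>(1) by blast+
  have "primitive_on (2 * pi) (\<lambda>z. \<phi> z * G z) (\<lambda>z. ?\<phi>' z * G z + \<phi> z * g z)"
    using smooth_vector_derivative(2)[OF \<phi>(1)]
    by (intro primitive_on_mult G c) (auto intro: has_vector_derivative_at_within)
  from primitive_on_integral[OF this, of "2 * pi"]
  have "(LBINT z:{0..2 * pi}. ?\<phi>' z * G z + \<phi> z * g z) = 0"
    using G(2) periodic_fun_simple.plus_period[OF \<phi>(2), of 0] by simp
  moreover have "(LBINT z:{0..2 * pi}. ?\<phi>' z * G z + \<phi> z * g z)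
      = (LBINT z:{0..2 * pi}. ?\<phi>' z * G z) + (LBINT z:{0..2 * pi}. \<phi> z * g z)"
    using set_integrable_mult_continuous(1)[OF primitive_on_integrable[OF G(1)] c(2)]
    by (rule set_integral_add(2)[rotated])
      (intro borel_integrable_atLeastAtMost' continuous_intros c primitive_on_continuous[OF G(1)])
  ultimately show ?thesis by (simp add: mult.commute add_eq_0_iff2)
qed

lemma has_weak_deriv_if_primitive:
  assumes V: "V \<in> L2T" and G: "primitive_on (2 * pi) G g" "G (2 * pi) = G 0"
    and ae: "AE z in lborel. z \<in> {0..2 * pi} \<longrightarrow> V z = G z"
  shows "has_weak_deriv V g"
  unfolding has_weak_deriv_def
proof (intro allI impI)
  fix \<phi> :: "real \<Rightarrow> complex" assume \<phi>: "smooth \<phi> \<and> periodic_fun_simple \<phi> (2 * pi)"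
  let ?\<phi>' = "\<lambda>z. vector_derivative \<phi> (at z)"
  have c: "continuous_on {0..2 * pi} ?\<phi>'"
    using smooth_imp_continuous smooth_vector_derivative(1) \<phi> by blast
  have "(LBINT z:{0..2 * pi}. V z * ?\<phi>' z) = (LBINT z:{0..2 * pi}. G z * ?\<phi>' z)"
    unfolding set_lebesgue_integral_def
  proof (rule integral_cong_AE)
    show "AE z in lborel. indicator {0..2 * pi} z *\<^sub>R (V z * ?\<phi>' z) = indicator {0..2 * pi} z *\<^sub>R (G z * ?\<phi>' z)"
      using ae by eventually_elim (auto simp: indicator_def)
    show "(\<lambda>z. indicator {0..2 * pi} z *\<^sub>R (V z * ?\<phi>' z)) \<in> borel_measurable lborel"
      using set_integrable_mult_continuous(2)[OF L2T_set_integrable[OF V] c]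
      by (auto simp: set_integrable_def)
    have "continuous_on {0..2 * pi} (\<lambda>z. G z * ?\<phi>' z)"
      by (intro continuous_intros c primitive_on_continuous[OF G(1)])
    from borel_integrable_atLeastAtMost'[OF this]
    show "(\<lambda>z. indicator {0..2 * pi} z *\<^sub>R (G z * ?\<phi>' z)) \<in> borel_measurable lborel"
      by (auto simp: set_integrable_def)
  qed
  then show "(LBINT z:{0..2 * pi}. V z * ?\<phi>' z) = - (LBINT z:{0..2 * pi}. g z * \<phi> z)"
    using primitive_on_periodic_by_parts[OF G] \<phi> by simp
qed

text \<open>The difference of \<open>V\<close> and the primitive of \<open>g\<close> is orthogonal to every derivative, so it is
  constant; testing with a constant shows that \<open>g\<close> has mean zero and the primitive is periodic.\<close>

lemma has_weak_deriv_imp_primitive: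
  assumes V: "V \<in> L2T" and g: "g \<in> L2T" and w: "has_weak_deriv V g"
  obtains G where "primitive_on (2 * pi) G g" "G (2 * pi) = G 0"
    "AE z in lborel. z \<in> {0..2 * pi} \<longrightarrow> V z = G z"
proof -
  define F where "F z = (LBINT t:{0..z}. g t)" for z
  have F: "primitive_on (2 * pi) F g"
    using primitive_on_indefinite(1)[OF L2T_set_integrable[OF g], of 0] by (simp add: F_def[abs_def])
  have "(LBINT z:{0..2 * pi}. g z) = 0"
  proof -
    have "periodic_fun_simple (\<lambda>_::real. 1::complex) (2 * pi)" by unfold_locales simp
    then have "(LBINT z:{0..2 * pi}. V z * vector_derivative (\<lambda>_. 1) (at z)) = - (LBINT z:{0..2 * pi}. g z * 1)"
      using w smooth_const unfolding has_weak_deriv_def by blast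
    then show ?thesis by simp
  qed
  then have Fper: "F (2 * pi) = F 0"
    using primitive_on_integral[OF F, of "2 * pi"] by simp
  have "\<exists>C. AE z in lborel. z \<in> {0..2 * pi} \<longrightarrow> V z - F z = C"
  proof (rule AE_constant_if_orthogonal_to_derivatives)
    have Fi: "set_integrable lborel {0..2 * pi} F"
      by (intro borel_integrable_atLeastAtMost' primitive_on_continuous[OF F])
    show "set_integrable lborel {0..2 * pi} (\<lambda>z. V z - F z)"
      using L2T_set_integrable[OF V] Fi by auto
    fix \<phi> :: "real \<Rightarrow> complex" assume \<phi>: "smooth \<phi>" "periodic_fun_simple \<phi> (2 * pi)"
    let ?\<phi>' = "\<lambda>z. vector_derivative \<phi> (at z)"
    have c: "continuous_on {0..2 * pi} ?\<phi>'"
      using smooth_imp_continuous smooth_vector_derivative(1) \<phi> by blast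
    have "(LBINT z:{0..2 * pi}. (V z - F z) * ?\<phi>' z)
        = (LBINT z:{0..2 * pi}. V z * ?\<phi>' z) - (LBINT z:{0..2 * pi}. F z * ?\<phi>' z)"
      using set_integrable_mult_continuous(2)[OF L2T_set_integrable[OF V] c]
        set_integrable_mult_continuous(2)[OF Fi c]
      by (simp add: left_diff_distrib set_integral_diff(2))
    then show "(LBINT z:{0..2 * pi}. (V z - F z) * ?\<phi>' z) = 0"
      using primitive_on_periodic_by_parts[OF F Fper \<phi>] w \<phi> by (simp add: has_weak_deriv_def)
  qed
  then obtain C where C: "AE z in lborel. z \<in> {0..2 * pi} \<longrightarrow> V z - F z = C" by blast
  show ?thesis
  proof (rule that[of "\<lambda>z. C + F z"])
    show "primitive_on (2 * pi) (\<lambda>z. C + F z) g"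
      by (rule primitive_onI[OF primitive_on_integrable[OF F]]) (simp add: primitive_on_integral[OF F])
    show "AE z in lborel. z \<in> {0..2 * pi} \<longrightarrow> V z = C + F z"
      using C by eventually_elim (auto simp: algebra_simps)
  qed (simp add: Fper)
qed

lemma has_weak_deriv_unique:
  assumes "g \<in> L2T" "g' \<in> L2T" "has_weak_deriv V g" "has_weak_deriv V g'"
  shows "AE z in lborel. z \<in> {0..2 * pi} \<longrightarrow> g z = g' z"
proof -
  have "AE z in lborel. z \<in> {0..2 * pi} \<longrightarrow> g z - g' z = 0"
  proof (rule AE_zero_if_orthogonal_to_smooth)
    show "set_integrable lborel {0..2 * pi} (\<lambda>z. g z - g' z)"
      using assms L2T_set_integrable by auto
    fix \<phi> :: "real \<Rightarrow> complex" assume \<phi>: "smooth \<phi>" "periodic_fun_simple \<phi> (2 * pi)"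
    have "(LBINT z:{0..2 * pi}. g z * \<phi> z) = (LBINT z:{0..2 * pi}. g' z * \<phi> z)"
      using assms(3)[unfolded has_weak_deriv_def, rule_format, of \<phi>]
        assms(4)[unfolded has_weak_deriv_def, rule_format, of \<phi>] \<phi> by simp
    then show "(LBINT z:{0..2 * pi}. (g z - g' z) * \<phi> z) = 0"
      using set_integrable_mult_continuous(2)[OF L2T_set_integrable[OF assms(1)] smooth_imp_continuous[OF \<phi>(1)]]
        set_integrable_mult_continuous(2)[OF L2T_set_integrable[OF assms(2)] smooth_imp_continuous[OF \<phi>(1)]]
      by (simp add: left_diff_distrib set_integral_diff(2))
  qed
  then show ?thesis by auto
qed

lemma wderiv_props:
  assumes "g \<in> L2T" "has_weak_deriv V g"
  shows "wderiv V \<in> L2T" "has_weak_deriv V (wderiv V)"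
    "AE z in lborel. z \<in> {0..2 * pi} \<longrightarrow> wderiv V z = g z"
proof -
  have "wderiv V \<in> L2T \<and> has_weak_deriv V (wderiv V)"
    unfolding wderiv_def using assms
    by (intro someI[of "\<lambda>g. g \<in> L2T \<and> has_weak_deriv V g" g]) simp
  then show "wderiv V \<in> L2T" "has_weak_deriv V (wderiv V)" by auto
  then show "AE z in lborel. z \<in> {0..2 * pi} \<longrightarrow> wderiv V z = g z"
    using has_weak_deriv_unique assms by blast
qed

text \<open>The continuous representatives \<open>G0\<close> and \<open>G1\<close> of \<open>V\<close> and its derivative have boundary values, which carry
  the periodicity; the second derivative \<open>h\<close> is only determined up to null sets and stays a class in
  \<open>L2T\<close>.\<close>

definition H2_rep :: "(real \<Rightarrow> complex) \<Rightarrow> (real \<Rightarrow> complex) \<Rightarrow> (real \<Rightarrow> complex) \<Rightarrow> (real \<Rightarrow> complex) \<Rightarrow> bool" where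
  "H2_rep V G0 G1 h \<longleftrightarrow> V \<in> L2T \<and> h \<in> L2T \<and>
     primitive_on (2 * pi) G0 G1 \<and> primitive_on (2 * pi) G1 h \<and> G0 (2 * pi) = G0 0 \<and> G1 (2 * pi) = G1 0 \<and>
     (AE z in lborel. z \<in> {0..2 * pi} \<longrightarrow> V z = G0 z)"

lemma H2T_imp_H2_rep:
  assumes "V \<in> H2T" obtains G0 G1 h where "H2_rep V G0 G1 h"
proof -
  obtain g h where V: "V \<in> L2T" "g \<in> L2T" "h \<in> L2T" "has_weak_deriv V g" "has_weak_deriv g h"
    using assms by (auto simp: H2T_def)
  obtain G0 where G0: "primitive_on (2 * pi) G0 g" "G0 (2 * pi) = G0 0"
    "AE z in lborel. z \<in> {0..2 * pi} \<longrightarrow> V z = G0 z"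
    using has_weak_deriv_imp_primitive[OF V(1,2,4)] by blast
  obtain G1 where G1: "primitive_on (2 * pi) G1 h" "G1 (2 * pi) = G1 0"
    "AE z in lborel. z \<in> {0..2 * pi} \<longrightarrow> g z = G1 z"
    using has_weak_deriv_imp_primitive[OF V(2,3,5)] by blast
  have "primitive_on (2 * pi) G0 G1"
    by (rule primitive_on_cong_AE[OF G0(1) _ G1(3)])
      (intro borel_integrable_atLeastAtMost' primitive_on_continuous[OF G1(1)])
  then show ?thesis using that V G0 G1 unfolding H2_rep_def by blast
qed

lemma H2_rep_wderiv:
  assumes "H2_rep V G0 G1 h"
  shows "V \<in> H2T" "wderiv V \<in> L2T" "wderiv (wderiv V) \<in> L2T"
    "AE z in lborel. z \<in> {0..2 * pi} \<longrightarrow> wderiv V z = G1 z"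
    "AE z in lborel. z \<in> {0..2 * pi} \<longrightarrow> wderiv (wderiv V) z = h z"
proof -
  note r = assms[unfolded H2_rep_def]
  define g where "g = periodize G1"
  have g: "g \<in> L2T" unfolding g_def using r by (intro periodize_L2T primitive_on_continuous) blast
  have gae: "AE z in lborel. z \<in> {0..2 * pi} \<longrightarrow> g z = G1 z" unfolding g_def by (rule AE_periodize)
  then have gae': "AE z in lborel. z \<in> {0..2 * pi} \<longrightarrow> G1 z = g z" by eventually_elim auto
  have "primitive_on (2 * pi) G0 g"
    by (rule primitive_on_cong_AE[OF _ L2T_set_integrable[OF g] gae']) (use r in blast)
  then have Vg: "has_weak_deriv V g" by (rule has_weak_deriv_if_primitive[rotated]) (use r in auto)
  have gh: "has_weak_deriv g h" by (rule has_weak_deriv_if_primitive[OF g _ _ gae]) (use r in auto)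
  show "V \<in> H2T" using r g Vg gh by (auto simp: H2T_def)
  note w = wderiv_props[OF g Vg]
  show "wderiv V \<in> L2T" by (rule w)
  show wae: "AE z in lborel. z \<in> {0..2 * pi} \<longrightarrow> wderiv V z = G1 z"
    using w(3) gae by eventually_elim auto
  have "has_weak_deriv (wderiv V) h"
    by (rule has_weak_deriv_if_primitive[OF w(1) _ _ wae]) (use r in auto)
  then show "wderiv (wderiv V) \<in> L2T" "AE z in lborel. z \<in> {0..2 * pi} \<longrightarrow> wderiv (wderiv V) z = h z"
    using wderiv_props[of h "wderiv V"] r by auto
qed

lemma H2_rep_mult:
  assumes "H2_rep V G0 G1 h" and q: "\<And>z. q (z + 2 * pi) = q z" "\<And>z. q' (z + 2 * pi) = q' z"
     "\<And>z. q'' (z + 2 * pi) = q'' z" "continuous_on UNIV q''"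
    and d: "\<And>z. (q has_vector_derivative q' z) (at z)" "\<And>z. (q' has_vector_derivative q'' z) (at z)"
  shows "H2_rep (\<lambda>z. q z * V z) (\<lambda>z. q z * G0 z) (\<lambda>z. q' z * G0 z + q z * G1 z)
           (\<lambda>z. q'' z * V z + 2 * q' z * wderiv V z + q z * h z)"
proof -
  note r = assms(1)[unfolded H2_rep_def]
  note w = H2_rep_wderiv[OF assms(1)]
  have c: "continuous_on A q" "continuous_on A q'" "continuous_on A q''" for A
    using has_vector_derivative_continuous[OF d(1)] has_vector_derivative_continuous[OF d(2)]
    by (auto intro: continuous_at_imp_continuous_on continuous_on_subset[OF q(4)])
  have m1: "primitive_on (2 * pi) (\<lambda>z. q z * G0 z) (\<lambda>z. q' z * G0 z + q z * G1 z)"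
    by (rule primitive_on_mult) (use r c d in \<open>auto intro: has_vector_derivative_at_within\<close>)
  have m2: "primitive_on (2 * pi) (\<lambda>z. q z * G1 z) (\<lambda>z. q' z * G1 z + q z * h z)"
    by (rule primitive_on_mult) (use r c d in \<open>auto intro: has_vector_derivative_at_within\<close>)
  have m3: "primitive_on (2 * pi) (\<lambda>z. q' z * G0 z) (\<lambda>z. q'' z * G0 z + q' z * G1 z)"
    by (rule primitive_on_mult) (use r c d in \<open>auto intro: has_vector_derivative_at_within\<close>)
  have h: "(\<lambda>z. q'' z * V z + 2 * q' z * wderiv V z + q z * h z) \<in> L2T"
    using r w(2) q c by (intro L2T_add L2T_mult) (auto intro!: continuous_intros)
  have "AE z in lborel. z \<in> {0..2 * pi} \<longrightarrow> (q'' z * G0 z + q' z * G1 z) + (q' z * G1 z + q z * h z)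
      = q'' z * V z + 2 * q' z * wderiv V z + q z * h z"
  proof -
    have "AE z in lborel. z \<in> {0..2 * pi} \<longrightarrow> V z = G0 z" using r by blast
    then show ?thesis using w(4) by eventually_elim auto
  qed
  then have "primitive_on (2 * pi) (\<lambda>z. q' z * G0 z + q z * G1 z)
      (\<lambda>z. q'' z * V z + 2 * q' z * wderiv V z + q z * h z)"
    by (rule primitive_on_cong_AE[OF primitive_on_add[OF m3 m2] L2T_set_integrable[OF h]])
  moreover have "AE z in lborel. z \<in> {0..2 * pi} \<longrightarrow> q z * V z = q z * G0 z"
  proof -
    have "AE z in lborel. z \<in> {0..2 * pi} \<longrightarrow> V z = G0 z" using r by blast
    then show ?thesis by eventually_elim auto
  qed
  moreover have "(\<lambda>z. q z * V z) \<in> L2T" using r q c by (intro L2T_mult) auto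
  ultimately show ?thesis using h m1 r q(1)[of 0] q(2)[of 0] by (simp add: H2_rep_def)
qed

text \<open>The operator \<open>shifted_deriv\<close> is defined through a choice of weak derivatives; this identifies its first two
  iterates with classical expressions in the representatives.\<close>

lemma shifted_deriv_AE:
  assumes "H2_rep W G0 G1 h"
  shows "shifted_deriv \<mu> W \<in> L2T"
    "AE z in lborel. z \<in> {0..2 * pi} \<longrightarrow> shifted_deriv \<mu> W z = G1 z + \<i> * of_real \<mu> * G0 z"
    "shifted_deriv \<mu> (shifted_deriv \<mu> W) \<in> L2T"
    "AE z in lborel. z \<in> {0..2 * pi} \<longrightarrow>
       shifted_deriv \<mu> (shifted_deriv \<mu> W) z = h z + 2 * \<i> * of_real \<mu> * G1 z - (of_real \<mu>)\<^sup>2 * G0 z"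
proof -
  note r = assms[unfolded H2_rep_def]
  note w = H2_rep_wderiv[OF assms]
  have W: "AE z in lborel. z \<in> {0..2 * pi} \<longrightarrow> W z = G0 z" using r by blast
  show U: "shifted_deriv \<mu> W \<in> L2T" unfolding shifted_deriv_def
    using r w by (intro L2T_add L2T_cmult) auto
  show Uae: "AE z in lborel. z \<in> {0..2 * pi} \<longrightarrow> shifted_deriv \<mu> W z = G1 z + \<i> * of_real \<mu> * G0 z"
    using w(4) W by eventually_elim (auto simp: shifted_deriv_def)
  define k where "k z = h z + \<i> * of_real \<mu> * wderiv W z" for z
  have k: "k \<in> L2T" unfolding k_def[abs_def] using r w by (intro L2T_add L2T_cmult) auto
  have "primitive_on (2 * pi) (\<lambda>z. \<i> * of_real \<mu> * G0 z) (\<lambda>z. 0 * G0 z + \<i> * of_real \<mu> * G1 z)"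
    by (rule primitive_on_mult) (use r in auto)
  then have "primitive_on (2 * pi) (\<lambda>z. G1 z + \<i> * of_real \<mu> * G0 z) (\<lambda>z. h z + (0 * G0 z + \<i> * of_real \<mu> * G1 z))"
    using r by (intro primitive_on_add) auto
  moreover have "AE z in lborel. z \<in> {0..2 * pi} \<longrightarrow> h z + (0 * G0 z + \<i> * of_real \<mu> * G1 z) = k z"
    using w(4) by eventually_elim (auto simp: k_def)
  ultimately have "primitive_on (2 * pi) (\<lambda>z. G1 z + \<i> * of_real \<mu> * G0 z) k"
    by (intro primitive_on_cong_AE[OF _ L2T_set_integrable[OF k]])
  then have Uk: "has_weak_deriv (shifted_deriv \<mu> W) k"
    by (rule has_weak_deriv_if_primitive[OF U _ _ Uae]) (use r in simp)
  note u = wderiv_props[OF k Uk]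
  show "shifted_deriv \<mu> (shifted_deriv \<mu> W) \<in> L2T"
    unfolding shifted_deriv_def[of \<mu> "shifted_deriv \<mu> W"]
    using U u(1) by (intro L2T_add L2T_cmult)
  show "AE z in lborel. z \<in> {0..2 * pi} \<longrightarrow>
       shifted_deriv \<mu> (shifted_deriv \<mu> W) z = h z + 2 * \<i> * of_real \<mu> * G1 z - (of_real \<mu>)\<^sup>2 * G0 z"
    using u(3) Uae w(4)
  proof eventually_elim
    case (elim z)
    then show ?case
      by (auto simp: shifted_deriv_def[of \<mu> "shifted_deriv \<mu> W"] k_def algebra_simps power2_eq_square)
  qed
qed

section \<open>Periodic solutions of second order equations\<close>

lemma has_vector_derivative_quotient:
  fixes f g :: "real \<Rightarrow> complex"
  assumes "(f has_vector_derivative f') (at x within S)" "(g has_vector_derivative g') (at x within S)" "g x \<noteq> 0"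
  shows "((\<lambda>x. f x / g x) has_vector_derivative (f' * g x - f x * g') / (g x * g x)) (at x within S)"
  using has_derivative_divide'[OF assms(1,2)[unfolded has_vector_derivative_def] assms(3)]
  unfolding has_vector_derivative_def
  by (rule has_derivative_eq_rhs) (auto simp: scaleR_conv_of_real algebra_simps)

lemma continuous_bounded_on:
  fixes f :: "real \<Rightarrow> complex"
  assumes "continuous_on {a..b} f" obtains B where "B > 0" "\<And>z. z \<in> {a..b} \<Longrightarrow> cmod (f z) \<le> B"
  using compact_imp_bounded[OF compact_continuous_image[OF assms compact_Icc]]
  by (auto simp: bounded_pos)

text \<open>The matrix with entries \<open>m11, m12, m21, m22\<close> transports the solutions \<open>y1, y2\<close> over one period, and the
  last assumption says that 1 is not an eigenvalue of it. Solutions are only needed on \<open>{0..2 * pi}\<close>, because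
  weak derivatives of periodic functions only see one period.\<close>

locale periodic_equation =
  fixes a2 a1 a0 :: "real \<Rightarrow> complex" and y1 y1' y1'' y2 y2' y2'' :: "real \<Rightarrow> complex"
    and m11 m12 m21 m22 :: complex
  assumes a_cont: "continuous_on UNIV a2" "continuous_on UNIV a1" "continuous_on UNIV a0"
    and a_per: "\<And>z. a2 (z + 2 * pi) = a2 z" "\<And>z. a1 (z + 2 * pi) = a1 z" "\<And>z. a0 (z + 2 * pi) = a0 z"
    and a2_nonzero: "\<And>z. a2 z \<noteq> 0"
    and y1_deriv: "\<And>z. z \<in> {0..2 * pi} \<Longrightarrow> (y1 has_vector_derivative y1' z) (at z within {0..2 * pi})"
      "\<And>z. z \<in> {0..2 * pi} \<Longrightarrow> (y1' has_vector_derivative y1'' z) (at z within {0..2 * pi})"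
    and y2_deriv: "\<And>z. z \<in> {0..2 * pi} \<Longrightarrow> (y2 has_vector_derivative y2' z) (at z within {0..2 * pi})"
      "\<And>z. z \<in> {0..2 * pi} \<Longrightarrow> (y2' has_vector_derivative y2'' z) (at z within {0..2 * pi})"
    and y1_eq: "\<And>z. z \<in> {0..2 * pi} \<Longrightarrow> a2 z * y1'' z + a1 z * y1' z + a0 z * y1 z = 0"
    and y2_eq: "\<And>z. z \<in> {0..2 * pi} \<Longrightarrow> a2 z * y2'' z + a1 z * y2' z + a0 z * y2 z = 0"
    and wronskian: "\<And>z. z \<in> {0..2 * pi} \<Longrightarrow> y1 z * y2' z - y2 z * y1' z \<noteq> 0"
    and y1_end: "y1 (2 * pi) = m11 * y1 0 + m21 * y2 0" "y1' (2 * pi) = m11 * y1' 0 + m21 * y2' 0"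
    and y2_end: "y2 (2 * pi) = m12 * y1 0 + m22 * y2 0" "y2' (2 * pi) = m12 * y1' 0 + m22 * y2' 0"
    and nonresonant: "(m11 - 1) * (m22 - 1) - m12 * m21 \<noteq> 0"
begin

definition wr :: "real \<Rightarrow> complex" where "wr z = y1 z * y2' z - y2 z * y1' z"

lemma wr_nonzero: "z \<in> {0..2 * pi} \<Longrightarrow> wr z \<noteq> 0"
  using wronskian by (simp add: wr_def)

lemma a_cont': "continuous_on A a2" "continuous_on A a1" "continuous_on A a0"
  using a_cont continuous_on_subset by blast+

lemma y_cont:
  "continuous_on {0..2 * pi} y1" "continuous_on {0..2 * pi} y1'"
  "continuous_on {0..2 * pi} y2" "continuous_on {0..2 * pi} y2'"
  using has_vector_derivative_continuous[OF y1_deriv(1)] has_vector_derivative_continuous[OF y1_deriv(2)]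
    has_vector_derivative_continuous[OF y2_deriv(1)] has_vector_derivative_continuous[OF y2_deriv(2)]
  by (simp_all add: continuous_on_eq_continuous_within)

lemma y''_eq:
  assumes "z \<in> {0..2 * pi}"
  shows "y1'' z = - (a1 z * y1' z + a0 z * y1 z) / a2 z" "y2'' z = - (a1 z * y2' z + a0 z * y2 z) / a2 z"
  using y1_eq[OF assms] y2_eq[OF assms] a2_nonzero[of z] by (auto simp: field_simps add_eq_0_iff)

lemma y''_cont: "continuous_on {0..2 * pi} y1''" "continuous_on {0..2 * pi} y2''"
proof -
  have "continuous_on {0..2 * pi} (\<lambda>z. - (a1 z * y1' z + a0 z * y1 z) / a2 z)"
    by (intro continuous_intros a_cont' y_cont) (auto simp: a2_nonzero)
  then show "continuous_on {0..2 * pi} y1''" by (rule continuous_on_eq) (simp add: y''_eq)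
  have "continuous_on {0..2 * pi} (\<lambda>z. - (a1 z * y2' z + a0 z * y2 z) / a2 z)"
    by (intro continuous_intros a_cont' y_cont) (auto simp: a2_nonzero)
  then show "continuous_on {0..2 * pi} y2''" by (rule continuous_on_eq) (simp add: y''_eq)
qed

lemma wr_deriv:
  assumes "z \<in> {0..2 * pi}"
  shows "(wr has_vector_derivative y1 z * y2'' z - y2 z * y1'' z) (at z within {0..2 * pi})"
  unfolding wr_def[abs_def]
  by (rule has_vector_derivative_eq_rhs, (rule derivative_intros y1_deriv y2_deriv assms)+)
    (simp add: algebra_simps)

lemma wr_cont: "continuous_on {0..2 * pi} wr"
  unfolding wr_def[abs_def] by (intro continuous_intros y_cont)

text \<open>For a solution of the homogeneous equation the coefficients of its expansion in \<open>y1, y2\<close>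
  are constant, and periodicity makes them a fixed vector of the monodromy matrix.\<close>

lemma periodic_solution_zero:
  assumes G0: "primitive_on (2 * pi) G0 G1" and G1: "primitive_on (2 * pi) G1 h"
    and per: "G0 (2 * pi) = G0 0" "G1 (2 * pi) = G1 0"
    and ae: "AE z in lborel. z \<in> {0..2 * pi} \<longrightarrow> a2 z * h z + a1 z * G1 z + a0 z * G0 z = 0"
    and z: "z \<in> {0..2 * pi}"
  shows "G0 z = 0"
proof -
  have coeff: "\<exists>a. \<forall>z\<in>{0..2 * pi}. (G0 z * y' z - G1 z * y z) / wr z = a"
    if y: "\<And>z. z \<in> {0..2 * pi} \<Longrightarrow> (y has_vector_derivative y' z) (at z within {0..2 * pi})"
      "\<And>z. z \<in> {0..2 * pi} \<Longrightarrow> (y' has_vector_derivative y'' z) (at z within {0..2 * pi})"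
      "\<And>z. z \<in> {0..2 * pi} \<Longrightarrow> a2 z * y'' z + a1 z * y' z + a0 z * y z = 0"
      "continuous_on {0..2 * pi} y" "continuous_on {0..2 * pi} y'" "continuous_on {0..2 * pi} y''" for y y' y''
  proof -
    define w' where "w' z = y1 z * y2'' z - y2 z * y1'' z" for z
    have w'_cont: "continuous_on {0..2 * pi} w'"
      unfolding w'_def by (intro continuous_intros y_cont y''_cont)
    have quot: "((\<lambda>z. u z / wr z) has_vector_derivative (u' z * wr z - u z * w' z) / (wr z * wr z)) (at z within {0..2 * pi})"
      if "(u has_vector_derivative u' z) (at z within {0..2 * pi})" "z \<in> {0..2 * pi}" for u u' z
      using has_vector_derivative_quotient[OF that(1) wr_deriv[OF that(2)] wr_nonzero[OF that(2)]]
      by (simp add: w'_def)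
    have 1: "primitive_on (2 * pi) (\<lambda>z. (y' z / wr z) * G0 z)
        (\<lambda>z. (y'' z * wr z - y' z * w' z) / (wr z * wr z) * G0 z + (y' z / wr z) * G1 z)"
      by (rule primitive_on_mult[OF G0])
        (auto intro!: continuous_intros quot y wr_cont w'_cont simp: wr_nonzero)
    have 2: "primitive_on (2 * pi) (\<lambda>z. (y z / wr z) * G1 z)
        (\<lambda>z. (y' z * wr z - y z * w' z) / (wr z * wr z) * G1 z + (y z / wr z) * h z)"
      by (rule primitive_on_mult[OF G1])
        (auto intro!: continuous_intros quot y wr_cont w'_cont simp: wr_nonzero)
    note 3 = primitive_on_diff[OF 1 2]
    have "AE z in lborel. z \<in> {0..2 * pi} \<longrightarrow>
      ((y'' z * wr z - y' z * w' z) / (wr z * wr z) * G0 z + (y' z / wr z) * G1 z)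
      - ((y' z * wr z - y z * w' z) / (wr z * wr z) * G1 z + (y z / wr z) * h z) = 0"
      using ae
    proof eventually_elim
      case (elim z)
      show ?case
      proof
        assume z: "z \<in> {0..2 * pi}"
        have w': "a2 z * w' z = - a1 z * wr z"
          using y1_eq[OF z] y2_eq[OF z] unfolding w'_def wr_def by algebra
        have "a2 z * ((y'' z * wr z - y' z * w' z) * G0 z + y' z * wr z * G1 z
            - (y' z * wr z - y z * w' z) * G1 z - y z * wr z * h z) = 0"
          using y(3)[OF z] elim z w' by algebra
        then have "(y'' z * wr z - y' z * w' z) * G0 z + y' z * wr z * G1 z
            - (y' z * wr z - y z * w' z) * G1 z - y z * wr z * h z = 0" using a2_nonzero[of z] by simp
        then show "((y'' z * wr z - y' z * w' z) / (wr z * wr z) * G0 z + (y' z / wr z) * G1 z)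
      - ((y' z * wr z - y z * w' z) / (wr z * wr z) * G1 z + (y z / wr z) * h z) = 0"
          using wr_nonzero[OF z] by (simp add: divide_simps) algebra
      qed
    qed
    note const = primitive_on_zero_const[OF 3 this]
    have "(G0 z * y' z - G1 z * y z) / wr z = (y' 0 / wr 0) * G0 0 - (y 0 / wr 0) * G1 0"
      if z: "z \<in> {0..2 * pi}" for z
    proof -
      have "(G0 z * y' z - G1 z * y z) / wr z = (y' z / wr z) * G0 z - (y z / wr z) * G1 z"
        by (simp add: diff_divide_distrib mult.commute)
      also have "\<dots> = (y' 0 / wr 0) * G0 0 - (y 0 / wr 0) * G1 0" by (rule const[OF z])
      finally show ?thesis .
    qed
    then show ?thesis by blast
  qed
  obtain a where a: "\<And>z. z \<in> {0..2 * pi} \<Longrightarrow> (G0 z * y2' z - G1 z * y2 z) / wr z = a"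
    using coeff[of y2 y2' y2''] y2_deriv y2_eq y_cont y''_cont by blast
  obtain b where b: "\<And>z. z \<in> {0..2 * pi} \<Longrightarrow> (G0 z * y1' z - G1 z * y1 z) / wr z = b"
    using coeff[of y1 y1' y1''] y1_deriv y1_eq y_cont y''_cont by blast
  have exp: "G0 z = a * y1 z - b * y2 z" "G1 z = a * y1' z - b * y2' z" if z: "z \<in> {0..2 * pi}" for z
  proof -
    have ab: "G0 z * y2' z - G1 z * y2 z = a * wr z" "G0 z * y1' z - G1 z * y1 z = b * wr z"
      using a[OF z] b[OF z] wr_nonzero[OF z] by (auto simp: field_simps)
    have "wr z * (G0 z - (a * y1 z - b * y2 z)) = 0" "wr z * (G1 z - (a * y1' z - b * y2' z)) = 0"
      using ab unfolding wr_def by algebra+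
    then show "G0 z = a * y1 z - b * y2 z" "G1 z = a * y1' z - b * y2' z"
      using wr_nonzero[OF z] by auto
  qed
  have wr0: "wr 0 \<noteq> 0" by (rule wr_nonzero) simp
  have e: "a * y1 (2 * pi) - b * y2 (2 * pi) = a * y1 0 - b * y2 0"
    "a * y1' (2 * pi) - b * y2' (2 * pi) = a * y1' 0 - b * y2' 0"
    using per exp[of 0] exp[of "2 * pi"] by auto
  have "wr 0 * (m11 * a - m12 * b - a) = 0" "wr 0 * (m21 * a - m22 * b + b) = 0"
    using e y1_end y2_end unfolding wr_def by algebra+
  then have f: "m11 * a - m12 * b - a = 0" "m21 * a - m22 * b + b = 0" using wr0 by auto
  have "((m11 - 1) * (m22 - 1) - m12 * m21) * a = 0" "((m11 - 1) * (m22 - 1) - m12 * m21) * b = 0"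
    using f by algebra+
  then have "a = 0" "b = 0" using nonresonant by auto
  then show ?thesis using exp[OF z] by simp
qed


text \<open>Variation of constants: the coefficients of \<open>y1, y2\<close> are primitives of integrable functions,
  and their initial values solve the linear system expressing periodicity.\<close>

lemma periodic_solution_exists:
  obtains C where "C \<ge> 0" "\<And>f. f \<in> L2T \<Longrightarrow> \<exists>V G0 G1 h. H2_rep V G0 G1 h \<and>
      (\<forall>z\<in>{0..2 * pi}. cmod (G0 z) \<le> C * norm_L2T f \<and> cmod (G1 z) \<le> C * norm_L2T f) \<and>
      (AE z in lborel. z \<in> {0..2 * pi} \<longrightarrow> a2 z * h z + a1 z * G1 z + a0 z * G0 z = f z)"
proof -
  let ?I = "{0..2 * pi}"
  define q1 where "q1 z = - y2 z / (a2 z * wr z)" for z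
  define q2 where "q2 z = y1 z / (a2 z * wr z)" for z
  have q_cont: "continuous_on ?I q1" "continuous_on ?I q2" unfolding q1_def q2_def
    by (intro continuous_intros y_cont a_cont' wr_cont; simp add: a2_nonzero wr_nonzero)+
  obtain K1 where K1: "K1 > 0" "\<And>z. z \<in> ?I \<Longrightarrow> cmod (q1 z) \<le> K1" using continuous_bounded_on[OF q_cont(1)] by blast
  obtain K2 where K2: "K2 > 0" "\<And>z. z \<in> ?I \<Longrightarrow> cmod (q2 z) \<le> K2" using continuous_bounded_on[OF q_cont(2)] by blast
  obtain B1 where B1: "B1 > 0" "\<And>z. z \<in> ?I \<Longrightarrow> cmod (y1 z) \<le> B1" using continuous_bounded_on[OF y_cont(1)] by blast
  obtain B2 where B2: "B2 > 0" "\<And>z. z \<in> ?I \<Longrightarrow> cmod (y1' z) \<le> B2" using continuous_bounded_on[OF y_cont(2)] by blast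
  obtain B3 where B3: "B3 > 0" "\<And>z. z \<in> ?I \<Longrightarrow> cmod (y2 z) \<le> B3" using continuous_bounded_on[OF y_cont(3)] by blast
  obtain B4 where B4: "B4 > 0" "\<And>z. z \<in> ?I \<Longrightarrow> cmod (y2' z) \<le> B4" using continuous_bounded_on[OF y_cont(4)] by blast
  define B where "B = B1 + B2 + B3 + B4"
  have B: "B > 0" "\<And>z. z \<in> ?I \<Longrightarrow> cmod (y1 z) \<le> B" "\<And>z. z \<in> ?I \<Longrightarrow> cmod (y1' z) \<le> B"
    "\<And>z. z \<in> ?I \<Longrightarrow> cmod (y2 z) \<le> B" "\<And>z. z \<in> ?I \<Longrightarrow> cmod (y2' z) \<le> B"
    unfolding B_def using B1 B2 B3 B4 by (fastforce simp: add_nonneg_nonneg)+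
  define K where "K = (K1 + K2) * sqrt (2 * pi)"
  have K: "K > 0" unfolding K_def using K1 K2 by simp
  define d where "d = (m11 - 1) * (m22 - 1) - m12 * m21"
  have d: "d \<noteq> 0" using nonresonant by (simp add: d_def)
  define M where "M = cmod m11 + cmod m12 + cmod m21 + cmod m22 + 1"
  have M: "M \<ge> 1" by (simp add: M_def)
  define E where "E = 2 * M * M / cmod d"
  have E: "E > 0" using d M by (simp add: E_def)
  define C where "C = 2 * B * (E * K + K)"
  show ?thesis
  proof (rule that[of C])
    show "C \<ge> 0" unfolding C_def using B(1) E K by simp
    fix f assume f: "f \<in> L2T"
    define N where "N = K * norm_L2T f"
    have N: "N \<ge> 0" unfolding N_def using K norm_L2T_nonneg by simp
    define k1 where "k1 z = q1 z * f z" for z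
    define k2 where "k2 z = q2 z * f z" for z
    have ki: "set_integrable lborel ?I k1" "set_integrable lborel ?I k2"
      unfolding k1_def k2_def
      using set_integrable_mult_continuous(1)[OF L2T_set_integrable[OF f]] q_cont by blast+
    have bound: "cmod (LBINT t:{0..z}. q t * f t) \<le> N"
      if q: "continuous_on ?I q" "\<And>t. t \<in> ?I \<Longrightarrow> cmod (q t) \<le> K1 + K2" and z: "z \<in> ?I" for q z
    proof -
      have i: "set_integrable lborel ?I (\<lambda>t. q t * f t)"
        using set_integrable_mult_continuous(1)[OF L2T_set_integrable[OF f] q(1)] .
      have fi: "set_integrable lborel ?I (\<lambda>t. cmod (f t))"
        using set_integrable_cmod[OF L2T_set_integrable[OF f]] .
      have "cmod (LBINT t:{0..z}. q t * f t) \<le> (LBINT t:{0..z}. cmod (q t * f t))"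
        by (rule norm_set_integral_le[OF initial_set_integrable[OF i z]])
      also have "\<dots> \<le> (LBINT t:?I. (K1 + K2) * cmod (f t))"
        unfolding set_lebesgue_integral_def
      proof (rule integral_mono)
        show "integrable lborel (\<lambda>t. indicator {0..z} t *\<^sub>R cmod (q t * f t))"
          using set_integrable_cmod[OF initial_set_integrable[OF i z]] by (simp add: set_integrable_def)
        have "set_integrable lborel ?I (\<lambda>t. (K1 + K2) * cmod (f t))" using fi by (rule set_integrable_mult_right)
        then show "integrable lborel (\<lambda>t. indicator ?I t *\<^sub>R ((K1 + K2) * cmod (f t)))"
          by (simp add: set_integrable_def)
        show "indicator {0..z} t *\<^sub>R cmod (q t * f t) \<le> indicator ?I t *\<^sub>R ((K1 + K2) * cmod (f t))" for t
          using q(2)[of t] z K1(1) K2(1) by (auto simp: indicator_def norm_mult intro!: mult_right_mono)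
      qed
      also have "\<dots> = (K1 + K2) * (LBINT t:?I. cmod (f t))" by simp
      also have "\<dots> \<le> (K1 + K2) * (sqrt (2 * pi) * norm_L2T f)"
        using K1 K2 by (intro mult_left_mono L1_le_norm_L2T f) auto
      finally show ?thesis by (simp add: N_def K_def mult.assoc)
    qed
    have kb: "cmod (LBINT t:{0..z}. k1 t) \<le> N" "cmod (LBINT t:{0..z}. k2 t) \<le> N" if "z \<in> ?I" for z
      unfolding k1_def k2_def using K1 K2
      by (intro bound q_cont that; fastforce intro: add_increasing add_increasing2)+
    define \<kappa>1 where "\<kappa>1 = (LBINT t:?I. k1 t)"
    define \<kappa>2 where "\<kappa>2 = (LBINT t:?I. k2 t)"
    have \<kappa>: "cmod \<kappa>1 \<le> N" "cmod \<kappa>2 \<le> N" unfolding \<kappa>1_def \<kappa>2_def by (intro kb; simp)+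
    define r1 where "r1 = m11 * \<kappa>1 + m12 * \<kappa>2"
    define r2 where "r2 = m21 * \<kappa>1 + m22 * \<kappa>2"
    have r: "cmod r1 \<le> M * N" "cmod r2 \<le> M * N"
    proof -
      have "cmod r1 \<le> cmod m11 * cmod \<kappa>1 + cmod m12 * cmod \<kappa>2"
        unfolding r1_def by (metis norm_mult norm_triangle_ineq)
      also have "\<dots> \<le> cmod m11 * N + cmod m12 * N" by (intro add_mono mult_left_mono \<kappa>) auto
      also have "\<dots> \<le> M * N" unfolding distrib_right[symmetric] by (intro mult_right_mono N) (simp add: M_def)
      finally show "cmod r1 \<le> M * N" .
      have "cmod r2 \<le> cmod m21 * cmod \<kappa>1 + cmod m22 * cmod \<kappa>2"
        unfolding r2_def by (metis norm_mult norm_triangle_ineq)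
      also have "\<dots> \<le> cmod m21 * N + cmod m22 * N" by (intro add_mono mult_left_mono \<kappa>) auto
      also have "\<dots> \<le> M * N" unfolding distrib_right[symmetric] by (intro mult_right_mono N) (simp add: M_def)
      finally show "cmod r2 \<le> M * N" .
    qed
    \<comment> \<open>Cramer's rule for \<open>(M - 1) (\<alpha>0, \<beta>0) = - (r1, r2)\<close>.\<close>
    define \<alpha>0 where "\<alpha>0 = (m12 * r2 - (m22 - 1) * r1) / d"
    define \<beta>0 where "\<beta>0 = (m21 * r1 - (m11 - 1) * r2) / d"
    have sys: "m11 * (\<alpha>0 + \<kappa>1) + m12 * (\<beta>0 + \<kappa>2) = \<alpha>0" "m21 * (\<alpha>0 + \<kappa>1) + m22 * (\<beta>0 + \<kappa>2) = \<beta>0"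
    proof -
      have "d * \<alpha>0 = m12 * r2 - (m22 - 1) * r1" "d * \<beta>0 = m21 * r1 - (m11 - 1) * r2"
        using d by (simp_all add: \<alpha>0_def \<beta>0_def)
      then have "d * (m11 * (\<alpha>0 + \<kappa>1) + m12 * (\<beta>0 + \<kappa>2) - \<alpha>0) = 0"
        "d * (m21 * (\<alpha>0 + \<kappa>1) + m22 * (\<beta>0 + \<kappa>2) - \<beta>0) = 0"
        unfolding r1_def r2_def d_def by algebra+
      then show "m11 * (\<alpha>0 + \<kappa>1) + m12 * (\<beta>0 + \<kappa>2) = \<alpha>0" "m21 * (\<alpha>0 + \<kappa>1) + m22 * (\<beta>0 + \<kappa>2) = \<beta>0"
        using d by auto
    qed
    have frac: "cmod ((u * s - v * t) / d) \<le> E * N"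
      if "cmod u \<le> M" "cmod v \<le> M" "cmod s \<le> M * N" "cmod t \<le> M * N" for u v s t
    proof -
      have "cmod (u * s - v * t) \<le> cmod u * cmod s + cmod v * cmod t"
        by (metis norm_mult norm_triangle_ineq4)
      also have "\<dots> \<le> M * (M * N) + M * (M * N)"
        using that M N by (intro add_mono mult_mono) auto
      finally show ?thesis using d by (simp add: norm_divide E_def divide_right_mono field_simps)
    qed
    have m1: "cmod (m22 - 1) \<le> M" "cmod (m11 - 1) \<le> M" "cmod m12 \<le> M" "cmod m21 \<le> M"
      using norm_triangle_ineq4[of m22 1] norm_triangle_ineq4[of m11 1] unfolding M_def
      by (auto intro: add_nonneg_nonneg simp: add_increasing add_increasing2 add.assoc)
        (smt (verit) norm_ge_zero norm_one)+
    have \<alpha>\<beta>: "cmod \<alpha>0 \<le> E * N" "cmod \<beta>0 \<le> E * N"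
      unfolding \<alpha>0_def \<beta>0_def by (intro frac m1 r)+
    define \<alpha> where "\<alpha> z = \<alpha>0 + (LBINT t:{0..z}. k1 t)" for z
    define \<beta> where "\<beta> z = \<beta>0 + (LBINT t:{0..z}. k2 t)" for z
    have pr: "primitive_on (2 * pi) \<alpha> k1" "primitive_on (2 * pi) \<beta> k2"
      unfolding \<alpha>_def[abs_def] \<beta>_def[abs_def] by (rule primitive_on_indefinite ki)+
    have \<alpha>0: "\<alpha> 0 = \<alpha>0" "\<beta> 0 = \<beta>0" "\<alpha> (2 * pi) = \<alpha>0 + \<kappa>1" "\<beta> (2 * pi) = \<beta>0 + \<kappa>2"
      using primitive_on_indefinite(2)[OF ki(1)] primitive_on_indefinite(2)[OF ki(2)]
      by (simp_all add: \<alpha>_def \<beta>_def \<kappa>1_def \<kappa>2_def)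
    have \<alpha>b: "cmod (\<alpha> z) \<le> E * N + N" "cmod (\<beta> z) \<le> E * N + N" if "z \<in> ?I" for z
      unfolding \<alpha>_def \<beta>_def using kb[OF that] \<alpha>\<beta>
      by (auto intro: order_trans[OF norm_triangle_ineq add_mono])
    define G0 where "G0 z = y1 z * \<alpha> z + y2 z * \<beta> z" for z
    define G1 where "G1 z = y1' z * \<alpha> z + y2' z * \<beta> z" for z
    have p0: "primitive_on (2 * pi) G0 (\<lambda>z. (y1' z * \<alpha> z + y1 z * k1 z) + (y2' z * \<beta> z + y2 z * k2 z))"
      unfolding G0_def by (intro primitive_on_add primitive_on_mult pr y_cont y1_deriv y2_deriv)
    have p0: "primitive_on (2 * pi) G0 G1"
      by (rule primitive_on_cong[OF p0]) (auto simp: G1_def k1_def k2_def q1_def q2_def)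
    have p1: "primitive_on (2 * pi) G1 (\<lambda>z. (y1'' z * \<alpha> z + y1' z * k1 z) + (y2'' z * \<beta> z + y2' z * k2 z))"
      unfolding G1_def by (intro primitive_on_add primitive_on_mult pr y_cont y''_cont y1_deriv y2_deriv)
    have second: "a2 z * ((y1'' z * \<alpha> z + y1' z * k1 z) + (y2'' z * \<beta> z + y2' z * k2 z))
        + a1 z * G1 z + a0 z * G0 z = f z" if z: "z \<in> ?I" for z
    proof -
      have "a2 z * wr z * k1 z = - y2 z * f z" "a2 z * wr z * k2 z = y1 z * f z"
        using a2_nonzero[of z] wr_nonzero[OF z] by (simp_all add: k1_def k2_def q1_def q2_def)
      then have "wr z * (a2 z * (y1' z * k1 z + y2' z * k2 z) - f z) = 0"
        unfolding wr_def by algebra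
      then have "a2 z * (y1' z * k1 z + y2' z * k2 z) = f z" using wr_nonzero[OF z] by simp
      moreover have "a2 z * ((y1'' z * \<alpha> z + y1' z * k1 z) + (y2'' z * \<beta> z + y2' z * k2 z))
          + a1 z * G1 z + a0 z * G0 z
        = (a2 z * y1'' z + a1 z * y1' z + a0 z * y1 z) * \<alpha> z
          + (a2 z * y2'' z + a1 z * y2' z + a0 z * y2 z) * \<beta> z
          + a2 z * (y1' z * k1 z + y2' z * k2 z)"
        unfolding G0_def G1_def by (simp add: algebra_simps)
      ultimately show ?thesis using y1_eq[OF z] y2_eq[OF z] by simp
    qed
    define P0 where "P0 = periodize G0"
    define P1 where "P1 = periodize G1"
    have P: "P0 \<in> L2T" "P1 \<in> L2T" "AE z in lborel. z \<in> ?I \<longrightarrow> P0 z = G0 z" "AE z in lborel. z \<in> ?I \<longrightarrow> P1 z = G1 z"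
      unfolding P0_def P1_def
      by (rule periodize_L2T primitive_on_continuous p0 p1 AE_periodize)+
    define h where "h z = (1 / a2 z) * (f z - (a1 z * P1 z + a0 z * P0 z))" for z
    have h: "h \<in> L2T" unfolding h_def[abs_def]
      by (intro L2T_mult L2T_diff L2T_add f P a_cont continuous_intros) (auto simp: a2_nonzero a_per)
    have hae: "AE z in lborel. z \<in> ?I \<longrightarrow> a2 z * h z + a1 z * G1 z + a0 z * G0 z = f z"
      using P(3,4) by eventually_elim (auto simp: h_def a2_nonzero)
    have "AE z in lborel. z \<in> ?I \<longrightarrow> (y1'' z * \<alpha> z + y1' z * k1 z) + (y2'' z * \<beta> z + y2' z * k2 z) = h z"
      using hae
    proof eventually_elim
      case (elim z)
      show ?case
      proof
        assume z: "z \<in> ?I"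
        have "a2 z * ((y1'' z * \<alpha> z + y1' z * k1 z) + (y2'' z * \<beta> z + y2' z * k2 z)) = a2 z * h z"
          using second[OF z] elim z by (metis add_right_cancel)
        then show "(y1'' z * \<alpha> z + y1' z * k1 z) + (y2'' z * \<beta> z + y2' z * k2 z) = h z"
          using a2_nonzero[of z] by simp
      qed
    qed
    then have p1': "primitive_on (2 * pi) G1 h"
      by (rule primitive_on_cong_AE[OF p1 L2T_set_integrable[OF h]])
    have "(m11 * u + m21 * v) * (\<alpha>0 + \<kappa>1) + (m12 * u + m22 * v) * (\<beta>0 + \<kappa>2) = u * \<alpha>0 + v * \<beta>0" for u v
    proof -
      have "(m11 * u + m21 * v) * (\<alpha>0 + \<kappa>1) + (m12 * u + m22 * v) * (\<beta>0 + \<kappa>2)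
        = u * (m11 * (\<alpha>0 + \<kappa>1) + m12 * (\<beta>0 + \<kappa>2)) + v * (m21 * (\<alpha>0 + \<kappa>1) + m22 * (\<beta>0 + \<kappa>2))"
        by (simp only: distrib_left distrib_right mult.assoc mult.commute mult.left_commute add.assoc add.commute add.left_commute)
      then show ?thesis by (simp only: sys)
    qed
    then have per: "G0 (2 * pi) = G0 0" "G1 (2 * pi) = G1 0"
      unfolding G0_def G1_def \<alpha>0 y1_end y2_end by blast+
    have "H2_rep P0 G0 G1 h" unfolding H2_rep_def using P h p0 p1' per by blast
    moreover have "cmod (G0 z) \<le> C * norm_L2T f \<and> cmod (G1 z) \<le> C * norm_L2T f" if z: "z \<in> ?I" for z
    proof -
      have "cmod (u * \<alpha> z + v * \<beta> z) \<le> C * norm_L2T f" if "cmod u \<le> B" "cmod v \<le> B" for u v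
      proof -
        have "cmod (u * \<alpha> z + v * \<beta> z) \<le> cmod u * cmod (\<alpha> z) + cmod v * cmod (\<beta> z)"
          by (metis norm_mult norm_triangle_ineq)
        also have "\<dots> \<le> B * (E * N + N) + B * (E * N + N)"
          using that B(1) \<alpha>b[OF z] by (intro add_mono mult_mono) auto
        finally show ?thesis by (simp add: C_def N_def algebra_simps)
      qed
      then show ?thesis using B(2-5)[OF z] by (simp add: G0_def G1_def)
    qed
    ultimately show "\<exists>V G0 G1 h. H2_rep V G0 G1 h \<and>
      (\<forall>z\<in>{0..2 * pi}. cmod (G0 z) \<le> C * norm_L2T f \<and> cmod (G1 z) \<le> C * norm_L2T f) \<and>
      (AE z in lborel. z \<in> {0..2 * pi} \<longrightarrow> a2 z * h z + a1 z * G1 z + a0 z * G0 z = f z)"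
      using hae by blast
  qed
qed

text \<open>If \<open>T\<close> acts almost everywhere as the differential expression, then it is injective up to null
  sets and has a bounded right inverse, hence a bounded two-sided one.\<close>

theorem boundedly_invertible_if_AE_eq:
  assumes T: "\<And>V G0 G1 h. H2_rep V G0 G1 h \<Longrightarrow> T V \<in> L2T \<and>
      (AE z in lborel. z \<in> {0..2 * pi} \<longrightarrow> T V z = a2 z * h z + a1 z * G1 z + a0 z * G0 z)"
  shows "boundedly_invertible T"
proof -
  let ?I = "{0..2 * pi}"
  have TL: "T V \<in> L2T" if "V \<in> H2T" for V using H2T_imp_H2_rep[OF that] T by metis
  have uniq: "AE z in lborel. V z = W z"
    if VW: "V \<in> H2T" "W \<in> H2T" and ae: "AE z in lborel. T V z = T W z" for V W
  proof -
    obtain G0 G1 h where V: "H2_rep V G0 G1 h" using H2T_imp_H2_rep[OF VW(1)] .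
    obtain F0 F1 k where W: "H2_rep W F0 F1 k" using H2T_imp_H2_rep[OF VW(2)] .
    note v = V[unfolded H2_rep_def] and w = W[unfolded H2_rep_def]
    have p: "primitive_on (2 * pi) (\<lambda>z. G0 z - F0 z) (\<lambda>z. G1 z - F1 z)"
      "primitive_on (2 * pi) (\<lambda>z. G1 z - F1 z) (\<lambda>z. h z - k z)"
      using v w by (auto intro: primitive_on_diff)
    have "AE z in lborel. z \<in> ?I \<longrightarrow> T V z = a2 z * h z + a1 z * G1 z + a0 z * G0 z"
      "AE z in lborel. z \<in> ?I \<longrightarrow> T W z = a2 z * k z + a1 z * F1 z + a0 z * F0 z"
      using T[OF V] T[OF W] by auto
    with ae have "AE z in lborel. z \<in> ?I \<longrightarrow>
        a2 z * (h z - k z) + a1 z * (G1 z - F1 z) + a0 z * (G0 z - F0 z) = 0"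
    proof eventually_elim
      case (elim z)
      have "a2 z * (h z - k z) + a1 z * (G1 z - F1 z) + a0 z * (G0 z - F0 z)
        = (a2 z * h z + a1 z * G1 z + a0 z * G0 z) - (a2 z * k z + a1 z * F1 z + a0 z * F0 z)"
        by (simp add: algebra_simps)
      with elim show ?case by simp
    qed
    from periodic_solution_zero[OF p _ _ this]
    have "G0 z = F0 z" if "z \<in> ?I" for z using v w that by simp
    moreover have "AE z in lborel. z \<in> ?I \<longrightarrow> V z = G0 z" "AE z in lborel. z \<in> ?I \<longrightarrow> W z = F0 z"
      using v w by auto
    ultimately have "AE z in lborel. z \<in> ?I \<longrightarrow> V z = W z" by (auto elim: eventually_elim2)
    then show ?thesis using v w by (intro AE_of_AE_period L2T_D) auto
  qed
  obtain C where C: "C \<ge> 0" "\<And>f. f \<in> L2T \<Longrightarrow> \<exists>V G0 G1 h. H2_rep V G0 G1 h \<and>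
      (\<forall>z\<in>?I. cmod (G0 z) \<le> C * norm_L2T f \<and> cmod (G1 z) \<le> C * norm_L2T f) \<and>
      (AE z in lborel. z \<in> ?I \<longrightarrow> a2 z * h z + a1 z * G1 z + a0 z * G0 z = f z)"
    using periodic_solution_exists by blast
  obtain B1 where B1: "B1 > 0" "\<And>z. z \<in> ?I \<Longrightarrow> cmod (a1 z) \<le> B1" using continuous_bounded_on[OF a_cont'(2)] by blast
  obtain B0 where B0: "B0 > 0" "\<And>z. z \<in> ?I \<Longrightarrow> cmod (a0 z) \<le> B0" using continuous_bounded_on[OF a_cont'(3)] by blast
  have "continuous_on ?I (\<lambda>z. 1 / a2 z)" by (intro continuous_intros a_cont') (simp add: a2_nonzero)
  then obtain D where D: "D > 0" "\<And>z. z \<in> ?I \<Longrightarrow> cmod (1 / a2 z) \<le> D"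
    using continuous_bounded_on by blast
  define R where "R = (B1 + B0) * C"
  have R: "R \<ge> 0" using B1 B0 C by (simp add: R_def)
  define Q where "Q = 2 * (2 * pi * C\<^sup>2) + (2 * D\<^sup>2 + 2 * pi * (2 * D\<^sup>2 * R\<^sup>2))"
  have Q: "Q \<ge> 0" unfolding Q_def by simp
  have const: "(LBINT z:?I. c) = 2 * pi * c" for c :: real by (simp add: set_lebesgue_integral_def)
  have inv: "\<exists>V. V \<in> H2T \<and> (AE z in lborel. T V z = f z) \<and> norm_H2T V \<le> sqrt Q * norm_L2T f"
    if f: "f \<in> L2T" for f
  proof -
    let ?n = "norm_L2T f"
    obtain V G0 G1 h where V: "H2_rep V G0 G1 h"
      and b: "\<And>z. z \<in> ?I \<Longrightarrow> cmod (G0 z) \<le> C * ?n" "\<And>z. z \<in> ?I \<Longrightarrow> cmod (G1 z) \<le> C * ?n"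
      and ae: "AE z in lborel. z \<in> ?I \<longrightarrow> a2 z * h z + a1 z * G1 z + a0 z * G0 z = f z"
      using C(2)[OF f] by blast
    note v = V[unfolded H2_rep_def] and wd = H2_rep_wderiv[OF V]
    have Vae: "AE z in lborel. z \<in> ?I \<longrightarrow> V z = G0 z" using v by blast
    have "AE z in lborel. z \<in> ?I \<longrightarrow> T V z = a2 z * h z + a1 z * G1 z + a0 z * G0 z"
      using T[OF V] by blast
    then have "AE z in lborel. z \<in> ?I \<longrightarrow> T V z = f z" using ae by eventually_elim auto
    then have 1: "AE z in lborel. T V z = f z" using T[OF V] f by (intro AE_of_AE_period L2T_D) auto
    have n0: "(norm_L2T V)\<^sup>2 \<le> (LBINT z:?I. (C * ?n)\<^sup>2)"
    proof (rule norm_L2T_le)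
      show "AE z in lborel. z \<in> ?I \<longrightarrow> (cmod (V z))\<^sup>2 \<le> (C * ?n)\<^sup>2"
        using Vae by eventually_elim (auto intro!: power_mono b)
    qed (use v set_integrable_const_circle in auto)
    have n1: "(norm_L2T (wderiv V))\<^sup>2 \<le> (LBINT z:?I. (C * ?n)\<^sup>2)"
    proof (rule norm_L2T_le)
      show "AE z in lborel. z \<in> ?I \<longrightarrow> (cmod (wderiv V z))\<^sup>2 \<le> (C * ?n)\<^sup>2"
        using wd(4) by eventually_elim (auto intro!: power_mono b)
    qed (use wd set_integrable_const_circle in auto)
    have n2: "(norm_L2T (wderiv (wderiv V)))\<^sup>2 \<le> (LBINT z:?I. 2 * D\<^sup>2 * (cmod (f z))\<^sup>2 + 2 * D\<^sup>2 * R\<^sup>2 * ?n\<^sup>2)"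
    proof (rule norm_L2T_le)
      show "set_integrable lborel ?I (\<lambda>z. 2 * D\<^sup>2 * (cmod (f z))\<^sup>2 + 2 * D\<^sup>2 * R\<^sup>2 * ?n\<^sup>2)"
        using L2T_D(3)[OF f] by (intro set_integral_add(1) set_integrable_const_circle) auto
      show "AE z in lborel. z \<in> ?I \<longrightarrow> (cmod (wderiv (wderiv V) z))\<^sup>2 \<le> 2 * D\<^sup>2 * (cmod (f z))\<^sup>2 + 2 * D\<^sup>2 * R\<^sup>2 * ?n\<^sup>2"
        using wd(5) ae
      proof eventually_elim
        case (elim z)
        show ?case
        proof
          assume z: "z \<in> ?I"
          have "wderiv (wderiv V) z = (1 / a2 z) * (f z - (a1 z * G1 z + a0 z * G0 z))"
            using elim z a2_nonzero[of z] by (auto simp: field_simps)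
          moreover have "cmod (f z - (a1 z * G1 z + a0 z * G0 z)) \<le> cmod (f z) + R * ?n"
          proof -
            have "cmod (a1 z * G1 z + a0 z * G0 z) \<le> cmod (a1 z) * cmod (G1 z) + cmod (a0 z) * cmod (G0 z)"
              by (metis norm_mult norm_triangle_ineq)
            also have "\<dots> \<le> B1 * (C * ?n) + B0 * (C * ?n)"
              using B1 B0 z b by (intro add_mono mult_mono) auto
            finally show ?thesis
              by (intro order_trans[OF norm_triangle_ineq4]) (simp add: R_def algebra_simps)
          qed
          ultimately have "cmod (wderiv (wderiv V) z) \<le> D * (cmod (f z) + R * ?n)"
            using D(1) D(2)[OF z] by (simp only: norm_mult) (intro mult_mono; simp)
          then have "(cmod (wderiv (wderiv V) z))\<^sup>2 \<le> (D * (cmod (f z) + R * ?n))\<^sup>2" by (rule power_mono) simp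
          also have "\<dots> = D\<^sup>2 * (cmod (f z) + R * ?n)\<^sup>2" by (rule power_mult_distrib)
          also have "\<dots> \<le> D\<^sup>2 * (2 * (cmod (f z))\<^sup>2 + 2 * (R * ?n)\<^sup>2)"
            using sum_squares_bound[of "cmod (f z)" "R * ?n"] by (intro mult_left_mono) (simp_all add: power2_sum)
          finally show "(cmod (wderiv (wderiv V) z))\<^sup>2 \<le> 2 * D\<^sup>2 * (cmod (f z))\<^sup>2 + 2 * D\<^sup>2 * R\<^sup>2 * ?n\<^sup>2"
            by (simp add: power_mult_distrib algebra_simps)
        qed
      qed
    qed (use wd in auto)
    also have "\<dots> = (LBINT z:?I. 2 * D\<^sup>2 * (cmod (f z))\<^sup>2) + (LBINT z:?I. 2 * D\<^sup>2 * R\<^sup>2 * ?n\<^sup>2)"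
      using L2T_D(3)[OF f] by (intro set_integral_add(2) set_integrable_const_circle) auto
    also have "\<dots> = 2 * D\<^sup>2 * ?n\<^sup>2 + 2 * pi * (2 * D\<^sup>2 * R\<^sup>2 * ?n\<^sup>2)"
      unfolding const by (simp add: norm_L2T_power2)
    finally have "(norm_L2T V)\<^sup>2 + (norm_L2T (wderiv V))\<^sup>2 + (norm_L2T (wderiv (wderiv V)))\<^sup>2 \<le> Q * ?n\<^sup>2"
      using n0 n1 unfolding const by (simp add: Q_def power_mult_distrib algebra_simps)
    then have "norm_H2T V \<le> sqrt (Q * ?n\<^sup>2)" unfolding norm_H2T_def by (rule real_sqrt_le_mono)
    also have "\<dots> = sqrt Q * ?n" by (simp add: real_sqrt_mult norm_L2T_nonneg)
    finally show ?thesis using wd(1) 1 by blast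
  qed
  then obtain S where S: "\<And>f. f \<in> L2T \<Longrightarrow> S f \<in> H2T \<and> (AE z in lborel. T (S f) z = f z) \<and>
      norm_H2T (S f) \<le> sqrt Q * norm_L2T f"
  proof -
    have "\<forall>f\<in>L2T. \<exists>V. V \<in> H2T \<and> (AE z in lborel. T V z = f z) \<and> norm_H2T V \<le> sqrt Q * norm_L2T f"
      using inv by blast
    from bchoice[OF this] show ?thesis using that by blast
  qed
  moreover have "AE z in lborel. S (T V) z = V z" if "V \<in> H2T" for V
    by (rule uniq) (use S[OF TL[OF that]] that in blast)+
  ultimately show ?thesis unfolding boundedly_invertible_def using TL by blast
qed

end

section \<open>Resonances on the imaginary axis\<close>

text \<open>The quarter of the radius leaves room for the series of the derivative to converge with a uniform bound.\<close>

lemma powser_lipschitz: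
  fixes c :: "nat \<Rightarrow> complex"
  assumes "r > 0" "\<And>n. cmod (c n) * r ^ n \<le> B"
  obtains L where "L > 0" "\<And>x y. x \<in> ball 0 (r / 4) \<Longrightarrow> y \<in> ball 0 (r / 4) \<Longrightarrow>
    cmod ((\<Sum>n. c n * x ^ n) - (\<Sum>n. c n * y ^ n)) \<le> L * cmod (x - y)"
proof -
  have summ: "summable (\<lambda>n. c n * of_real (r / 2) ^ n)"
  proof (rule summable_comparison_test)
    show "summable (\<lambda>n. B * (1 / 2) ^ n)" by (intro summable_mult summable_geometric) simp
    have "norm (c n * of_real (r / 2) ^ n) = (cmod (c n) * r ^ n) * (1 / 2) ^ n" for n
      using \<open>r > 0\<close> by (simp add: norm_mult norm_power norm_divide power_divide)
    then show "\<exists>N. \<forall>n\<ge>N. norm (c n * of_real (r / 2) ^ n) \<le> B * (1 / 2) ^ n"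
      using assms(2) by (auto intro!: mult_right_mono)
  qed
  have nr: "norm (of_real (r / 2) :: complex) = r / 2" using \<open>r > 0\<close> by simp
  have D: "((\<lambda>x. \<Sum>n. c n * x ^ n) has_field_derivative (\<Sum>n. diffs c n * x ^ n)) (at x)"
    if "cmod x < r / 2" for x
    by (rule termdiffs_strong[OF summ]) (use that nr in simp)
  have summ': "summable (\<lambda>n. diffs c n * of_real (r / 3) ^ n)"
    by (rule termdiff_converges[of _ "r / 2"])
      (use \<open>r > 0\<close> powser_inside[OF summ] nr in auto)
  have "continuous_on (cball 0 (r / 4)) (\<lambda>x. \<Sum>n. diffs c n * x ^ n)"
    by (intro continuous_at_imp_continuous_on ballI isCont_powser[OF summ'])
      (use \<open>r > 0\<close> in \<open>simp add: norm_divide\<close>)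
  then have "bounded ((\<lambda>x. \<Sum>n. diffs c n * x ^ n) ` cball 0 (r / 4))"
    by (intro compact_imp_bounded compact_continuous_image) auto
  then obtain L where L: "L > 0" "\<And>x. x \<in> cball 0 (r / 4) \<Longrightarrow> cmod (\<Sum>n. diffs c n * x ^ n) \<le> L"
    by (auto simp: bounded_pos)
  show ?thesis
  proof (rule that[OF L(1)])
    fix x y :: complex assume "x \<in> ball 0 (r / 4)" "y \<in> ball 0 (r / 4)"
    then show "cmod ((\<Sum>n. c n * x ^ n) - (\<Sum>n. c n * y ^ n)) \<le> L * cmod (x - y)"
    proof (rule field_differentiable_bound[OF convex_ball, rotated 2])
      fix z :: complex assume z: "z \<in> ball 0 (r / 4)"
      then show "((\<lambda>x. \<Sum>n. c n * x ^ n) has_field_derivative (\<Sum>n. diffs c n * z ^ n)) (at z within ball 0 (r / 4))"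
        by (intro has_field_derivative_at_within[OF D]) (use z \<open>r > 0\<close> in simp)
      show "cmod (\<Sum>n. diffs c n * z ^ n) \<le> L" using L(2)[of z] z by simp
    qed
  qed
qed

text \<open>The function \<open>2 sinh (x / 2)\<close> has derivative 1 at zero, and it is continuously differentiable, so
  its increments are uniformly close to those of the identity.\<close>

lemma sinh_strict_derivative:
  assumes "\<kappa> > 0"
  obtains \<epsilon> where "\<epsilon> > 0" "\<And>x y::complex. x \<in> ball 0 \<epsilon> \<Longrightarrow> y \<in> ball 0 \<epsilon> \<Longrightarrow>
    cmod ((exp (x / 2) - exp (- x / 2)) - (exp (y / 2) - exp (- y / 2)) - (x - y)) \<le> \<kappa> * cmod (x - y)"
proof -
  define f where "f x = exp (x / 2) - exp (- x / 2) - x" for x :: complex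
  define f' where "f' x = exp (x / 2) / 2 + exp (- x / 2) / 2 - 1" for x :: complex
  have D: "(f has_field_derivative f' x) (at x within S)" for x S
    unfolding f_def f'_def by (auto intro!: derivative_eq_intros)
  have "isCont f' 0" unfolding f'_def by (intro continuous_intros) auto
  then obtain \<epsilon> where \<epsilon>: "\<epsilon> > 0" "\<And>x. dist x 0 < \<epsilon> \<Longrightarrow> dist (f' x) (f' 0) < \<kappa>"
    using assms unfolding continuous_at_eps_delta by blast
  show ?thesis
  proof (rule that[OF \<epsilon>(1)])
    fix x y :: complex assume xy: "x \<in> ball 0 \<epsilon>" "y \<in> ball 0 \<epsilon>"
    have "cmod (f x - f y) \<le> \<kappa> * cmod (x - y)"
    proof (rule field_differentiable_bound[OF convex_ball D _ xy])
      fix z :: complex assume "z \<in> ball 0 \<epsilon>"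
      then show "cmod (f' z) \<le> \<kappa>" using \<epsilon>(2)[of z] by (simp add: f'_def dist_norm)
    qed
    then show "cmod ((exp (x / 2) - exp (- x / 2)) - (exp (y / 2) - exp (- y / 2)) - (x - y)) \<le> \<kappa> * cmod (x - y)"
      by (simp add: f_def algebra_simps)
  qed
qed

text \<open>Taking square roots, the equation becomes \<open>2 sinh (x / 2) = \<plusminus>g \<rho>(g)\<close> with \<open>\<rho>(0) = s\<close>. The
  difference of the two sides is injective near zero because \<open>s \<noteq> P\<close>, and the equation is invariant
  under the reflection of \<open>g\<close> in the imaginary axis; so its solution lies on that axis.\<close>

lemma resonance_imaginary:
  fixes R :: "complex \<Rightarrow> complex" and s P r L :: real
  assumes s: "0 < s" "s < P" and r: "r > 0" and L: "L > 0"
    and R0: "R 0 = of_real (s\<^sup>2)"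
    and cnj: "\<And>\<nu>. cmod \<nu> < r \<Longrightarrow> cnj (R \<nu>) = R (cnj \<nu>)"
    and lip: "\<And>x y. x \<in> ball 0 r \<Longrightarrow> y \<in> ball 0 r \<Longrightarrow> cmod (R x - R y) \<le> L * cmod (x - y)"
  obtains \<epsilon> where "\<epsilon> > 0" "\<And>g \<mu>. cmod g < \<epsilon> \<Longrightarrow> \<bar>\<mu>\<bar> < \<epsilon> \<Longrightarrow>
      (let x = of_real P * g - 2 * pi * \<i> * of_real \<mu> in exp x + exp (- x) = 2 + g\<^sup>2 * R (g\<^sup>2)) \<Longrightarrow> Re g = 0"
proof -
  \<comment> \<open>Errors of relative size \<open>\<kappa>\<close> on both sides keep the slopes \<open>s\<close> and \<open>P\<close> apart.\<close>
  define \<kappa> where "\<kappa> = (P - s) / (2 * (P + 1))"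
  have \<kappa>: "\<kappa> > 0" unfolding \<kappa>_def using s by simp
  have gap: "s + \<kappa> < (1 - \<kappa>) * P"
  proof -
    have "\<kappa> * (P + 1) = (P - s) / 2" unfolding \<kappa>_def using s by (simp add: field_simps)
    then have "(1 - \<kappa>) * P - s - \<kappa> = (P - s) / 2" by (simp add: field_simps)
    then show ?thesis using s by (simp add: field_simps)
  qed
  obtain \<epsilon>1 where \<epsilon>1: "\<epsilon>1 > 0" "\<And>x y::complex. x \<in> ball 0 \<epsilon>1 \<Longrightarrow> y \<in> ball 0 \<epsilon>1 \<Longrightarrow>
    cmod ((exp (x / 2) - exp (- x / 2)) - (exp (y / 2) - exp (- y / 2)) - (x - y)) \<le> \<kappa> * cmod (x - y)"
    using sinh_strict_derivative[OF \<kappa>] by blast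
  \<comment> \<open>The third and fourth bounds keep \<open>\<rho>\<close> within \<open>\<kappa> / 3\<close> and \<open>s / 2\<close> of \<open>s\<close>; the last one keeps \<open>x\<close> small.\<close>
  define \<epsilon> where "\<epsilon> = Min {1, r, \<kappa> * s / (3 * L), s\<^sup>2 / (2 * L), \<epsilon>1 / (P + 2 * pi)}"
  have P0: "P + 2 * pi > 0" using s pi_gt_zero by linarith
  have \<epsilon>: "\<epsilon> > 0" "\<epsilon> \<le> 1" "\<epsilon> \<le> r" "\<epsilon> \<le> \<kappa> * s / (3 * L)" "\<epsilon> \<le> \<epsilon>1 / (P + 2 * pi)"
    "\<epsilon> \<le> s\<^sup>2 / (2 * L)"
  proof -
    show "\<epsilon> > 0" unfolding \<epsilon>_def using s r L \<kappa> \<epsilon>1(1) P0 by (subst Min_gr_iff) simp_all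
  qed (unfold \<epsilon>_def, (rule Min_le; simp)+)
  have \<epsilon>\<kappa>: "3 * L * \<epsilon> \<le> \<kappa> * s" using \<epsilon>(4) L by (simp add: field_simps)
  define \<rho> where "\<rho> g = csqrt (R (g\<^sup>2))" for g
  have Re\<rho>: "Re (\<rho> g) \<ge> 0" for g unfolding \<rho>_def by (rule Re_csqrt)
  have sq: "(\<rho> g)\<^sup>2 = R (g\<^sup>2)" for g by (simp add: \<rho>_def)
  have small: "cmod (g\<^sup>2) \<le> \<epsilon> * cmod g" "cmod (g\<^sup>2) < r" if "cmod g < \<epsilon>" for g
  proof -
    show *: "cmod (g\<^sup>2) \<le> \<epsilon> * cmod g" using that by (simp add: power2_eq_square norm_mult mult_right_mono)
    have "\<epsilon> * cmod g \<le> 1 * cmod g" using \<epsilon> by (intro mult_right_mono) auto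
    then show "cmod (g\<^sup>2) < r" using * that \<epsilon>(3) by simp
  qed
  have \<rho>s: "cmod (\<rho> g - of_real s) \<le> L * \<epsilon> / s" if g: "cmod g < \<epsilon>" for g
  proof -
    have "cmod (\<rho> g - of_real s) * cmod (\<rho> g + of_real s) = cmod (R (g\<^sup>2) - R 0)"
      using sq[of g] by (simp add: norm_mult[symmetric] R0 power2_eq_square algebra_simps)
    also have "\<dots> \<le> L * cmod (g\<^sup>2 - 0)" by (rule lip) (use small[OF g] r in auto)
    also have "\<dots> \<le> L * (\<epsilon> * 1)"
    proof -
      have "cmod g \<le> 1" using g \<epsilon>(2) by simp
      then have "\<epsilon> * cmod g \<le> \<epsilon> * 1" using \<epsilon>(1) by (intro mult_left_mono) auto
      then show ?thesis using small(1)[OF g] L by (intro mult_left_mono) auto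
    qed
    finally have 1: "cmod (\<rho> g - of_real s) * cmod (\<rho> g + of_real s) \<le> L * \<epsilon>" by simp
    have "s \<le> Re (\<rho> g + of_real s)" using Re\<rho>[of g] by simp
    also have "\<dots> \<le> cmod (\<rho> g + of_real s)" by (rule complex_Re_le_cmod)
    finally have "cmod (\<rho> g - of_real s) * s \<le> cmod (\<rho> g - of_real s) * cmod (\<rho> g + of_real s)"
      by (intro mult_left_mono) auto
    then show ?thesis using 1 s by (simp add: field_simps)
  qed
  have half: "s / 2 \<le> Re (\<rho> u)" if "cmod u < \<epsilon>" for u
  proof -
    have "L * \<epsilon> / s \<le> s / 2" using \<epsilon>(6) L s by (simp add: field_simps power2_eq_square)
    moreover have "\<bar>Re (\<rho> u) - s\<bar> \<le> cmod (\<rho> u - of_real s)"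
      using abs_Re_le_cmod[of "\<rho> u - of_real s"] by simp
    ultimately show ?thesis using \<rho>s[OF that] by linarith
  qed
  have strict: "cmod (g * \<rho> g - h * \<rho> h) \<le> (s + \<kappa>) * cmod (g - h)"
    if g: "cmod g < \<epsilon>" and h: "cmod h < \<epsilon>" for g h
  proof -
    have "L * \<epsilon> / s \<le> \<kappa> / 3" using \<epsilon>\<kappa> s by (simp add: field_simps)
    then have \<rho>g: "cmod (\<rho> g) \<le> s + \<kappa> / 3"
    proof -
      have "cmod (complex_of_real s) = s" using s by simp
      then show ?thesis
        using \<open>L * \<epsilon> / s \<le> \<kappa> / 3\<close> \<rho>s[OF g] norm_triangle_ineq2[of "\<rho> g" "of_real s"] by linarith
    qed
    have "cmod (\<rho> g - \<rho> h) * s \<le> cmod (\<rho> g - \<rho> h) * cmod (\<rho> g + \<rho> h)"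
    proof (rule mult_left_mono)
      have "s \<le> Re (\<rho> g + \<rho> h)" using half[OF g] half[OF h] by simp
      also have "\<dots> \<le> cmod (\<rho> g + \<rho> h)" by (rule complex_Re_le_cmod)
      finally show "s \<le> cmod (\<rho> g + \<rho> h)" .
    qed simp
    also have "\<dots> = cmod (R (g\<^sup>2) - R (h\<^sup>2))"
      using sq[of g] sq[of h] by (simp add: norm_mult[symmetric] power2_eq_square algebra_simps)
    also have "\<dots> \<le> L * cmod (g\<^sup>2 - h\<^sup>2)" by (rule lip) (use small g h in auto)
    also have "cmod (g\<^sup>2 - h\<^sup>2) = cmod (g + h) * cmod (g - h)"
      by (simp add: norm_mult[symmetric] power2_eq_square algebra_simps)
    also have "\<dots> \<le> (2 * \<epsilon>) * cmod (g - h)"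
      using g h norm_triangle_ineq[of g h] by (intro mult_right_mono) auto
    finally have "cmod (\<rho> g - \<rho> h) * s \<le> L * ((2 * \<epsilon>) * cmod (g - h))" using L by simp
    also have "\<dots> = (2 / 3) * (3 * L * \<epsilon>) * cmod (g - h)" by simp
    also have "\<dots> \<le> (2 / 3) * (\<kappa> * s) * cmod (g - h)"
      using \<epsilon>\<kappa> by (intro mult_right_mono mult_left_mono) auto
    finally have "cmod (\<rho> g - \<rho> h) * s \<le> (2 / 3 * \<kappa> * cmod (g - h)) * s" by (simp add: mult_ac)
    then have \<rho>gh: "cmod (\<rho> g - \<rho> h) \<le> 2 / 3 * \<kappa> * cmod (g - h)" using s by simp
    have "g * \<rho> g - h * \<rho> h = (g - h) * \<rho> g + h * (\<rho> g - \<rho> h)" by (simp add: algebra_simps)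
    then have "cmod (g * \<rho> g - h * \<rho> h) \<le> cmod (g - h) * cmod (\<rho> g) + cmod h * cmod (\<rho> g - \<rho> h)"
      by (metis norm_mult norm_triangle_ineq)
    also have "\<dots> \<le> cmod (g - h) * (s + \<kappa> / 3) + 1 * (2 / 3 * \<kappa> * cmod (g - h))"
      using \<rho>g \<rho>gh h \<epsilon>(2) by (intro add_mono mult_mono) auto
    finally show ?thesis by (simp add: algebra_simps)
  qed
  show ?thesis
  proof (rule that[OF \<epsilon>(1)])
    fix g :: complex and \<mu> :: real
    assume g: "cmod g < \<epsilon>" and \<mu>: "\<bar>\<mu>\<bar> < \<epsilon>"
    define x where "x = of_real P * g - 2 * pi * \<i> * of_real \<mu>"
    assume "let x = of_real P * g - 2 * pi * \<i> * of_real \<mu> in exp x + exp (- x) = 2 + g\<^sup>2 * R (g\<^sup>2)"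
    then have eq: "exp x + exp (- x) = 2 + g\<^sup>2 * R (g\<^sup>2)" by (simp add: x_def Let_def)
    define S where "S x = exp (x / 2) - exp (- x / 2)" for x :: complex
    have "(S x)\<^sup>2 = exp x + exp (- x) - 2"
    proof -
      have "(exp (x / 2))\<^sup>2 = exp x" "(exp (- x / 2))\<^sup>2 = exp (- x)" by (simp_all flip: exp_double)
      moreover have "exp (x / 2) * exp (- x / 2) = 1" by (simp flip: exp_add)
      ultimately show ?thesis by (simp add: S_def power2_diff)
    qed
    also have "\<dots> = (g * \<rho> g)\<^sup>2" using eq sq[of g] by (simp add: power_mult_distrib)
    finally have S: "S x = g * \<rho> g \<or> S x = - (g * \<rho> g)" by (simp add: power2_eq_iff)
    define h where "h = - cnj g"
    define y where "y = - cnj x"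
    have h: "cmod h < \<epsilon>" using g by (simp add: h_def)
    have "\<rho> h = cnj (\<rho> g)"
    proof -
      have "0 < Re (\<rho> g)"
        using half[OF g] s by linarith
      moreover have "(cnj (\<rho> g))\<^sup>2 = R (h\<^sup>2)"
        using arg_cong[OF sq[of g], of cnj] cnj[OF small(2)[OF g]] by (simp add: h_def)
      ultimately show ?thesis unfolding \<rho>_def[of h] by (intro csqrt_unique) auto
    qed
    moreover have "S y = - cnj (S x)" by (simp add: S_def y_def exp_cnj)
    ultimately have "S x - S y = g * \<rho> g - h * \<rho> h \<or> S x - S y = - (g * \<rho> g - h * \<rho> h)"
      using S by (auto simp: h_def)
    then have 1: "cmod (S x - S y) \<le> (s + \<kappa>) * cmod (g - h)"
      using strict[OF g h] by (metis norm_minus_cancel)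
    have xy: "x - y = of_real P * (g - h)" by (simp add: x_def y_def h_def algebra_simps)
    have "cmod x \<le> P * cmod g + 2 * pi * \<bar>\<mu>\<bar>"
      unfolding x_def by (rule order_trans[OF norm_triangle_ineq4]) (use s in \<open>simp add: norm_mult\<close>)
    also have "\<dots> < P * \<epsilon> + 2 * pi * \<epsilon>" using g \<mu> s by (intro add_strict_mono mult_strict_left_mono) auto
    also have "\<dots> = (P + 2 * pi) * \<epsilon>" by (simp add: algebra_simps)
    also have "\<dots> \<le> \<epsilon>1" using \<epsilon>(5) P0 by (simp add: field_simps)
    finally have x: "cmod x < \<epsilon>1" .
    have "cmod (S x - S y - (x - y)) \<le> \<kappa> * cmod (x - y)"
      unfolding S_def by (rule \<epsilon>1(2)) (use x in \<open>auto simp: y_def\<close>)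
    then have "cmod (x - y) - \<kappa> * cmod (x - y) \<le> cmod (S x - S y)"
      using norm_triangle_ineq2[of "x - y" "S x - S y"] by (simp add: norm_minus_commute)
    moreover have "cmod (x - y) = P * cmod (g - h)" using s by (simp add: xy norm_mult)
    ultimately have "(1 - \<kappa>) * P * cmod (g - h) \<le> (s + \<kappa>) * cmod (g - h)"
      using 1 by (simp add: algebra_simps)
    then have "cmod (g - h) = 0"
      using gap by (metis linorder_not_less mult_less_cancel_right norm_ge_zero order_le_less)
    then show "Re g = 0" by (simp add: h_def complex_eq_iff)
  qed
qed

section \<open>Linear systems depending on a parameter\<close>

lemma has_vector_derivative_suminf:
  fixes u v :: "nat \<Rightarrow> real \<Rightarrow> complex"
  assumes M: "summable M" "\<And>n x. x \<in> {a..b} \<Longrightarrow> cmod (v n x) \<le> M n"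
    and d: "\<And>n x. x \<in> {a..b} \<Longrightarrow> (u n has_vector_derivative v n x) (at x within {a..b})"
    and s: "\<And>x. x \<in> {a..b} \<Longrightarrow> summable (\<lambda>n. u n x)" and x: "x \<in> {a..b}"
  shows "((\<lambda>x. \<Sum>n. u n x) has_vector_derivative (\<Sum>n. v n x)) (at x within {a..b})"
proof -
  have ul: "uniform_limit {a..b} (\<lambda>n x. \<Sum>i<n. v i x) (\<lambda>x. \<Sum>i. v i x) sequentially"
    by (rule Weierstrass_m_test[OF _ M(1)]) (use M(2) in auto)
  have "\<exists>g. \<forall>x\<in>{a..b}. (\<lambda>n. u n x) sums g x \<and>
      (g has_derivative (\<lambda>h. h *\<^sub>R (\<Sum>n. v n x))) (at x within {a..b})"
  proof (rule has_derivative_series[where f = u and f' = "\<lambda>n x h. h *\<^sub>R v n x" and x = x])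
    show "(\<lambda>n. u n x) sums (\<Sum>n. u n x)" by (rule summable_sums[OF s[OF x]])
    show "(u n has_derivative (\<lambda>h. h *\<^sub>R v n y)) (at y within {a..b})" if "y \<in> {a..b}" for n y
      using d[OF that] by (simp add: has_vector_derivative_def)
    fix e :: real assume "e > 0"
    from uniform_limitD[OF ul this]
    show "\<forall>\<^sub>F n in sequentially. \<forall>x\<in>{a..b}. \<forall>h. norm ((\<Sum>i<n. h *\<^sub>R v i x) - h *\<^sub>R (\<Sum>n. v n x)) \<le> e * norm h"
    proof eventually_elim
      case (elim n)
      show ?case
      proof (intro ballI allI)
        fix x h assume "x \<in> {a..b}"
        then have "norm ((\<Sum>i<n. v i x) - (\<Sum>n. v n x)) \<le> e" using elim by (auto simp: dist_norm less_imp_le)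
        then have "\<bar>h\<bar> * norm ((\<Sum>i<n. v i x) - (\<Sum>n. v n x)) \<le> \<bar>h\<bar> * e" by (intro mult_left_mono) auto
        then show "norm ((\<Sum>i<n. h *\<^sub>R v i x) - h *\<^sub>R (\<Sum>n. v n x)) \<le> e * norm h"
          by (simp add: scaleR_right.sum[symmetric] scaleR_diff_right[symmetric] mult.commute)
      qed
    qed
  qed (use x in simp_all)
  then obtain g where g: "\<And>x. x \<in> {a..b} \<Longrightarrow> (\<lambda>n. u n x) sums g x"
    "\<And>x. x \<in> {a..b} \<Longrightarrow> (g has_vector_derivative (\<Sum>n. v n x)) (at x within {a..b})"
    unfolding has_vector_derivative_def by blast
  show ?thesis
    by (rule has_vector_derivative_transform[OF x _ g(2)[OF x]]) (use g(1) in \<open>simp add: sums_iff\<close>)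
qed

text \<open>The Picard iterates of \<open>(A, B)' = \<nu> K (A, B)\<close> are the coefficients of the power series of the
  solution in \<open>\<nu>\<close>.\<close>

locale parametric_system =
  fixes k11 k12 k21 k22 :: "real \<Rightarrow> real" and b :: real
  assumes b: "b \<ge> 0"
    and k_cont: "continuous_on {0..b} k11" "continuous_on {0..b} k12"
      "continuous_on {0..b} k21" "continuous_on {0..b} k22"
begin

primrec iterate :: "real \<times> real \<Rightarrow> nat \<Rightarrow> (real \<Rightarrow> real) \<times> (real \<Rightarrow> real)" where
  "iterate ab 0 = ((\<lambda>_. fst ab), (\<lambda>_. snd ab))"
| "iterate ab (Suc n) =
    ((\<lambda>z. integral {0..z} (\<lambda>t. k11 t * fst (iterate ab n) t + k12 t * snd (iterate ab n) t)),
     (\<lambda>z. integral {0..z} (\<lambda>t. k21 t * fst (iterate ab n) t + k22 t * snd (iterate ab n) t)))"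

abbreviation "A ab n \<equiv> fst (iterate ab n)"
abbreviation "B ab n \<equiv> snd (iterate ab n)"

lemma iterate_cont: "continuous_on {0..b} (A ab n)" "continuous_on {0..b} (B ab n)"
proof (induction n)
  case (Suc n)
  case 1 show ?case
    by (simp, intro indefinite_integral_continuous_1 integrable_continuous_real continuous_intros k_cont Suc)
  case 2 show ?case
    by (simp, intro indefinite_integral_continuous_1 integrable_continuous_real continuous_intros k_cont Suc)
qed simp_all

lemma iterate_Suc_deriv:
  assumes "z \<in> {0..b}"
  shows "(A ab (Suc n) has_real_derivative k11 z * A ab n z + k12 z * B ab n z) (at z within {0..b})"
    "(B ab (Suc n) has_real_derivative k21 z * A ab n z + k22 z * B ab n z) (at z within {0..b})"
proof -
  have "continuous_on {0..b} (\<lambda>z. k11 z * A ab n z + k12 z * B ab n z)"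
    "continuous_on {0..b} (\<lambda>z. k21 z * A ab n z + k22 z * B ab n z)"
    by (intro continuous_intros k_cont iterate_cont)+
  from this[THEN integral_has_vector_derivative, OF assms]
  show "(A ab (Suc n) has_real_derivative k11 z * A ab n z + k12 z * B ab n z) (at z within {0..b})"
    "(B ab (Suc n) has_real_derivative k21 z * A ab n z + k22 z * B ab n z) (at z within {0..b})"
    by (simp_all add: has_real_derivative_iff_has_vector_derivative)
qed

lemma iterate_bound:
  obtains C where "C > 0" "\<And>ab n z. z \<in> {0..b} \<Longrightarrow>
    \<bar>A ab n z\<bar> \<le> (\<bar>fst ab\<bar> + \<bar>snd ab\<bar>) * C ^ n \<and> \<bar>B ab n z\<bar> \<le> (\<bar>fst ab\<bar> + \<bar>snd ab\<bar>) * C ^ n"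
proof -
  have "\<exists>K. \<forall>z\<in>{0..b}. \<bar>k z\<bar> \<le> K" if "continuous_on {0..b} k" for k :: "real \<Rightarrow> real"
    using compact_imp_bounded[OF compact_continuous_image[OF that]] by (fastforce simp: bounded_iff)
  then obtain K1 K2 K3 K4 where K: "\<And>z. z \<in> {0..b} \<Longrightarrow> \<bar>k11 z\<bar> \<le> K1" "\<And>z. z \<in> {0..b} \<Longrightarrow> \<bar>k12 z\<bar> \<le> K2"
    "\<And>z. z \<in> {0..b} \<Longrightarrow> \<bar>k21 z\<bar> \<le> K3" "\<And>z. z \<in> {0..b} \<Longrightarrow> \<bar>k22 z\<bar> \<le> K4"
    using k_cont by metis
  define K where "K = \<bar>K1\<bar> + \<bar>K2\<bar> + \<bar>K3\<bar> + \<bar>K4\<bar> + 1"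
  have K': "\<bar>k11 z\<bar> \<le> K" "\<bar>k12 z\<bar> \<le> K" "\<bar>k21 z\<bar> \<le> K" "\<bar>k22 z\<bar> \<le> K" if "z \<in> {0..b}" for z
    using K[OF that] by (simp_all add: K_def)
  have K1: "K > 0" by (simp add: K_def)
  define C where "C = 2 * K * b + 1"
  have C: "C > 0" unfolding C_def using b K1 by (simp add: add_nonneg_pos)
  have step: "\<bar>integral {0..z} (\<lambda>t. p t * f t + q t * g t)\<bar> \<le> C * D"
    if z: "z \<in> {0..b}" and c: "continuous_on {0..b} p" "continuous_on {0..b} q" "continuous_on {0..b} f" "continuous_on {0..b} g"
      and bd: "\<And>t. t \<in> {0..b} \<Longrightarrow> \<bar>p t\<bar> \<le> K" "\<And>t. t \<in> {0..b} \<Longrightarrow> \<bar>q t\<bar> \<le> K"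
        "\<And>t. t \<in> {0..b} \<Longrightarrow> \<bar>f t\<bar> \<le> D" "\<And>t. t \<in> {0..b} \<Longrightarrow> \<bar>g t\<bar> \<le> D" for p q f g z D
  proof -
    have D: "D \<ge> 0" using bd(3)[OF z] by simp
    have "norm (integral {0..z} (\<lambda>t. p t * f t + q t * g t)) \<le> (2 * K * D) * (z - 0)"
    proof (rule integral_bound)
      show "continuous_on {0..z} (\<lambda>t. p t * f t + q t * g t)"
        by (rule continuous_on_subset[of "{0..b}"], intro continuous_intros c) (use z in auto)
      show "norm (p t * f t + q t * g t) \<le> 2 * K * D" if "t \<in> {0..z}" for t
      proof -
        have t: "t \<in> {0..b}" using that z by auto
        have "\<bar>p t * f t + q t * g t\<bar> \<le> \<bar>p t\<bar> * \<bar>f t\<bar> + \<bar>q t\<bar> * \<bar>g t\<bar>" by (simp add: abs_mult[symmetric])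
        also have "\<dots> \<le> K * D + K * D" using bd t K1 by (intro add_mono mult_mono) auto
        finally show ?thesis by (simp add: mult_ac)
      qed
    qed (use z in simp)
    also have "\<dots> \<le> (2 * K * D) * b" using z K1 D by (intro mult_left_mono) auto
    also have "\<dots> \<le> C * D" using D by (simp add: C_def algebra_simps)
    finally show ?thesis by simp
  qed
  show ?thesis
  proof (rule that[OF C])
    fix ab n z assume "z \<in> {0..b}"
    then show "\<bar>A ab n z\<bar> \<le> (\<bar>fst ab\<bar> + \<bar>snd ab\<bar>) * C ^ n \<and> \<bar>B ab n z\<bar> \<le> (\<bar>fst ab\<bar> + \<bar>snd ab\<bar>) * C ^ n"
    proof (induction n arbitrary: z)
      case (Suc n)
      let ?D = "(\<bar>fst ab\<bar> + \<bar>snd ab\<bar>) * C ^ n"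
      have "\<bar>A ab (Suc n) z\<bar> \<le> C * ?D" "\<bar>B ab (Suc n) z\<bar> \<le> C * ?D"
        unfolding iterate.simps fst_conv snd_conv
        using Suc K' by (intro step k_cont iterate_cont; blast)+
      then show ?case by (simp add: mult_ac)
    qed simp
  qed
qed

definition sol_A :: "real \<times> real \<Rightarrow> complex \<Rightarrow> real \<Rightarrow> complex" where
  "sol_A ab \<nu> z = (\<Sum>n. of_real (A ab n z) * \<nu> ^ n)"

definition sol_B :: "real \<times> real \<Rightarrow> complex \<Rightarrow> real \<Rightarrow> complex" where
  "sol_B ab \<nu> z = (\<Sum>n. of_real (B ab n z) * \<nu> ^ n)"

lemma system_solution:
  obtains r where "r > 0"
    "\<And>ab. \<exists>D. \<forall>n. \<forall>z\<in>{0..b}. \<bar>A ab n z\<bar> * r ^ n \<le> D \<and> \<bar>B ab n z\<bar> * r ^ n \<le> D"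
    "\<And>ab \<nu> z. cmod \<nu> < r \<Longrightarrow> z \<in> {0..b} \<Longrightarrow>
       summable (\<lambda>n. of_real (A ab n z) * \<nu> ^ n) \<and> summable (\<lambda>n. of_real (B ab n z) * \<nu> ^ n)"
    "\<And>ab \<nu>. cmod \<nu> < r \<Longrightarrow> sol_A ab \<nu> 0 = of_real (fst ab) \<and> sol_B ab \<nu> 0 = of_real (snd ab)"
    "\<And>ab \<nu> z. cmod \<nu> < r \<Longrightarrow> z \<in> {0..b} \<Longrightarrow>
       (sol_A ab \<nu> has_vector_derivative \<nu> * (of_real (k11 z) * sol_A ab \<nu> z + of_real (k12 z) * sol_B ab \<nu> z)) (at z within {0..b}) \<and>
       (sol_B ab \<nu> has_vector_derivative \<nu> * (of_real (k21 z) * sol_A ab \<nu> z + of_real (k22 z) * sol_B ab \<nu> z)) (at z within {0..b})"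
proof -
  obtain C where C: "C > 0" and bd: "\<And>ab n z. z \<in> {0..b} \<Longrightarrow>
    \<bar>A ab n z\<bar> \<le> (\<bar>fst ab\<bar> + \<bar>snd ab\<bar>) * C ^ n \<and> \<bar>B ab n z\<bar> \<le> (\<bar>fst ab\<bar> + \<bar>snd ab\<bar>) * C ^ n"
    using iterate_bound by blast
  have kb: "\<exists>K. \<forall>z\<in>{0..b}. \<bar>k z\<bar> \<le> K" if "continuous_on {0..b} k" for k :: "real \<Rightarrow> real"
    using compact_imp_bounded[OF compact_continuous_image[OF that]] by (fastforce simp: bounded_iff)
  define r where "r = 1 / C"
  have r: "r > 0" using C by (simp add: r_def)
  have term_bound: "cmod (of_real x * \<nu> ^ n) \<le> D * (C * cmod \<nu>) ^ n" if "\<bar>x\<bar> \<le> D * C ^ n" for x \<nu> D n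
    using mult_right_mono[OF that, of "cmod \<nu> ^ n"] by (simp add: norm_mult norm_power power_mult_distrib mult.assoc)
  have geo: "summable (\<lambda>n. D * (C * cmod \<nu>) ^ n)" if "cmod \<nu> < r" for D \<nu>
    using that C by (intro summable_mult summable_geometric) (simp add: r_def field_simps)
  have sm: "summable (\<lambda>n. of_real (A ab n z) * \<nu> ^ n)" "summable (\<lambda>n. of_real (B ab n z) * \<nu> ^ n)"
    if \<nu>: "cmod \<nu> < r" and z: "z \<in> {0..b}" for ab \<nu> z
    by (rule summable_comparison_test[OF _ geo[OF \<nu>]], use term_bound bd[OF z] in blast)+
  have deriv: "((\<lambda>z. \<Sum>n. of_real (u n z) * \<nu> ^ n) has_vector_derivative
        \<nu> * (of_real (p z) * sol_A ab \<nu> z + of_real (q z) * sol_B ab \<nu> z)) (at z within {0..b})"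
    if \<nu>: "cmod \<nu> < r" and z: "z \<in> {0..b}" and pq: "continuous_on {0..b} p" "continuous_on {0..b} q"
      and u: "\<And>z. u 0 z = u0" "\<And>n z. z \<in> {0..b} \<Longrightarrow>
         (u (Suc n) has_real_derivative p z * A ab n z + q z * B ab n z) (at z within {0..b})"
      and su: "\<And>z. z \<in> {0..b} \<Longrightarrow> summable (\<lambda>n. complex_of_real (u n z) * \<nu> ^ n)" for \<nu> z ab p q u u0
  proof -
    define v where "v n z = (case n of 0 \<Rightarrow> 0 | Suc n \<Rightarrow>
       of_real (p z * A ab n z + q z * B ab n z) * \<nu> ^ Suc n)" for n z
    obtain P where P: "\<And>z. z \<in> {0..b} \<Longrightarrow> \<bar>p z\<bar> \<le> P" using kb[OF pq(1)] by blast
    obtain Q where Q: "\<And>z. z \<in> {0..b} \<Longrightarrow> \<bar>q z\<bar> \<le> Q" using kb[OF pq(2)] by blast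
    define E where "E = (P + Q) * (\<bar>fst ab\<bar> + \<bar>snd ab\<bar>)"
    have PQ: "P \<ge> 0" "Q \<ge> 0" using P[OF z] Q[OF z] by linarith+
    have "((\<lambda>z. \<Sum>n. of_real (u n z) * \<nu> ^ n) has_vector_derivative (\<Sum>n. v n z)) (at z within {0..b})"
    proof (rule has_vector_derivative_suminf[OF _ _ _ su z])
      show "summable (\<lambda>n. E / C * (C * cmod \<nu>) ^ n)" by (rule geo[OF \<nu>])
      fix n y assume y: "y \<in> {0..b}"
      show "cmod (v n y) \<le> E / C * (C * cmod \<nu>) ^ n"
      proof (cases n)
        case 0 then show ?thesis using PQ C by (simp add: v_def E_def)
      next
        case (Suc m)
        have "\<bar>p y * A ab m y + q y * B ab m y\<bar> \<le> \<bar>p y\<bar> * \<bar>A ab m y\<bar> + \<bar>q y\<bar> * \<bar>B ab m y\<bar>"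
          by (simp add: abs_mult[symmetric])
        also have "\<dots> \<le> P * ((\<bar>fst ab\<bar> + \<bar>snd ab\<bar>) * C ^ m) + Q * ((\<bar>fst ab\<bar> + \<bar>snd ab\<bar>) * C ^ m)"
          using P[OF y] Q[OF y] bd[OF y] PQ by (intro add_mono mult_mono) auto
        also have "\<dots> = E * C ^ m" by (simp add: E_def algebra_simps)
        also have "\<dots> = E / C * C ^ n" using C Suc by simp
        finally have "cmod (of_real (p y * A ab m y + q y * B ab m y) * \<nu> ^ n) \<le> E / C * (C * cmod \<nu>) ^ n"
          by (rule term_bound)
        then show ?thesis by (simp add: v_def Suc del: of_real_add of_real_mult power_Suc)
      qed
      show "((\<lambda>z. of_real (u n z) * \<nu> ^ n) has_vector_derivative v n y) (at y within {0..b})"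
      proof (cases n)
        case 0 then show ?thesis by (simp add: v_def u(1))
      next
        case (Suc m)
        show ?thesis unfolding Suc v_def
          by (simp del: of_real_add of_real_mult power_Suc)
            (intro has_vector_derivative_mult_left has_vector_derivative_of_real u(2)[OF y])
      qed
    qed
    also have "(\<Sum>n. v n z) = \<nu> * (of_real (p z) * sol_A ab \<nu> z + of_real (q z) * sol_B ab \<nu> z)"
    proof -
      note s = sm[OF \<nu> z, of ab]
      have "(\<lambda>n. \<nu> * (of_real (p z) * (of_real (A ab n z) * \<nu> ^ n) + of_real (q z) * (of_real (B ab n z) * \<nu> ^ n)))
          sums (\<nu> * (of_real (p z) * sol_A ab \<nu> z + of_real (q z) * sol_B ab \<nu> z))"
        unfolding sol_A_def sol_B_def by (intro sums_mult sums_add summable_sums s)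
      then have "(\<lambda>n. v (Suc n) z) sums (\<nu> * (of_real (p z) * sol_A ab \<nu> z + of_real (q z) * sol_B ab \<nu> z))"
        by (simp add: v_def algebra_simps)
      then have "(\<lambda>n. v n z) sums (\<nu> * (of_real (p z) * sol_A ab \<nu> z + of_real (q z) * sol_B ab \<nu> z) + v 0 z)"
        by (rule sums_Suc)
      then show ?thesis by (simp add: sums_iff v_def)
    qed
    finally show ?thesis .
  qed
  have init: "sol_A ab \<nu> 0 = of_real (fst ab)" "sol_B ab \<nu> 0 = of_real (snd ab)" for ab \<nu>
  proof -
    have z: "A ab n 0 = (if n = 0 then fst ab else 0)" "B ab n 0 = (if n = 0 then snd ab else 0)" for n
      by (cases n; simp)+
    have "(\<Sum>n. of_real (if n = 0 then x else 0) * \<nu> ^ n) = of_real x" for x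
    proof -
      have "(\<lambda>n. of_real (if n = 0 then x else 0) * \<nu> ^ n) = (\<lambda>n. if n = 0 then of_real x else 0)" by auto
      then show ?thesis using sums_unique[OF sums_single[of 0 "\<lambda>_. complex_of_real x"]] by simp
    qed
    then show "sol_A ab \<nu> 0 = of_real (fst ab)" "sol_B ab \<nu> 0 = of_real (snd ab)"
      unfolding sol_A_def sol_B_def z by blast+
  qed
  show ?thesis
  proof (rule that[OF r])
    fix ab
    have "x * r ^ n \<le> D" if "x \<le> D * C ^ n" for x D n
      using mult_right_mono[OF that, of "r ^ n"] r C by (simp add: r_def power_divide field_simps)
    then show "\<exists>D. \<forall>n. \<forall>z\<in>{0..b}. \<bar>A ab n z\<bar> * r ^ n \<le> D \<and> \<bar>B ab n z\<bar> * r ^ n \<le> D"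
      using bd by blast
    fix \<nu> :: complex assume \<nu>: "cmod \<nu> < r"
    show "sol_A ab \<nu> 0 = of_real (fst ab) \<and> sol_B ab \<nu> 0 = of_real (snd ab)" using init by blast
    fix z assume z: "z \<in> {0..b}"
    show "summable (\<lambda>n. of_real (A ab n z) * \<nu> ^ n) \<and> summable (\<lambda>n. of_real (B ab n z) * \<nu> ^ n)"
      using sm[OF \<nu> z] by blast
    show "(sol_A ab \<nu> has_vector_derivative \<nu> * (of_real (k11 z) * sol_A ab \<nu> z + of_real (k12 z) * sol_B ab \<nu> z)) (at z within {0..b}) \<and>
       (sol_B ab \<nu> has_vector_derivative \<nu> * (of_real (k21 z) * sol_A ab \<nu> z + of_real (k22 z) * sol_B ab \<nu> z)) (at z within {0..b})"
    proof
      have eq: "(\<lambda>z. \<Sum>n. of_real (A ab n z) * \<nu> ^ n) = sol_A ab \<nu>"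
        "(\<lambda>z. \<Sum>n. of_real (B ab n z) * \<nu> ^ n) = sol_B ab \<nu>"
        by (simp_all add: sol_A_def sol_B_def fun_eq_iff)
      show "(sol_A ab \<nu> has_vector_derivative \<nu> * (of_real (k11 z) * sol_A ab \<nu> z + of_real (k12 z) * sol_B ab \<nu> z)) (at z within {0..b})"
        by (rule deriv[OF \<nu> z k_cont(1,2), of "A ab" "fst ab" ab, unfolded eq])
          (use iterate_Suc_deriv(1) sm[OF \<nu>] in \<open>simp_all del: iterate.simps(2)\<close>)
      show "(sol_B ab \<nu> has_vector_derivative \<nu> * (of_real (k21 z) * sol_A ab \<nu> z + of_real (k22 z) * sol_B ab \<nu> z)) (at z within {0..b})"
        by (rule deriv[OF \<nu> z k_cont(3,4), of "B ab" "snd ab" ab, unfolded eq])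
          (use iterate_Suc_deriv(2) sm[OF \<nu>] in \<open>simp_all del: iterate.simps(2)\<close>)
    qed
  qed
qed

end

section \<open>The linearization at a traveling wave\<close>

text \<open>The inequality \<open>m < c\<^sup>2\<close> keeps \<open>p = 3 c\<^sup>2 - 2 \<eta>\<close> above \<open>m\<close>, in particular positive, so that the profile
  equation is not degenerate. The value at zero excludes the trivial solution.\<close>

locale traveling_wave =
  fixes \<eta> :: "real \<Rightarrow> real" and c k m :: real
  assumes k: "k > 0" and smooth: "smooth \<eta>" and periodic: "periodic_fun_simple \<eta> (2 * pi)"
    and profile: "\<And>z. (3 * c\<^sup>2 - 2 * \<eta> z) * k\<^sup>2 * deriv (deriv \<eta>) z - k\<^sup>2 * (deriv \<eta> z)\<^sup>2 + \<eta> z = 0"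
    and bound: "\<And>z. \<bar>\<eta> z\<bar> \<le> m" "m < c\<^sup>2"
    and nonzero: "\<eta> 0 \<noteq> 0" and c: "c > 0"
begin

definition \<eta>1 where "\<eta>1 = deriv \<eta>"
definition \<eta>2 where "\<eta>2 = deriv \<eta>1"
definition \<eta>3 where "\<eta>3 = deriv \<eta>2"
definition p where "p z = 3 * c\<^sup>2 - 2 * \<eta> z"

lemma deriv_eta:
  "(\<eta> has_real_derivative \<eta>1 z) (at z within S)" "(\<eta>1 has_real_derivative \<eta>2 z) (at z within S)"
  "(\<eta>2 has_real_derivative \<eta>3 z) (at z within S)" "continuous_on T \<eta>3"
proof -
  obtain D where D: "D 0 = \<eta>" "\<And>n x. (D n has_vector_derivative D (Suc n) x) (at x)"
    using smooth unfolding smooth_def by blast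
  have D': "(D n has_real_derivative D (Suc n) x) (at x)" for n x
    using D(2) by (simp add: has_real_derivative_iff_has_vector_derivative)
  then have "deriv (D n) = D (Suc n)" for n by (auto intro: DERIV_imp_deriv)
  then have e: "D 0 = \<eta>" "D (Suc 0) = \<eta>1" "D (Suc (Suc 0)) = \<eta>2" "D (Suc (Suc (Suc 0))) = \<eta>3"
    using D(1) by (auto simp: \<eta>1_def \<eta>2_def \<eta>3_def)
  show "(\<eta> has_real_derivative \<eta>1 z) (at z within S)" "(\<eta>1 has_real_derivative \<eta>2 z) (at z within S)"
    "(\<eta>2 has_real_derivative \<eta>3 z) (at z within S)"
    using D'[of 0 z] D'[of "Suc 0" z] D'[of "Suc (Suc 0)" z]
    by (simp_all only: e has_field_derivative_at_within)
  show "continuous_on T \<eta>3" unfolding e(4)[symmetric]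
    using D'[THEN DERIV_isCont] by (simp add: continuous_at_imp_continuous_on)
qed

lemma eta_cont: "continuous_on T \<eta>" "continuous_on T \<eta>1" "continuous_on T \<eta>2"
  using deriv_eta(1-3)[where S = UNIV, THEN DERIV_isCont] by (simp_all add: continuous_at_imp_continuous_on)

lemma eta_per: "\<eta> (z + 2 * pi) = \<eta> z" "\<eta>1 (z + 2 * pi) = \<eta>1 z" "\<eta>2 (z + 2 * pi) = \<eta>2 z"
proof -
  have step: "g' (z + 2 * pi) = g' z"
    if "\<And>z. (g has_real_derivative g' z) (at z)" "\<And>z. g (z + 2 * pi) = g z" for g g' :: "real \<Rightarrow> real" and z
  proof -
    have "((\<lambda>z. g (z + 2 * pi)) has_real_derivative g' (z + 2 * pi)) (at z)"
      using that(1)[of "z + 2 * pi"] by (simp add: DERIV_shift)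
    then have "(g has_real_derivative g' (z + 2 * pi)) (at z)" using that(2) by simp
    then show ?thesis using that(1) DERIV_unique by blast
  qed
  show 0: "\<eta> (z + 2 * pi) = \<eta> z" for z using periodic_fun_simple.plus_period[OF periodic] .
  show 1: "\<eta>1 (z + 2 * pi) = \<eta>1 z" for z using step[OF deriv_eta(1) 0] .
  show "\<eta>2 (z + 2 * pi) = \<eta>2 z" using step[OF deriv_eta(2) 1] .
qed

lemma eta_end: "\<eta> (2 * pi) = \<eta> 0" "\<eta>1 (2 * pi) = \<eta>1 0" "\<eta>2 (2 * pi) = \<eta>2 0"
  using eta_per[of 0] by simp_all

lemma p_gt: "p z > m" "p z > 0" "m \<ge> 0"
proof -
  have "\<bar>\<eta> z\<bar> \<le> m" "m < c\<^sup>2" using bound by auto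
  then show "p z > m" "p z > 0" "m \<ge> 0" unfolding p_def by linarith+
qed

lemma p_cont: "continuous_on T p" unfolding p_def by (intro continuous_intros eta_cont)

lemma p_deriv: "(p has_real_derivative - 2 * \<eta>1 z) (at z within S)"
  unfolding p_def by (auto intro!: derivative_eq_intros deriv_eta)

lemma p_end: "p (2 * pi) = p 0" by (simp add: p_def eta_end)

lemma ode: "k\<^sup>2 * (p z * \<eta>2 z - (\<eta>1 z)\<^sup>2) + \<eta> z = 0"
  using profile[of z] by (simp add: p_def \<eta>1_def \<eta>2_def algebra_simps)

lemma ode': "k\<^sup>2 * (p z * \<eta>3 z - 4 * \<eta>1 z * \<eta>2 z) + \<eta>1 z = 0"
proof -
  have "((\<lambda>z. k\<^sup>2 * (p z * \<eta>2 z - (\<eta>1 z)\<^sup>2) + \<eta> z) has_real_derivative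
      k\<^sup>2 * (p z * \<eta>3 z - 4 * \<eta>1 z * \<eta>2 z) + \<eta>1 z) (at z)"
    by (auto intro!: derivative_eq_intros deriv_eta p_deriv simp: algebra_simps)
  moreover have "((\<lambda>z. k\<^sup>2 * (p z * \<eta>2 z - (\<eta>1 z)\<^sup>2) + \<eta> z) has_real_derivative 0) (at z)"
    using ode by simp
  ultimately show ?thesis by (rule DERIV_unique)
qed

text \<open>The energy of the profile, the first integral of its equation.\<close>

definition w where "w = p 0 * (\<eta>1 0)\<^sup>2 + (\<eta> 0)\<^sup>2 / k\<^sup>2"

text \<open>The derivative of the left-hand side is \<open>2 \<eta>' / k\<^sup>2\<close> times the left-hand side of the profile equation.\<close>

lemma energy: "p z * (\<eta>1 z)\<^sup>2 + (\<eta> z)\<^sup>2 / k\<^sup>2 = w"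
proof -
  have "((\<lambda>z. p z * (\<eta>1 z)\<^sup>2 + (\<eta> z)\<^sup>2 / k\<^sup>2) has_real_derivative 0) (at z)" for z
  proof -
    have "((\<lambda>z. p z * (\<eta>1 z)\<^sup>2 + (\<eta> z)\<^sup>2 / k\<^sup>2) has_real_derivative
        2 * \<eta>1 z / k\<^sup>2 * (k\<^sup>2 * (p z * \<eta>2 z - (\<eta>1 z)\<^sup>2) + \<eta> z)) (at z)"
      using k by (auto intro!: derivative_eq_intros deriv_eta p_deriv simp: field_simps power2_eq_square)
    then show ?thesis by (simp add: ode)
  qed
  then have "p z * (\<eta>1 z)\<^sup>2 + (\<eta> z)\<^sup>2 / k\<^sup>2 = p 0 * (\<eta>1 0)\<^sup>2 + (\<eta> 0)\<^sup>2 / k\<^sup>2"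
    by (rule DERIV_isconst_all[rule_format, rotated]) 
  then show ?thesis by (simp add: w_def)
qed

lemma w_pos: "w > 0"
  unfolding w_def using p_gt(2)[of 0] nonzero k by (intro add_nonneg_pos) auto

text \<open>At a critical point of the profile the energy is \<open>\<eta>\<^sup>2 / k\<^sup>2\<close>.\<close>

lemma k_sqrt_w: "k * sqrt w \<le> m"
proof -
  obtain z where "\<eta>1 z = 0"
    using Rolle_deriv[of 0 "2 * pi" \<eta> "\<lambda>z h. \<eta>1 z * h"] eta_end(1) eta_cont(1) deriv_eta(1)[where S = UNIV]
    by (auto simp: has_field_derivative_def fun_eq_iff)
  then have "w = (\<eta> z / k)\<^sup>2" using energy[of z] by (simp add: power_divide)
  then have "sqrt w = \<bar>\<eta> z\<bar> / k" using k by (simp add: abs_divide)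
  then show ?thesis using bound(1)[of z] k by simp
qed

definition Q where "Q z = integral {0..z} (\<lambda>t. \<eta> t / p t)"

lemma Q_deriv:
  assumes "z \<in> {0..2 * pi}"
  shows "(Q has_real_derivative \<eta> z / p z) (at z within {0..2 * pi})"
proof -
  have "continuous_on {0..2 * pi} (\<lambda>t. \<eta> t / p t)"
    by (intro continuous_intros eta_cont p_cont) (use p_gt(2) in \<open>metis less_irrefl\<close>)
  from integral_has_vector_derivative[OF this assms] show ?thesis
    by (simp add: Q_def[abs_def] has_real_derivative_iff_has_vector_derivative)
qed

lemma Q_cont: "continuous_on {0..2 * pi} Q"
  using Q_deriv[THEN DERIV_continuous] by (simp add: continuous_on_eq_continuous_within)

lemma Q_0: "Q 0 = 0" by (simp add: Q_def)

text \<open>Translation invariance gives the solution \<open>\<eta>'\<close> of the linearized profile equation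
  \<open>p u'' + p' u' + (p'' + 1 / k\<^sup>2) u = 0\<close>. Up to a constant factor, \<open>\<psi>\<close> is the derivative of the profile
  along the solutions of the profile equation with the same speed and varying amplitude; their period
  varies as well, whence the term with \<open>Q\<close>, which is not periodic.\<close>

definition \<psi> where "\<psi> z = \<eta> z + \<eta>1 z * Q z"
definition \<psi>1 where "\<psi>1 z = \<eta>1 z + \<eta>2 z * Q z + \<eta>1 z * \<eta> z / p z"
definition \<psi>2 where "\<psi>2 z = \<eta>2 z + \<eta>3 z * Q z + \<eta>2 z * \<eta> z / p z
   + (\<eta>2 z * \<eta> z + (\<eta>1 z)\<^sup>2) / p z + 2 * (\<eta>1 z)\<^sup>2 * \<eta> z / (p z)\<^sup>2"

lemma psi_deriv:
  assumes z: "z \<in> {0..2 * pi}"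
  shows "(\<psi> has_real_derivative \<psi>1 z) (at z within {0..2 * pi})"
    "(\<psi>1 has_real_derivative \<psi>2 z) (at z within {0..2 * pi})"
proof -
  have p: "p z \<noteq> 0" using p_gt(2)[of z] by simp
  show "(\<psi> has_real_derivative \<psi>1 z) (at z within {0..2 * pi})"
  proof -
    have "((\<lambda>z. \<eta> z + \<eta>1 z * Q z) has_real_derivative \<eta>1 z + (\<eta>2 z * Q z + \<eta> z / p z * \<eta>1 z)) (at z within {0..2 * pi})"
      by (intro DERIV_add DERIV_mult deriv_eta Q_deriv z)
    then show ?thesis by (simp add: \<psi>_def[abs_def] \<psi>1_def add.assoc mult.commute)
  qed
  show "(\<psi>1 has_real_derivative \<psi>2 z) (at z within {0..2 * pi})"
  proof -
    have "((\<lambda>z. \<eta>1 z + \<eta>2 z * Q z + \<eta>1 z * \<eta> z / p z) has_real_derivative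
        \<eta>2 z + (\<eta>3 z * Q z + \<eta> z / p z * \<eta>2 z)
        + ((\<eta>2 z * \<eta> z + \<eta>1 z * \<eta>1 z) * p z - \<eta>1 z * \<eta> z * (- 2 * \<eta>1 z)) / (p z * p z)) (at z within {0..2 * pi})"
      by (intro DERIV_add DERIV_mult DERIV_divide deriv_eta Q_deriv p_deriv z p)
    moreover have "\<eta>2 z + (\<eta>3 z * Q z + \<eta> z / p z * \<eta>2 z)
        + ((\<eta>2 z * \<eta> z + \<eta>1 z * \<eta>1 z) * p z - \<eta>1 z * \<eta> z * (- 2 * \<eta>1 z)) / (p z * p z) = \<psi>2 z"
      unfolding \<psi>2_def using p by (simp add: field_simps power2_eq_square)
    ultimately show ?thesis by (simp add: \<psi>1_def[abs_def])
  qed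
qed

lemma psi_cont: "continuous_on {0..2 * pi} \<psi>"
  unfolding \<psi>_def by (intro continuous_intros eta_cont Q_cont)

lemma eta1_eq: "k\<^sup>2 * (p z * \<eta>3 z - 2 * \<eta>1 z * \<eta>2 z - 2 * \<eta>2 z * \<eta>1 z) + \<eta>1 z = 0"
  using ode'[of z] by (simp add: algebra_simps)

text \<open>The left-hand side is the profile equation for \<open>\<eta>\<close> plus \<open>Q\<close> times its derivative.\<close>

lemma psi_eq: "k\<^sup>2 * (p z * \<psi>2 z - 2 * \<eta>1 z * \<psi>1 z - 2 * \<eta>2 z * \<psi> z) + \<psi> z = 0"
proof -
  have p: "p z \<noteq> 0" using p_gt(2)[of z] by simp
  have "p z * \<psi>2 z - 2 * \<eta>1 z * \<psi>1 z - 2 * \<eta>2 z * \<psi> z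
    = p z * \<eta>2 z - (\<eta>1 z)\<^sup>2 + Q z * (p z * \<eta>3 z - 4 * \<eta>1 z * \<eta>2 z)"
    unfolding \<psi>_def \<psi>1_def \<psi>2_def using p by (simp add: field_simps power2_eq_square)
  then have "k\<^sup>2 * (p z * \<psi>2 z - 2 * \<eta>1 z * \<psi>1 z - 2 * \<eta>2 z * \<psi> z) + \<psi> z
    = (k\<^sup>2 * (p z * \<eta>2 z - (\<eta>1 z)\<^sup>2) + \<eta> z) + Q z * (k\<^sup>2 * (p z * \<eta>3 z - 4 * \<eta>1 z * \<eta>2 z) + \<eta>1 z)"
    by (simp only:) (simp add: \<psi>_def algebra_simps)
  then show ?thesis by (simp add: ode ode')
qed

lemma psi_wronskian: "p z * (\<eta>1 z * \<psi>1 z - \<psi> z * \<eta>2 z) = w"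
proof -
  have p: "p z \<noteq> 0" using p_gt(2)[of z] by simp
  have "p z * (\<eta>1 z * \<psi>1 z - \<psi> z * \<eta>2 z) = p z * (\<eta>1 z)\<^sup>2 - \<eta> z * (p z * \<eta>2 z - (\<eta>1 z)\<^sup>2)"
    unfolding \<psi>_def \<psi>1_def using p by (simp add: field_simps power2_eq_square)
  also have "p z * \<eta>2 z - (\<eta>1 z)\<^sup>2 = - \<eta> z / k\<^sup>2" using ode[of z] k by (simp add: field_simps)
  also have "p z * (\<eta>1 z)\<^sup>2 - \<eta> z * (- \<eta> z / k\<^sup>2) = w" using energy[of z] by (simp add: power2_eq_square)
  finally show ?thesis .
qed

definition q0 where "q0 = Q (2 * pi)"

lemma psi_end: "\<psi> 0 = \<eta> 0" "\<psi> (2 * pi) = \<psi> 0 + q0 * \<eta>1 0" "\<psi>1 (2 * pi) = \<psi>1 0 + q0 * \<eta>2 0"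
  by (simp_all add: \<psi>_def \<psi>1_def eta_end p_end Q_0 q0_def)

definition N where "N = integral {0..2 * pi} (\<lambda>z. (\<eta>1 z)\<^sup>2 / p z)"
definition P where "P = integral {0..2 * pi} (\<lambda>z. 1 / p z)"

lemma inv_p_cont: "continuous_on T (\<lambda>z. 1 / p z)"
  by (intro continuous_intros p_cont) (use p_gt(2) in \<open>metis less_irrefl\<close>)

lemma N_integrand_cont: "continuous_on T (\<lambda>z. (\<eta>1 z)\<^sup>2 / p z)"
  by (intro continuous_intros p_cont eta_cont) (use p_gt(2) in \<open>metis less_irrefl\<close>)

text \<open>By the profile equation \<open>\<eta> / p\<close> and \<open>k\<^sup>2 \<eta>'\<^sup>2 / p\<close> differ by the derivative of a periodic function.\<close>

lemma q0_eq: "q0 = k\<^sup>2 * N"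
proof -
  have "((\<lambda>z. Q z + k\<^sup>2 * \<eta>1 z) has_vector_derivative k\<^sup>2 * ((\<eta>1 z)\<^sup>2 / p z)) (at z within {0..2 * pi})"
    if z: "z \<in> {0..2 * pi}" for z
  proof -
    have p: "p z \<noteq> 0" using p_gt(2)[of z] by simp
    have "((\<lambda>z. Q z + k\<^sup>2 * \<eta>1 z) has_real_derivative \<eta> z / p z + k\<^sup>2 * \<eta>2 z) (at z within {0..2 * pi})"
      by (auto intro!: derivative_eq_intros deriv_eta Q_deriv z)
    moreover have "\<eta> z / p z + k\<^sup>2 * \<eta>2 z = k\<^sup>2 * ((\<eta>1 z)\<^sup>2 / p z)"
      using ode[of z] p by (simp add: field_simps)
    ultimately show ?thesis by (simp add: has_real_derivative_iff_has_vector_derivative)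
  qed
  then have "((\<lambda>z. k\<^sup>2 * ((\<eta>1 z)\<^sup>2 / p z)) has_integral
     (Q (2 * pi) + k\<^sup>2 * \<eta>1 (2 * pi)) - (Q 0 + k\<^sup>2 * \<eta>1 0)) {0..2 * pi}"
    by (intro fundamental_theorem_of_calculus) auto
  moreover have "((\<lambda>z. k\<^sup>2 * ((\<eta>1 z)\<^sup>2 / p z)) has_integral k\<^sup>2 * N) {0..2 * pi}"
    unfolding N_def
    by (intro has_integral_mult_right integrable_integral integrable_continuous_real N_integrand_cont)
  ultimately have "k\<^sup>2 * N = (Q (2 * pi) + k\<^sup>2 * \<eta>1 (2 * pi)) - (Q 0 + k\<^sup>2 * \<eta>1 0)"
    by (rule has_integral_unique[rotated])
  then show ?thesis by (simp add: eta_end Q_0 q0_def)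
qed

lemma P_pos: "P > 0"
proof -
  have "P \<noteq> 0" unfolding P_def
  proof
    assume "integral {0..2 * pi} (\<lambda>z. 1 / p z) = 0"
    then have "1 / p 0 = 0"
      using integral_eq_0_iff[of 0 "2 * pi" "\<lambda>z. 1 / p z"] inv_p_cont p_gt(2)
      by (auto simp: less_imp_le)
    then show False using p_gt(2)[of 0] by simp
  qed
  moreover have "P \<ge> 0" unfolding P_def using p_gt(2) by (intro integral_nonneg integrable_continuous_real inv_p_cont) (auto intro: less_imp_le)
  ultimately show ?thesis by simp
qed

text \<open>If \<open>\<eta>'\<close> vanished identically, so would \<open>\<eta>\<close> by the profile equation, and with it the energy.\<close>

lemma N_pos: "N > 0"
proof -
  have "N \<noteq> 0"
  proof
    assume "N = 0"
    then have "\<forall>z\<in>{0..2 * pi}. (\<eta>1 z)\<^sup>2 / p z = 0" unfolding N_def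
      by (subst (asm) integral_eq_0_iff) (use N_integrand_cont p_gt(2) in \<open>auto intro!: divide_nonneg_pos\<close>)
    then have z: "\<eta>1 z = 0" if "z \<in> {0..2 * pi}" for z using p_gt(2)[of z] that by (metis divide_eq_0_iff less_irrefl power2_eq_iff zero_eq_power2)
    have "\<eta>2 pi = 0"
    proof (rule DERIV_local_const[OF deriv_eta(2), of pi])
      show "\<forall>y. \<bar>pi - y\<bar> < pi \<longrightarrow> \<eta>1 pi = \<eta>1 y"
      proof (intro allI impI)
        fix y assume "\<bar>pi - y\<bar> < pi"
        then have "y \<in> {0..2 * pi}" by (simp add: abs_less_iff)
        then show "\<eta>1 pi = \<eta>1 y" using z[of y] z[of pi] by simp
      qed
    qed simp
    then have "\<eta> pi = 0" using ode[of pi] z[of pi] by simp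
    then have "w = 0" using energy[of pi] z[of pi] by simp
    then show False using w_pos by simp
  qed
  moreover have "N \<ge> 0" unfolding N_def using p_gt(2)
    by (intro integral_nonneg integrable_continuous_real N_integrand_cont) (intro divide_nonneg_pos zero_le_power2)
  ultimately show ?thesis by simp
qed

text \<open>The square of this number is the derivative at zero of the trace of the monodromy matrix.\<close>

definition s where "s = k * N / sqrt w"

lemma s_pos: "s > 0" unfolding s_def using k N_pos w_pos by simp

text \<open>Pointwise \<open>k \<eta>'\<^sup>2 \<le> k w / p \<le> (m / p) \<surd>w\<close> and \<open>m / p < 1\<close>.\<close>

lemma s_less_P: "s < P"
proof -
  define t where "t = m / (3 * c\<^sup>2 - 2 * m)"
  have t: "t < 1" using bound(2) p_gt(3) by (simp add: t_def field_simps)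
  have "N \<le> integral {0..2 * pi} (\<lambda>z. t * sqrt w / k * (1 / p z))" unfolding N_def
  proof (rule integral_le)
    show "(\<lambda>z. t * sqrt w / k * (1 / p z)) integrable_on {0..2 * pi}"
      by (intro integrable_continuous_real continuous_on_mult_left inv_p_cont)
    fix z
    have p: "p z > 0" "p z \<ge> 3 * c\<^sup>2 - 2 * m" "3 * c\<^sup>2 - 2 * m > 0"
      using p_gt bound(1)[of z] bound(2) by (auto simp: p_def)
    have "k * (p z * (\<eta>1 z)\<^sup>2) \<le> k * (w)"
    proof (rule mult_left_mono)
      have "0 \<le> (\<eta> z)\<^sup>2 / k\<^sup>2" by simp
      then show "p z * (\<eta>1 z)\<^sup>2 \<le> w" using energy[of z] by linarith
    qed (use k in simp)
    also have "\<dots> = (k * sqrt w) * sqrt w" using w_pos by simp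
    also have "\<dots> \<le> m * sqrt w" using k_sqrt_w w_pos by (intro mult_right_mono) auto
    also have "\<dots> \<le> (t * p z) * sqrt w"
    proof (rule mult_right_mono)
      have "m = t * (3 * c\<^sup>2 - 2 * m)" using p(3) by (simp add: t_def)
      also have "\<dots> \<le> t * p z" using p p_gt(3) by (intro mult_left_mono) (auto simp: t_def)
      finally show "m \<le> t * p z" .
    qed (use w_pos in simp)
    finally have "(\<eta>1 z)\<^sup>2 \<le> t * sqrt w / k" using k p by (simp add: field_simps)
    from divide_right_mono[OF this, of "p z"]
    show "(\<eta>1 z)\<^sup>2 / p z \<le> t * sqrt w / k * (1 / p z)" using p(1) by simp
  qed (intro integrable_continuous_real N_integrand_cont)
  also have "\<dots> = t * sqrt w / k * P" unfolding P_def by (rule integral_mult_right)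
  finally have "k * N / sqrt w \<le> t * P" using k w_pos by (simp add: field_simps)
  also have "\<dots> < P" using t P_pos by simp
  finally show ?thesis by (simp add: s_def)
qed


section \<open>Monodromy of the Hill equation\<close>

text \<open>Variation of constants for the perturbation \<open>\<nu> u / p\<close>: the coefficients of \<open>\<eta>', \<psi>\<close> satisfy a
  linear system whose matrix is \<open>\<nu>\<close> times a real traceless matrix.\<close>

definition k11 where "k11 z = - \<psi> z * \<eta>1 z / (w * p z)"
definition k12 where "k12 z = - (\<psi> z)\<^sup>2 / (w * p z)"
definition k21 where "k21 z = (\<eta>1 z)\<^sup>2 / (w * p z)"
definition k22 where "k22 z = \<eta>1 z * \<psi> z / (w * p z)"

sublocale parametric_system k11 k12 k21 k22 "2 * pi"
proof
  have "w * p z \<noteq> 0" for z using w_pos p_gt(2)[of z] by simp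
  then show "continuous_on {0..2 * pi} k11" "continuous_on {0..2 * pi} k12"
      "continuous_on {0..2 * pi} k21" "continuous_on {0..2 * pi} k22"
    unfolding k11_def k12_def k21_def k22_def
    by (auto intro!: continuous_intros psi_cont eta_cont p_cont)
qed simp

lemma k_trace: "k22 z = - k11 z" by (simp add: k11_def k22_def)

text \<open>The coefficients of the power series of the trace of the monodromy matrix.\<close>

definition disc :: "nat \<Rightarrow> real" where
  "disc n = A (1, 0) n (2 * pi) + B (0, 1) n (2 * pi) + q0 * B (1, 0) n (2 * pi)"

lemma disc_0: "disc 0 = 2" by (simp add: disc_def)

text \<open>Since the matrix is traceless, its diagonal contributes nothing in first order; what remains comes from
  the growth \<open>q0\<close> of \<open>\<psi>\<close> over a period.\<close>

lemma disc_1: "disc (Suc 0) = s\<^sup>2"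
proof -
  have "k21 = (\<lambda>z. 1 / w * ((\<eta>1 z)\<^sup>2 / p z))" by (simp add: k21_def fun_eq_iff)
  then have 1: "integral {0..2 * pi} k21 = 1 / w * N" unfolding N_def by (simp only: integral_mult_right)
  have "k22 = (\<lambda>z. - k11 z)" by (simp add: k_trace fun_eq_iff)
  then have 2: "integral {0..2 * pi} k22 = - integral {0..2 * pi} k11" by (simp only: integral_neg)
  have "disc (Suc 0) = integral {0..2 * pi} k11 + integral {0..2 * pi} k22 + q0 * integral {0..2 * pi} k21"
    by (simp add: disc_def)
  also have "\<dots> = q0 * (N / w)" by (simp add: 1 2)
  also have "\<dots> = s\<^sup>2" using w_pos by (simp add: q0_eq s_def power_divide power_mult_distrib power2_eq_square)
  finally show ?thesis .
qed

text \<open>The derivatives of the coefficients satisfy \<open>A' \<eta>' + B' \<psi> = 0\<close>, so they do not enter the first derivative of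
  \<open>u\<close>; in the second one they produce exactly \<open>\<nu> u / p\<^sup>2\<close> by the Wronskian identity.\<close>

definition u where "u ab \<nu> z = sol_A ab \<nu> z * of_real (\<eta>1 z) + sol_B ab \<nu> z * of_real (\<psi> z)"
definition u1 where "u1 ab \<nu> z = sol_A ab \<nu> z * of_real (\<eta>2 z) + sol_B ab \<nu> z * of_real (\<psi>1 z)"
definition u2 where "u2 ab \<nu> z = sol_A ab \<nu> z * of_real (\<eta>3 z) + sol_B ab \<nu> z * of_real (\<psi>2 z)
  + \<nu> * u ab \<nu> z / of_real ((p z)\<^sup>2)"

lemma u_deriv:
  assumes z: "z \<in> {0..2 * pi}"
    and AB: "(sol_A ab \<nu> has_vector_derivative \<nu> * (of_real (k11 z) * sol_A ab \<nu> z + of_real (k12 z) * sol_B ab \<nu> z)) (at z within {0..2 * pi})"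
       "(sol_B ab \<nu> has_vector_derivative \<nu> * (of_real (k21 z) * sol_A ab \<nu> z + of_real (k22 z) * sol_B ab \<nu> z)) (at z within {0..2 * pi})"
  shows "(u ab \<nu> has_vector_derivative u1 ab \<nu> z) (at z within {0..2 * pi})"
    "(u1 ab \<nu> has_vector_derivative u2 ab \<nu> z) (at z within {0..2 * pi})"
    "of_real (k\<^sup>2) * (of_real (p z) * u2 ab \<nu> z - 2 * of_real (\<eta>1 z) * u1 ab \<nu> z - 2 * of_real (\<eta>2 z) * u ab \<nu> z) + u ab \<nu> z
      = of_real (k\<^sup>2) * \<nu> * u ab \<nu> z / of_real (p z)"
proof -
  let ?a = "sol_A ab \<nu> z" and ?b = "sol_B ab \<nu> z"
  let ?a' = "\<nu> * (of_real (k11 z) * ?a + of_real (k12 z) * ?b)"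
  let ?b' = "\<nu> * (of_real (k21 z) * ?a + of_real (k22 z) * ?b)"
  have wp: "w * p z \<noteq> 0" "w \<noteq> 0" "p z \<noteq> 0" using w_pos p_gt(2)[of z] by auto
  have a': "?a' = - (\<nu> * u ab \<nu> z / of_real (w * p z)) * of_real (\<psi> z)"
    by (simp add: k11_def k12_def u_def algebra_simps add_divide_distrib power2_eq_square)
  have b': "?b' = (\<nu> * u ab \<nu> z / of_real (w * p z)) * of_real (\<eta>1 z)"
    by (simp add: k21_def k22_def u_def algebra_simps add_divide_distrib power2_eq_square)
  have "(u ab \<nu> has_vector_derivative (?a * of_real (\<eta>2 z) + ?a' * of_real (\<eta>1 z)) + (?b * of_real (\<psi>1 z) + ?b' * of_real (\<psi> z)))
      (at z within {0..2 * pi})"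
    unfolding u_def[abs_def]
    by (intro has_vector_derivative_add has_vector_derivative_mult AB has_vector_derivative_of_real deriv_eta psi_deriv z)
  moreover have "(?a * of_real (\<eta>2 z) + ?a' * of_real (\<eta>1 z)) + (?b * of_real (\<psi>1 z) + ?b' * of_real (\<psi> z)) = u1 ab \<nu> z"
    unfolding a' b' u1_def by (simp add: algebra_simps)
  ultimately show "(u ab \<nu> has_vector_derivative u1 ab \<nu> z) (at z within {0..2 * pi})" by simp
  have "(u1 ab \<nu> has_vector_derivative (?a * of_real (\<eta>3 z) + ?a' * of_real (\<eta>2 z)) + (?b * of_real (\<psi>2 z) + ?b' * of_real (\<psi>1 z)))
      (at z within {0..2 * pi})"
    unfolding u1_def[abs_def]
    by (intro has_vector_derivative_add has_vector_derivative_mult AB has_vector_derivative_of_real deriv_eta psi_deriv z)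
  moreover have "(?a * of_real (\<eta>3 z) + ?a' * of_real (\<eta>2 z)) + (?b * of_real (\<psi>2 z) + ?b' * of_real (\<psi>1 z)) = u2 ab \<nu> z"
  proof -
    have "?a' * of_real (\<eta>2 z) + ?b' * of_real (\<psi>1 z)
        = (\<nu> * u ab \<nu> z / of_real (w * p z)) * of_real (\<eta>1 z * \<psi>1 z - \<psi> z * \<eta>2 z)"
      unfolding a' b' by (simp add: algebra_simps diff_divide_distrib)
    also have "\<eta>1 z * \<psi>1 z - \<psi> z * \<eta>2 z = w / p z" using psi_wronskian[of z] wp by (simp add: field_simps)
    also have "(\<nu> * u ab \<nu> z / of_real (w * p z)) * of_real (w / p z) = \<nu> * u ab \<nu> z / of_real ((p z)\<^sup>2)"
      using wp by (simp add: power2_eq_square)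
    finally show ?thesis by (simp add: u2_def algebra_simps)
  qed
  ultimately show "(u1 ab \<nu> has_vector_derivative u2 ab \<nu> z) (at z within {0..2 * pi})" by simp
  have "of_real (k\<^sup>2) * (of_real (p z) * u2 ab \<nu> z - 2 * of_real (\<eta>1 z) * u1 ab \<nu> z - 2 * of_real (\<eta>2 z) * u ab \<nu> z) + u ab \<nu> z
    = ?a * of_real (k\<^sup>2 * (p z * \<eta>3 z - 2 * \<eta>1 z * \<eta>2 z - 2 * \<eta>2 z * \<eta>1 z) + \<eta>1 z)
      + ?b * of_real (k\<^sup>2 * (p z * \<psi>2 z - 2 * \<eta>1 z * \<psi>1 z - 2 * \<eta>2 z * \<psi> z) + \<psi> z)
      + of_real (k\<^sup>2) * (of_real (p z) * (\<nu> * u ab \<nu> z / of_real ((p z)\<^sup>2)))"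
    unfolding u2_def by (simp add: u_def[of ab \<nu> z] u1_def algebra_simps add_divide_distrib)
  also have "\<dots> = of_real (k\<^sup>2) * (of_real (p z) * (\<nu> * u ab \<nu> z / of_real ((p z)\<^sup>2)))"
    unfolding eta1_eq psi_eq by simp
  also have "\<dots> = of_real (k\<^sup>2) * \<nu> * u ab \<nu> z / of_real (p z)"
    using wp by (simp add: power2_eq_square)
  finally show "of_real (k\<^sup>2) * (of_real (p z) * u2 ab \<nu> z - 2 * of_real (\<eta>1 z) * u1 ab \<nu> z - 2 * of_real (\<eta>2 z) * u ab \<nu> z) + u ab \<nu> z
      = of_real (k\<^sup>2) * \<nu> * u ab \<nu> z / of_real (p z)" .
qed

text \<open>Liouville's formula: the matrix of the system has trace zero.\<close>

lemma monodromy_det: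
  assumes AB: "\<And>ab z. z \<in> {0..2 * pi} \<Longrightarrow>
       (sol_A ab \<nu> has_vector_derivative \<nu> * (of_real (k11 z) * sol_A ab \<nu> z + of_real (k12 z) * sol_B ab \<nu> z)) (at z within {0..2 * pi}) \<and>
       (sol_B ab \<nu> has_vector_derivative \<nu> * (of_real (k21 z) * sol_A ab \<nu> z + of_real (k22 z) * sol_B ab \<nu> z)) (at z within {0..2 * pi})"
    and init: "\<And>ab. sol_A ab \<nu> 0 = of_real (fst ab) \<and> sol_B ab \<nu> 0 = of_real (snd ab)"
    and z: "z \<in> {0..2 * pi}"
  shows "sol_A (1, 0) \<nu> z * sol_B (0, 1) \<nu> z - sol_A (0, 1) \<nu> z * sol_B (1, 0) \<nu> z = 1"
proof -
  define D where "D z = sol_A (1, 0) \<nu> z * sol_B (0, 1) \<nu> z - sol_A (0, 1) \<nu> z * sol_B (1, 0) \<nu> z" for z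
  have "(D has_vector_derivative 0) (at z within {0..2 * pi})" if z: "z \<in> {0..2 * pi}" for z
  proof -
    have "(D has_vector_derivative
        (sol_A (1, 0) \<nu> z * (\<nu> * (of_real (k21 z) * sol_A (0, 1) \<nu> z + of_real (k22 z) * sol_B (0, 1) \<nu> z))
         + (\<nu> * (of_real (k11 z) * sol_A (1, 0) \<nu> z + of_real (k12 z) * sol_B (1, 0) \<nu> z)) * sol_B (0, 1) \<nu> z)
        - (sol_A (0, 1) \<nu> z * (\<nu> * (of_real (k21 z) * sol_A (1, 0) \<nu> z + of_real (k22 z) * sol_B (1, 0) \<nu> z))
         + (\<nu> * (of_real (k11 z) * sol_A (0, 1) \<nu> z + of_real (k12 z) * sol_B (0, 1) \<nu> z)) * sol_B (1, 0) \<nu> z))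
       (at z within {0..2 * pi})"
      unfolding D_def[abs_def]
      by (intro has_vector_derivative_diff has_vector_derivative_mult AB[THEN conjunct1] AB[THEN conjunct2] z)
    then show ?thesis by (simp add: k_trace algebra_simps)
  qed
  then obtain d where "\<And>z. z \<in> {0..2 * pi} \<Longrightarrow> D z = d"
    using has_vector_derivative_zero_constant[of "{0..2 * pi}" D] by auto
  then have "D z = D 0" using z by simp
  then show ?thesis using init[of "(1, 0)"] init[of "(0, 1)"] by (simp add: D_def)
qed

section \<open>Invertibility of the Bloch operators\<close>

text \<open>The coefficients of the Bloch operator after expanding its derivatives.\<close>

definition \<beta>2 :: "real \<Rightarrow> complex" where "\<beta>2 z = - of_real (k\<^sup>2 * p z)"

definition \<beta>1 :: "complex \<Rightarrow> real \<Rightarrow> real \<Rightarrow> complex" where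
  "\<beta>1 \<Lambda> \<mu> z = 2 * (of_real c * \<Lambda> - of_real (k\<^sup>2 * \<eta>1 z))
     + of_real (k\<^sup>2) * (4 * of_real (\<eta>1 z) - 2 * \<i> * of_real \<mu> * of_real (p z))"

definition \<beta>0 :: "complex \<Rightarrow> real \<Rightarrow> real \<Rightarrow> complex" where
  "\<beta>0 \<Lambda> \<mu> z = 2 * (of_real c * \<Lambda> - of_real (k\<^sup>2 * \<eta>1 z)) * (\<i> * of_real \<mu>)
     + of_real (k\<^sup>2) * (2 * of_real (\<eta>2 z) + 4 * \<i> * of_real \<mu> * of_real (\<eta>1 z)
                      + (of_real \<mu>)\<^sup>2 * of_real (p z)) - 1"

lemma bloch_op_AE:
  assumes V: "H2_rep V G0 G1 h"
  shows "bloch_op k \<eta> c \<Lambda> \<mu> V \<in> L2T \<and> (AE z in lborel. z \<in> {0..2 * pi} \<longrightarrow>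
     bloch_op k \<eta> c \<Lambda> \<mu> V z = \<beta>2 z * h z + \<beta>1 \<Lambda> \<mu> z * G1 z + \<beta>0 \<Lambda> \<mu> z * G0 z)"
proof -
  define q where "q z = complex_of_real (- 3 * c\<^sup>2 + 2 * \<eta> z)" for z
  have q: "q z = - of_real (p z)" for z by (simp add: q_def p_def)
  define W where "W z = q z * V z" for z
  define H where "H z = of_real (2 * \<eta>2 z) * V z + 2 * of_real (2 * \<eta>1 z) * wderiv V z + q z * h z" for z
  have W: "H2_rep W (\<lambda>z. q z * G0 z) (\<lambda>z. of_real (2 * \<eta>1 z) * G0 z + q z * G1 z) H"
    unfolding W_def[abs_def] H_def[abs_def]
  proof (rule H2_rep_mult[OF V])
    show "(q has_vector_derivative complex_of_real (2 * \<eta>1 z)) (at z)" for z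
      unfolding q_def[abs_def]
      by (rule has_vector_derivative_of_real) (auto intro!: derivative_eq_intros deriv_eta)
    show "((\<lambda>z. of_real (2 * \<eta>1 z)) has_vector_derivative complex_of_real (2 * \<eta>2 z)) (at z)" for z
      by (rule has_vector_derivative_of_real) (auto intro!: derivative_eq_intros deriv_eta)
  qed (auto simp: q_def eta_per intro!: continuous_intros eta_cont)
  note s1 = shifted_deriv_AE(1,2)[OF V, of \<mu>] and s2 = shifted_deriv_AE(3,4)[OF W, of \<mu>]
  note v = V[unfolded H2_rep_def] and wd = H2_rep_wderiv[OF V]
  have op: "bloch_op k \<eta> c \<Lambda> \<mu> V z = (2 * (of_real c * \<Lambda> - of_real (k\<^sup>2 * \<eta>1 z))) * shifted_deriv \<mu> V z
     + of_real (k\<^sup>2) * shifted_deriv \<mu> (shifted_deriv \<mu> W) z - V z" for z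
    by (simp add: bloch_op_def \<eta>1_def W_def[abs_def] q_def)
  have "bloch_op k \<eta> c \<Lambda> \<mu> V = (\<lambda>z. (2 * (of_real c * \<Lambda> - of_real (k\<^sup>2 * \<eta>1 z))) * shifted_deriv \<mu> V z
     + of_real (k\<^sup>2) * shifted_deriv \<mu> (shifted_deriv \<mu> W) z - V z)" using op by blast
  also have "\<dots> \<in> L2T"
    using s1(1) s2(1) v by (intro L2T_diff L2T_add L2T_cmult L2T_mult)
      (auto simp: eta_per intro!: continuous_intros eta_cont)
  finally have L: "bloch_op k \<eta> c \<Lambda> \<mu> V \<in> L2T" .
  have Vae: "AE z in lborel. z \<in> {0..2 * pi} \<longrightarrow> V z = G0 z" using v by blast
  show ?thesis
  proof (rule conjI[OF L])
    show "AE z in lborel. z \<in> {0..2 * pi} \<longrightarrow>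
     bloch_op k \<eta> c \<Lambda> \<mu> V z = \<beta>2 z * h z + \<beta>1 \<Lambda> \<mu> z * G1 z + \<beta>0 \<Lambda> \<mu> z * G0 z"
      using s1(2) s2(2) Vae wd(4)
    proof eventually_elim
      case (elim z)
      show ?case
      proof
        assume z: "z \<in> {0..2 * pi}"
        show "bloch_op k \<eta> c \<Lambda> \<mu> V z = \<beta>2 z * h z + \<beta>1 \<Lambda> \<mu> z * G1 z + \<beta>0 \<Lambda> \<mu> z * G0 z"
          unfolding op elim(1)[rule_format, OF z] elim(2)[rule_format, OF z]
          unfolding H_def elim(3)[rule_format, OF z] elim(4)[rule_format, OF z] q
          by (simp add: \<beta>2_def \<beta>1_def \<beta>0_def algebra_simps)
      qed
    qed
  qed
qed


text \<open>Multiplication by \<open>E\<close>, whose logarithmic derivative is \<open>e\<close>, turns solutions of the Hill equation into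
  solutions of the equation for the Bloch operator.\<close>

definition \<tau> where "\<tau> z = integral {0..z} (\<lambda>t. 1 / p t)"

lemma tau_deriv:
  assumes "z \<in> {0..2 * pi}"
  shows "(\<tau> has_real_derivative 1 / p z) (at z within {0..2 * pi})"
  using integral_has_vector_derivative[OF inv_p_cont assms]
  by (simp add: \<tau>_def[abs_def] has_real_derivative_iff_has_vector_derivative)

lemma tau_end: "\<tau> 0 = 0" "\<tau> (2 * pi) = P" by (simp_all add: \<tau>_def P_def)

definition E where "E g \<mu> z = exp (g * of_real (\<tau> z) - \<i> * of_real \<mu> * of_real z)" for g :: complex and \<mu> :: real
definition e where "e g \<mu> z = g / of_real (p z) - \<i> * of_real \<mu>" for g :: complex and \<mu> :: real

lemma E_deriv:
  assumes z: "z \<in> {0..2 * pi}"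
  shows "(E g \<mu> has_vector_derivative E g \<mu> z * e g \<mu> z) (at z within {0..2 * pi})"
proof -
  have "((\<lambda>z. g * of_real (\<tau> z) - \<i> * of_real \<mu> * of_real z) has_vector_derivative
     g * of_real (1 / p z) - \<i> * of_real \<mu> * of_real 1) (at z within {0..2 * pi})"
    by (intro has_vector_derivative_diff has_vector_derivative_mult_right has_vector_derivative_of_real tau_deriv z DERIV_ident)
  then have "((\<lambda>z. g * of_real (\<tau> z) - \<i> * of_real \<mu> * of_real z) has_vector_derivative e g \<mu> z) (at z within {0..2 * pi})"
    by (simp add: e_def)
  from field_vector_diff_chain_within[OF this has_field_derivative_at_within[OF DERIV_exp]]
  have "((\<lambda>z. exp (g * of_real (\<tau> z) - \<i> * of_real \<mu> * of_real z)) has_vector_derivative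
     e g \<mu> z * exp (g * of_real (\<tau> z) - \<i> * of_real \<mu> * of_real z)) (at z within {0..2 * pi})"
    by (simp only: o_def)
  then show ?thesis by (simp only: E_def[abs_def] mult.commute)
qed

lemma e_deriv: "(e g \<mu> has_vector_derivative 2 * g * of_real (\<eta>1 z) / of_real ((p z)\<^sup>2)) (at z within S)"
proof -
  have p: "p z \<noteq> 0" using p_gt(2)[of z] by simp
  have "((\<lambda>z. 1 / p z) has_real_derivative 2 * \<eta>1 z / (p z)\<^sup>2) (at z within S)"
    using DERIV_divide[OF DERIV_const p_deriv p, of 1 S] by (simp add: power2_eq_square)
  then have "((\<lambda>z. g * of_real (1 / p z) - \<i> * of_real \<mu>) has_vector_derivative g * of_real (2 * \<eta>1 z / (p z)\<^sup>2) - 0) (at z within S)"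
    by (intro has_vector_derivative_diff has_vector_derivative_mult_right has_vector_derivative_of_real has_vector_derivative_const)
  moreover have "(\<lambda>z. g * of_real (1 / p z) - \<i> * of_real \<mu>) = e g \<mu>" by (simp add: e_def fun_eq_iff)
  ultimately show ?thesis by (simp add: mult_ac)
qed

lemma E_end: "E g \<mu> 0 = 1" "E g \<mu> (2 * pi) = exp (of_real P * g - 2 * pi * \<i> * of_real \<mu>)" "e g \<mu> (2 * pi) = e g \<mu> 0"
proof -
  show "E g \<mu> 0 = 1" "e g \<mu> (2 * pi) = e g \<mu> 0" by (simp_all add: E_def e_def tau_end p_end)
  show "E g \<mu> (2 * pi) = exp (of_real P * g - 2 * pi * \<i> * of_real \<mu>)"
    unfolding E_def tau_end by (simp add: mult_ac)
qed

definition y where "y g \<mu> ab z = E g \<mu> z * u ab (g\<^sup>2) z"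
definition y1 where "y1 g \<mu> ab z = E g \<mu> z * (e g \<mu> z * u ab (g\<^sup>2) z + u1 ab (g\<^sup>2) z)"
definition y2 where "y2 g \<mu> ab z = E g \<mu> z * (u2 ab (g\<^sup>2) z + 2 * e g \<mu> z * u1 ab (g\<^sup>2) z
    + ((e g \<mu> z)\<^sup>2 + 2 * g * of_real (\<eta>1 z) / of_real ((p z)\<^sup>2)) * u ab (g\<^sup>2) z)"

lemma y_deriv:
  assumes z: "z \<in> {0..2 * pi}"
    and u: "(u ab (g\<^sup>2) has_vector_derivative u1 ab (g\<^sup>2) z) (at z within {0..2 * pi})"
      "(u1 ab (g\<^sup>2) has_vector_derivative u2 ab (g\<^sup>2) z) (at z within {0..2 * pi})"
  shows "(y g \<mu> ab has_vector_derivative y1 g \<mu> ab z) (at z within {0..2 * pi})"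
    "(y1 g \<mu> ab has_vector_derivative y2 g \<mu> ab z) (at z within {0..2 * pi})"
proof -
  have "(y g \<mu> ab has_vector_derivative E g \<mu> z * u1 ab (g\<^sup>2) z + E g \<mu> z * e g \<mu> z * u ab (g\<^sup>2) z) (at z within {0..2 * pi})"
    unfolding y_def[abs_def] by (intro has_vector_derivative_mult E_deriv u z)
  then show "(y g \<mu> ab has_vector_derivative y1 g \<mu> ab z) (at z within {0..2 * pi})"
    by (simp add: y1_def algebra_simps)
  have "(y1 g \<mu> ab has_vector_derivative
      E g \<mu> z * ((e g \<mu> z * u1 ab (g\<^sup>2) z + 2 * g * of_real (\<eta>1 z) / of_real ((p z)\<^sup>2) * u ab (g\<^sup>2) z) + u2 ab (g\<^sup>2) z)
      + E g \<mu> z * e g \<mu> z * (e g \<mu> z * u ab (g\<^sup>2) z + u1 ab (g\<^sup>2) z)) (at z within {0..2 * pi})"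
    unfolding y1_def[abs_def]
    by (intro has_vector_derivative_mult has_vector_derivative_add E_deriv e_deriv u z)
  then show "(y1 g \<mu> ab has_vector_derivative y2 g \<mu> ab z) (at z within {0..2 * pi})"
    by (simp add: y2_def algebra_simps power2_eq_square)
qed

text \<open>With \<open>f = g / p\<close> one has \<open>e = f - \<i> \<mu>\<close>, and all terms in \<open>\<mu>\<close> and all first order terms in \<open>f\<close> cancel; what is left is
  \<open>- E\<close> times the Hill equation with \<open>\<nu> = g\<^sup>2\<close>.\<close>

lemma y_eq:
  assumes g: "of_real c * \<Lambda> = of_real (k\<^sup>2) * g"
    and ueq: "of_real (k\<^sup>2) * (of_real (p z) * u2 ab (g\<^sup>2) z - 2 * of_real (\<eta>1 z) * u1 ab (g\<^sup>2) z - 2 * of_real (\<eta>2 z) * u ab (g\<^sup>2) z) + u ab (g\<^sup>2) z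
      = of_real (k\<^sup>2) * g\<^sup>2 * u ab (g\<^sup>2) z / of_real (p z)"
  shows "\<beta>2 z * y2 g \<mu> ab z + \<beta>1 \<Lambda> \<mu> z * y1 g \<mu> ab z + \<beta>0 \<Lambda> \<mu> z * y g \<mu> ab z = 0"
proof -
  define f where "f = g / of_real (p z)"
  have p: "complex_of_real (p z) \<noteq> 0" using p_gt(2)[of z] by simp
  have gf: "g = of_real (p z) * f" using p by (simp add: f_def)
  have ef: "e g \<mu> z = f - \<i> * of_real \<mu>" by (simp add: e_def f_def)
  have e'f: "2 * g * of_real (\<eta>1 z) / of_real ((p z)\<^sup>2) = 2 * f * of_real (\<eta>1 z) / of_real (p z)"
    by (simp add: f_def power2_eq_square)
  define U where "U = u ab (g\<^sup>2) z"
  define U1 where "U1 = u1 ab (g\<^sup>2) z"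
  define U2 where "U2 = u2 ab (g\<^sup>2) z"
  define t where "t = f * of_real (\<eta>1 z) / of_real (p z)"
  have t: "of_real (p z) * t = f * of_real (\<eta>1 z)" using p by (simp add: t_def)
  define K where "K = complex_of_real (k\<^sup>2)"
  define m where "m = complex_of_real \<mu>"
  define q where "q = complex_of_real (p z)"
  define h1 where "h1 = complex_of_real (\<eta>1 z)"
  define h2 where "h2 = complex_of_real (\<eta>2 z)"
  have t': "q * t = f * h1" using t by (simp add: q_def h1_def)
  have "K * g\<^sup>2 * U / of_real (p z) = K * q * f\<^sup>2 * U"
    using p by (simp add: gf q_def power2_eq_square)
  then have ueq': "K * (q * U2 - 2 * h1 * U1 - 2 * h2 * U) + U = K * q * f\<^sup>2 * U"
    using ueq by (simp add: K_def U_def U1_def U2_def q_def h1_def h2_def)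
  have cL: "of_real c * \<Lambda> = K * (q * f)" using g gf by (simp add: K_def q_def)
  have "2 * g * of_real (\<eta>1 z) / of_real ((p z)\<^sup>2) = 2 * t" using e'f by (simp add: t_def)
  then have Y: "y2 g \<mu> ab z = E g \<mu> z * (U2 + 2 * (f - \<i> * m) * U1 + ((f - \<i> * m)\<^sup>2 + 2 * t) * U)"
    "y1 g \<mu> ab z = E g \<mu> z * ((f - \<i> * m) * U + U1)" "y g \<mu> ab z = E g \<mu> z * U"
    unfolding y_def y1_def y2_def ef by (simp_all add: U_def U1_def U2_def m_def)
  have "\<beta>2 z * y2 g \<mu> ab z + \<beta>1 \<Lambda> \<mu> z * y1 g \<mu> ab z + \<beta>0 \<Lambda> \<mu> z * y g \<mu> ab z
    = - (K * q) * (E g \<mu> z * (U2 + 2 * (f - \<i> * m) * U1 + ((f - \<i> * m)\<^sup>2 + 2 * t) * U))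
     + (2 * (K * (q * f) - K * h1) + K * (4 * h1 - 2 * \<i> * m * q)) * (E g \<mu> z * ((f - \<i> * m) * U + U1))
     + (2 * (K * (q * f) - K * h1) * (\<i> * m) + K * (2 * h2 + 4 * \<i> * m * h1 + m\<^sup>2 * q) - 1) * (E g \<mu> z * U)"
    unfolding Y cL \<beta>2_def \<beta>1_def \<beta>0_def
    by (simp only: K_def q_def h1_def h2_def m_def of_real_mult)
  also have "\<dots> = E g \<mu> z * ((K * q * f\<^sup>2 * U - (K * (q * U2 - 2 * h1 * U1 - 2 * h2 * U) + U))
      - 2 * K * U * (q * t - f * h1))"
    by (simp add: algebra_simps power2_eq_square)
  also have "\<dots> = 0" using ueq' t' by simp
  finally show ?thesis .
qed

text \<open>Choose \<open>\<delta>\<close> so small that \<open>g = c \<Lambda> / k\<^sup>2\<close> and \<open>\<mu>\<close> lie in the range of \<open>resonance_imaginary\<close> and the power series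
  converge at \<open>g\<^sup>2\<close>. If \<open>Re \<Lambda> \<noteq> 0\<close>, there is no resonance, and \<open>boundedly_invertible_if_AE_eq\<close> applies.\<close>

theorem wave_modulationally_stable: "modulationally_stable k \<eta> c"
proof -
  let ?I = "{0..2 * pi}"
  obtain r where r: "r > 0"
    and bd: "\<And>ab. \<exists>D. \<forall>n. \<forall>z\<in>?I. \<bar>A ab n z\<bar> * r ^ n \<le> D \<and> \<bar>B ab n z\<bar> * r ^ n \<le> D"
    and sm: "\<And>ab \<nu> z. cmod \<nu> < r \<Longrightarrow> z \<in> ?I \<Longrightarrow>
       summable (\<lambda>n. of_real (A ab n z) * \<nu> ^ n) \<and> summable (\<lambda>n. of_real (B ab n z) * \<nu> ^ n)"
    and init: "\<And>ab \<nu>. cmod \<nu> < r \<Longrightarrow> sol_A ab \<nu> 0 = of_real (fst ab) \<and> sol_B ab \<nu> 0 = of_real (snd ab)"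
    and dAB: "\<And>ab \<nu> z. cmod \<nu> < r \<Longrightarrow> z \<in> ?I \<Longrightarrow>
       (sol_A ab \<nu> has_vector_derivative \<nu> * (of_real (k11 z) * sol_A ab \<nu> z + of_real (k12 z) * sol_B ab \<nu> z)) (at z within ?I) \<and>
       (sol_B ab \<nu> has_vector_derivative \<nu> * (of_real (k21 z) * sol_A ab \<nu> z + of_real (k22 z) * sol_B ab \<nu> z)) (at z within ?I)"
    by (rule system_solution) (rule that; assumption)
  define \<Delta> where "\<Delta> \<nu> = sol_A (1, 0) \<nu> (2 * pi) + sol_B (0, 1) \<nu> (2 * pi) + of_real q0 * sol_B (1, 0) \<nu> (2 * pi)" for \<nu>
  define R where "R \<nu> = (\<Sum>n. of_real (disc (Suc n)) * \<nu> ^ n)" for \<nu> :: complex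
  have discsum: "(\<lambda>n. of_real (disc n) * \<nu> ^ n) sums \<Delta> \<nu>" if \<nu>: "cmod \<nu> < r" for \<nu>
  proof -
    have "(\<lambda>n. of_real (A (1, 0) n (2 * pi)) * \<nu> ^ n + of_real (B (0, 1) n (2 * pi)) * \<nu> ^ n
        + of_real q0 * (of_real (B (1, 0) n (2 * pi)) * \<nu> ^ n)) sums \<Delta> \<nu>"
      unfolding \<Delta>_def sol_A_def sol_B_def
      by (intro sums_add sums_mult summable_sums sm[THEN conjunct1] sm[THEN conjunct2] \<nu>) simp_all
    then show ?thesis by (simp add: disc_def algebra_simps)
  qed
  have \<Delta>R: "\<Delta> \<nu> = 2 + \<nu> * R \<nu>" if \<nu>: "cmod \<nu> < r" for \<nu>
    using powser_split_head(1)[OF sums_summable[OF discsum[OF \<nu>]]] sums_unique[OF discsum[OF \<nu>]]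
    by (simp add: disc_0 R_def mult.commute)
  obtain D1 where D1: "\<And>n z. z \<in> ?I \<Longrightarrow> \<bar>A (1, 0) n z\<bar> * r ^ n \<le> D1 \<and> \<bar>B (1, 0) n z\<bar> * r ^ n \<le> D1"
    using bd by blast
  obtain D2 where D2: "\<And>n z. z \<in> ?I \<Longrightarrow> \<bar>A (0, 1) n z\<bar> * r ^ n \<le> D2 \<and> \<bar>B (0, 1) n z\<bar> * r ^ n \<le> D2"
    using bd by blast
  have discb: "\<bar>disc n\<bar> * r ^ n \<le> D1 + D2 + \<bar>q0\<bar> * D1" for n
  proof -
    have I: "2 * pi \<in> ?I" by simp
    have "\<bar>disc n\<bar> \<le> \<bar>A (1, 0) n (2 * pi)\<bar> + \<bar>B (0, 1) n (2 * pi)\<bar> + \<bar>q0\<bar> * \<bar>B (1, 0) n (2 * pi)\<bar>"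
      unfolding disc_def abs_mult[symmetric] by linarith
    then have "\<bar>disc n\<bar> * r ^ n \<le> (\<bar>A (1, 0) n (2 * pi)\<bar> + \<bar>B (0, 1) n (2 * pi)\<bar> + \<bar>q0\<bar> * \<bar>B (1, 0) n (2 * pi)\<bar>) * r ^ n"
      using r by (intro mult_right_mono) auto
    also have "\<dots> = \<bar>A (1, 0) n (2 * pi)\<bar> * r ^ n + \<bar>B (0, 1) n (2 * pi)\<bar> * r ^ n + \<bar>q0\<bar> * (\<bar>B (1, 0) n (2 * pi)\<bar> * r ^ n)"
      by (simp only: distrib_right mult.assoc)
    also have "\<dots> \<le> D1 + D2 + \<bar>q0\<bar> * D1"
      using D1[OF I, of n] D2[OF I, of n] by (intro add_mono mult_left_mono) auto
    finally show ?thesis .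
  qed
  have cb: "cmod (of_real (disc (Suc n))) * r ^ n \<le> (D1 + D2 + \<bar>q0\<bar> * D1) / r" for n
    using discb[of "Suc n"] r by (simp add: field_simps)
  obtain L where L: "L > 0" "\<And>x y. x \<in> ball 0 (r / 4) \<Longrightarrow> y \<in> ball 0 (r / 4) \<Longrightarrow> cmod (R x - R y) \<le> L * cmod (x - y)"
    using powser_lipschitz[OF r cb] unfolding R_def by blast
  have R0: "R 0 = of_real (s\<^sup>2)" unfolding R_def by (simp add: disc_1 del: of_real_power)
  have Rcnj: "cnj (R \<nu>) = R (cnj \<nu>)" if "cmod \<nu> < r / 4" for \<nu>
  proof -
    have "cmod \<nu> < r" using that r by simp
    then have "summable (\<lambda>n. of_real (disc (Suc n)) * \<nu> ^ n)"
      using sums_summable[OF discsum] summable_powser_split_head[of "\<lambda>n. complex_of_real (disc n)" \<nu>] by blast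
    then have "(\<lambda>n. cnj (of_real (disc (Suc n)) * \<nu> ^ n)) sums cnj (R \<nu>)"
      unfolding R_def sums_cnj by (rule summable_sums)
    then show ?thesis by (simp add: R_def sums_iff)
  qed
  obtain \<epsilon> where \<epsilon>: "\<epsilon> > 0" and res: "\<And>g \<mu>. cmod g < \<epsilon> \<Longrightarrow> \<bar>\<mu>\<bar> < \<epsilon> \<Longrightarrow>
      (let x = of_real P * g - 2 * pi * \<i> * of_real \<mu> in exp x + exp (- x) = 2 + g\<^sup>2 * R (g\<^sup>2)) \<Longrightarrow> Re g = 0"
    using resonance_imaginary[OF s_pos s_less_P _ L(1) R0 Rcnj L(2)] r by (metis divide_pos_pos zero_less_numeral)
  define \<epsilon>' where "\<epsilon>' = min \<epsilon> (min 1 r)"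
  have \<epsilon>': "\<epsilon>' > 0" "\<epsilon>' \<le> \<epsilon>" "\<epsilon>' \<le> 1" "\<epsilon>' \<le> r" using \<epsilon> r by (auto simp: \<epsilon>'_def)
  define \<delta> where "\<delta> = min \<epsilon>' (\<epsilon>' * k\<^sup>2 / c)"
  have \<delta>: "\<delta> > 0" using \<epsilon>' k c by (simp add: \<delta>_def)
  have inv: "boundedly_invertible (bloch_op k \<eta> c \<Lambda> \<mu>)"
    if small: "norm (\<Lambda>, \<mu>) < \<delta>" and Re: "Re \<Lambda> \<noteq> 0" for \<Lambda> :: complex and \<mu> :: real
  proof -
    define g where "g = of_real (c / k\<^sup>2) * \<Lambda>"
    define \<nu> where "\<nu> = g\<^sup>2"
    define x where "x = of_real P * g - 2 * pi * \<i> * of_real \<mu>"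
    have gk: "of_real c * \<Lambda> = of_real (k\<^sup>2) * g" using k by (simp add: g_def)
    have "cmod \<Lambda> < \<delta>" "\<bar>\<mu>\<bar> < \<delta>"
      using small norm_fst_le[of \<Lambda> \<mu>] norm_snd_le[of \<mu> \<Lambda>] by auto
    then have \<mu>: "\<bar>\<mu>\<bar> < \<epsilon>" and \<Lambda>: "cmod \<Lambda> < \<epsilon>' * k\<^sup>2 / c" using \<epsilon>' by (auto simp: \<delta>_def)
    have "cmod g = c / k\<^sup>2 * cmod \<Lambda>" using c k by (simp add: g_def norm_mult norm_divide norm_power)
    also have "\<dots> < \<epsilon>'" using \<Lambda> c k by (simp add: field_simps)
    finally have g: "cmod g < \<epsilon>'" .
    have Reg: "Re g \<noteq> 0" using Re c k by (simp add: g_def)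
    have \<nu>: "cmod \<nu> < r"
    proof -
      have "cmod \<nu> \<le> cmod g * 1" unfolding \<nu>_def power2_eq_square norm_mult
        using g \<epsilon>' by (intro mult_left_mono) auto
      then show ?thesis using g \<epsilon>' by simp
    qed
    have nr: "exp x + exp (- x) \<noteq> \<Delta> \<nu>"
      using res[of g \<mu>] g \<epsilon>' \<mu> Reg \<Delta>R[OF \<nu>] by (auto simp: Let_def x_def \<nu>_def)
    have ud: "(u ab (g\<^sup>2) has_vector_derivative u1 ab (g\<^sup>2) z) (at z within ?I)"
      "(u1 ab (g\<^sup>2) has_vector_derivative u2 ab (g\<^sup>2) z) (at z within ?I)"
      "of_real (k\<^sup>2) * (of_real (p z) * u2 ab (g\<^sup>2) z - 2 * of_real (\<eta>1 z) * u1 ab (g\<^sup>2) z - 2 * of_real (\<eta>2 z) * u ab (g\<^sup>2) z) + u ab (g\<^sup>2) z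
      = of_real (k\<^sup>2) * g\<^sup>2 * u ab (g\<^sup>2) z / of_real (p z)" if "z \<in> ?I" for ab z
      using u_deriv[OF that] dAB[OF \<nu> that] unfolding \<nu>_def by blast+
    define A1 B1 A2 B2 where "A1 = sol_A (1, 0) \<nu> (2 * pi)" and "B1 = sol_B (1, 0) \<nu> (2 * pi)"
      and "A2 = sol_A (0, 1) \<nu> (2 * pi)" and "B2 = sol_B (0, 1) \<nu> (2 * pi)"
    have det: "sol_A (1, 0) \<nu> z * sol_B (0, 1) \<nu> z - sol_A (0, 1) \<nu> z * sol_B (1, 0) \<nu> z = 1" if "z \<in> ?I" for z
      using monodromy_det[OF dAB[OF \<nu>] init[OF \<nu>] that] .
    define m11 m12 m21 m22 where "m11 = exp x * (A1 + of_real q0 * B1)" and "m12 = exp x * (A2 + of_real q0 * B2)"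
      and "m21 = exp x * B1" and "m22 = exp x * B2"
    have start: "y g \<mu> ab 0 = of_real (fst ab * \<eta>1 0 + snd ab * \<psi> 0)"
      "y1 g \<mu> ab 0 = of_real (fst ab) * (e g \<mu> 0 * of_real (\<eta>1 0) + of_real (\<eta>2 0))
          + of_real (snd ab) * (e g \<mu> 0 * of_real (\<psi> 0) + of_real (\<psi>1 0))" for ab
      using init[OF \<nu>, of ab] by (simp_all add: y_def y1_def u_def u1_def E_end \<nu>_def algebra_simps)
    have stop: "y g \<mu> ab (2 * pi) = exp x * ((sol_A ab \<nu> (2 * pi) + of_real q0 * sol_B ab \<nu> (2 * pi)) * y g \<mu> (1, 0) 0
          + sol_B ab \<nu> (2 * pi) * y g \<mu> (0, 1) 0)"
      "y1 g \<mu> ab (2 * pi) = exp x * ((sol_A ab \<nu> (2 * pi) + of_real q0 * sol_B ab \<nu> (2 * pi)) * y1 g \<mu> (1, 0) 0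
          + sol_B ab \<nu> (2 * pi) * y1 g \<mu> (0, 1) 0)" for ab
      unfolding start unfolding y_def y1_def u_def u1_def E_end(2,3) psi_end(2,3) eta_end
        \<nu>_def[symmetric] x_def[symmetric]
      by (simp_all add: algebra_simps)
    interpret periodic_equation \<beta>2 "\<beta>1 \<Lambda> \<mu>" "\<beta>0 \<Lambda> \<mu>"
      "y g \<mu> (1, 0)" "y1 g \<mu> (1, 0)" "y2 g \<mu> (1, 0)" "y g \<mu> (0, 1)" "y1 g \<mu> (0, 1)" "y2 g \<mu> (0, 1)"
      m11 m12 m21 m22
    proof
      show "continuous_on UNIV \<beta>2" "continuous_on UNIV (\<beta>1 \<Lambda> \<mu>)" "continuous_on UNIV (\<beta>0 \<Lambda> \<mu>)"
        unfolding \<beta>2_def \<beta>1_def \<beta>0_def by (intro continuous_intros p_cont eta_cont)+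
      show "\<beta>2 z \<noteq> 0" for z using k p_gt(2)[of z] by (simp add: \<beta>2_def)
      show "y g \<mu> (1, 0) z * y1 g \<mu> (0, 1) z - y g \<mu> (0, 1) z * y1 g \<mu> (1, 0) z \<noteq> 0" if z: "z \<in> ?I" for z
      proof -
        have p: "p z \<noteq> 0" using p_gt(2)[of z] by simp
        have "y g \<mu> (1, 0) z * y1 g \<mu> (0, 1) z - y g \<mu> (0, 1) z * y1 g \<mu> (1, 0) z
          = (E g \<mu> z)\<^sup>2 * (u (1, 0) \<nu> z * u1 (0, 1) \<nu> z - u (0, 1) \<nu> z * u1 (1, 0) \<nu> z)"
          by (simp add: y_def y1_def \<nu>_def power2_eq_square algebra_simps)
        also have "u (1, 0) \<nu> z * u1 (0, 1) \<nu> z - u (0, 1) \<nu> z * u1 (1, 0) \<nu> z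
          = (sol_A (1, 0) \<nu> z * sol_B (0, 1) \<nu> z - sol_A (0, 1) \<nu> z * sol_B (1, 0) \<nu> z)
            * of_real (\<eta>1 z * \<psi>1 z - \<psi> z * \<eta>2 z)"
          by (simp add: u_def u1_def algebra_simps)
        also have "\<dots> = of_real (\<eta>1 z * \<psi>1 z - \<psi> z * \<eta>2 z)" using det[OF z] by simp
        also have "(E g \<mu> z)\<^sup>2 * of_real (\<eta>1 z * \<psi>1 z - \<psi> z * \<eta>2 z) \<noteq> 0"
          using psi_wronskian[of z] w_pos by (auto simp: E_def simp del: of_real_diff of_real_mult)
        finally show ?thesis .
      qed
      show "(m11 - 1) * (m22 - 1) - m12 * m21 \<noteq> 0"
      proof -
        \<comment> \<open>The monodromy matrix of the Bloch equation is \<open>exp x\<close> times that of the Hill equation.\<close>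
        have ex: "exp x * exp (- x) = 1" by (simp flip: exp_add)
        have "(m11 - 1) * (m22 - 1) - m12 * m21
          = exp x * exp x * (A1 * B2 - A2 * B1) - exp x * \<Delta> \<nu> + 1"
          by (simp add: m11_def m12_def m21_def m22_def \<Delta>_def A1_def A2_def B1_def B2_def algebra_simps)
        also have "A1 * B2 - A2 * B1 = 1" using det[of "2 * pi"] by (simp add: A1_def A2_def B1_def B2_def)
        also have "exp x * exp x * 1 - exp x * \<Delta> \<nu> + 1 = exp x * (exp x + exp (- x) - \<Delta> \<nu>)"
          using ex by (simp add: algebra_simps)
        finally show ?thesis using nr by simp
      qed
      show "\<beta>2 (z + 2 * pi) = \<beta>2 z" "\<beta>1 \<Lambda> \<mu> (z + 2 * pi) = \<beta>1 \<Lambda> \<mu> z"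
        "\<beta>0 \<Lambda> \<mu> (z + 2 * pi) = \<beta>0 \<Lambda> \<mu> z" for z
        by (simp_all add: \<beta>2_def \<beta>1_def \<beta>0_def p_def eta_per)
    qed (use y_deriv[OF _ ud(1,2)] y_eq[OF gk ud(3)] stop[of "(1, 0)"] stop[of "(0, 1)"] in
        \<open>simp_all add: m11_def m12_def m21_def m22_def A1_def A2_def B1_def B2_def
          distrib_left mult.assoc\<close>)
    show ?thesis by (rule boundedly_invertible_if_AE_eq) (rule bloch_op_AE)
  qed
  then show ?thesis unfolding modulationally_stable_def using \<delta> by blast
qed

end

section \<open>Small waves\<close>

text \<open>The term \<open>a cos z\<close> dominates the expansion: uniformly in \<open>z\<close> the profile is small, while at \<open>z = 0\<close>, where the
  terms of second order cancel, it is close to \<open>a\<close>.\<close>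

lemma small_wave_profile:
  assumes k: "k > (0::real)" and ev: "\<forall>\<^sub>F a in at 0. \<forall>z. \<bar>h a z - (a * cos z + a\<^sup>2 * (- k\<^sup>2 / 2 + k\<^sup>2 / 2 * cos (2 * z))
                     + 7 * k ^ 4 / 16 * a ^ 3 * cos (3 * z))\<bar> \<le> M * \<bar>a\<bar> ^ 4"
    and m: "m > 0"
  shows "\<forall>\<^sub>F a in at 0. (\<forall>z. \<bar>h a z\<bar> \<le> m) \<and> h a 0 \<noteq> (0::real)"
proof -
  define d where "d a = \<bar>a\<bar> + \<bar>a\<bar>\<^sup>2 * k\<^sup>2 + 7 * k ^ 4 / 16 * \<bar>a\<bar> ^ 3 + M * \<bar>a\<bar> ^ 4" for a :: real
  define e where "e a = 7 * k ^ 4 / 16 * \<bar>a\<bar> ^ 2 + M * \<bar>a\<bar> ^ 3" for a :: real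
  have "(d \<longlongrightarrow> d 0) (at 0)" "(e \<longlongrightarrow> e 0) (at 0)"
    unfolding d_def e_def by (intro tendsto_intros)+
  then have "(d \<longlongrightarrow> 0) (at 0)" "(e \<longlongrightarrow> 0) (at 0)" by (simp_all add: d_def e_def)
  then have "\<forall>\<^sub>F a in at 0. d a < m" "\<forall>\<^sub>F a in at 0. e a < 1"
    using m by (simp_all add: order_tendstoD(2))
  with ev show ?thesis using eventually_neq_at_within[of 0 0 UNIV]
  proof eventually_elim
    case (elim a)
    have "\<bar>h a z\<bar> \<le> m" for z
    proof -
      have 1: "\<bar>a * cos z\<bar> \<le> \<bar>a\<bar>" by (simp add: abs_mult mult_left_le)
      have 2: "\<bar>a\<^sup>2 * (- k\<^sup>2 / 2 + k\<^sup>2 / 2 * cos (2 * z))\<bar> \<le> \<bar>a\<bar>\<^sup>2 * k\<^sup>2"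
      proof -
        have "\<bar>k\<^sup>2 / 2 * cos (2 * z)\<bar> \<le> k\<^sup>2 / 2" by (simp add: abs_mult mult_left_le)
        then have "\<bar>- k\<^sup>2 / 2 + k\<^sup>2 / 2 * cos (2 * z)\<bar> \<le> k\<^sup>2" by (simp add: abs_le_iff)
        then show ?thesis by (simp add: abs_mult mult_left_mono)
      qed
      have 3: "\<bar>7 * k ^ 4 / 16 * a ^ 3 * cos (3 * z)\<bar> \<le> 7 * k ^ 4 / 16 * \<bar>a\<bar> ^ 3"
      proof -
        have "\<bar>7 * k ^ 4 / 16 * a ^ 3 * cos (3 * z)\<bar> = (7 * k ^ 4 / 16 * \<bar>a\<bar> ^ 3) * \<bar>cos (3 * z)\<bar>"
          using k by (simp add: abs_mult power_abs)
        also have "\<dots> \<le> 7 * k ^ 4 / 16 * \<bar>a\<bar> ^ 3" using k by (intro mult_left_le) auto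
        finally show ?thesis .
      qed
      show ?thesis using elim(1)[rule_format, of z] 1 2 3 elim(2) unfolding d_def by linarith
    qed
    moreover have "h a 0 \<noteq> 0"
    proof
      assume "h a 0 = 0"
      then have "\<bar>a + 7 * k ^ 4 / 16 * a ^ 3\<bar> \<le> M * \<bar>a\<bar> ^ 4" using elim(1)[rule_format, of 0] by simp
      moreover have "\<bar>7 * k ^ 4 / 16 * a ^ 3\<bar> = 7 * k ^ 4 / 16 * \<bar>a\<bar> ^ 3"
        using k by (simp add: abs_mult power_abs)
      ultimately have "\<bar>a\<bar> \<le> 7 * k ^ 4 / 16 * \<bar>a\<bar> ^ 3 + M * \<bar>a\<bar> ^ 4" by linarith
      also have "\<dots> = e a * \<bar>a\<bar>" by (simp add: e_def algebra_simps power2_eq_square power3_eq_cube power4_eq_xxxx)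
      also have "\<dots> < 1 * \<bar>a\<bar>" using elim by (intro mult_strict_right_mono) auto
      finally show False by simp
    qed
    ultimately show ?case by blast
  qed
qed

theorem theorem5p1:
  fixes \<eta> :: "real \<Rightarrow> real \<Rightarrow> real \<Rightarrow> real" and c :: "real \<Rightarrow> real \<Rightarrow> real" and k :: real
  assumes "k > 0"
    and "wave_family \<eta> c"
  shows "\<exists>a\<^sub>0>0. \<forall>a. 0 < \<bar>a\<bar> \<and> \<bar>a\<bar> < a\<^sub>0 \<longrightarrow> modulationally_stable k (\<eta> a k) (c a k)"
proof -
  obtain A where A: "\<forall>k>0. A k > 0 \<and>
     (\<forall>a. \<bar>a\<bar> < A k \<longrightarrow>
        smooth (\<eta> a k) \<and> periodic_fun_simple (\<eta> a k) (2 * pi) \<and>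
        (\<forall>z. \<eta> a k (- z) = \<eta> a k z) \<and>
        c a k > 0 \<and> c (- a) k = c a k \<and>
        (\<forall>z. (3 * (c a k)\<^sup>2 - 2 * \<eta> a k z) * k\<^sup>2 * deriv (deriv (\<eta> a k)) z
              - k\<^sup>2 * (deriv (\<eta> a k) z)\<^sup>2 + \<eta> a k z = 0) \<and>
        analytic_family_at \<eta> a k \<and>
        analytic_family_at (\<lambda>a' k' (_::unit). c a' k') a k) \<and>
     (\<exists>M. \<forall>\<^sub>F a in at 0. \<forall>z.
        \<bar>\<eta> a k z - (a * cos z + a\<^sup>2 * (- k\<^sup>2 / 2 + k\<^sup>2 / 2 * cos (2 * z))
                     + 7 * k ^ 4 / 16 * a ^ 3 * cos (3 * z))\<bar> \<le> M * \<bar>a\<bar> ^ 4) \<and>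
     (\<lambda>a. c a k - (1 / (sqrt 3 * k) + k ^ 3 / (4 * sqrt 3) * a\<^sup>2)) \<in> O[at 0](\<lambda>a. a ^ 4)"
    using assms(2) unfolding wave_family_def by blast
  note Ak = A[rule_format, OF assms(1)]
  obtain M where M: "\<forall>\<^sub>F a in at 0. \<forall>z.
        \<bar>\<eta> a k z - (a * cos z + a\<^sup>2 * (- k\<^sup>2 / 2 + k\<^sup>2 / 2 * cos (2 * z))
                     + 7 * k ^ 4 / 16 * a ^ 3 * cos (3 * z))\<bar> \<le> M * \<bar>a\<bar> ^ 4" using Ak by blast
  define c0 where "c0 = 1 / (sqrt 3 * k)"
  have c0: "c0 > 0" using assms(1) by (simp add: c0_def)
  have "((\<lambda>a. c a k) \<longlongrightarrow> c0) (at 0)"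
  proof -
    let ?f = "\<lambda>a. c a k - (1 / (sqrt 3 * k) + k ^ 3 / (4 * sqrt 3) * a\<^sup>2)"
    have "?f \<in> O[at 0](\<lambda>a. a ^ 4)" using Ak by blast
    then obtain C where C: "\<forall>\<^sub>F a in at 0. norm (?f a) \<le> C * norm (a ^ 4 :: real)"
      by (rule landau_o.bigE)
    have "((\<lambda>a::real. C * norm (a ^ 4)) \<longlongrightarrow> C * norm ((0::real) ^ 4)) (at 0)" by (intro tendsto_intros)
    then have "(?f \<longlongrightarrow> 0) (at 0)" by (intro Lim_null_comparison[OF C]) simp
    moreover have "((\<lambda>a. 1 / (sqrt 3 * k) + k ^ 3 / (4 * sqrt 3) * a\<^sup>2) \<longlongrightarrow> 1 / (sqrt 3 * k) + k ^ 3 / (4 * sqrt 3) * 0\<^sup>2) (at 0)"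
      by (intro tendsto_intros)
    ultimately have "((\<lambda>a. ?f a + (1 / (sqrt 3 * k) + k ^ 3 / (4 * sqrt 3) * a\<^sup>2)) \<longlongrightarrow> 0 + (1 / (sqrt 3 * k) + k ^ 3 / (4 * sqrt 3) * 0\<^sup>2)) (at 0)"
      by (rule tendsto_add)
    then show ?thesis by (simp add: c0_def)
  qed
  then have "\<forall>\<^sub>F a in at 0. c a k > c0 / 2" using c0 by (intro order_tendstoD(1)) auto
  moreover have "\<forall>\<^sub>F a in at 0. (\<forall>z. \<bar>\<eta> a k z\<bar> \<le> c0\<^sup>2 / 8) \<and> \<eta> a k 0 \<noteq> 0"
    by (rule small_wave_profile[OF assms(1) M]) (use c0 in simp)
  moreover have "\<forall>\<^sub>F a in at 0. \<bar>a\<bar> < A k"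
    using Ak eventually_at[of "\<lambda>a::real. \<bar>a\<bar> < A k" 0 UNIV] by (auto simp: dist_norm)
  ultimately have "\<forall>\<^sub>F a in at 0. modulationally_stable k (\<eta> a k) (c a k)"
  proof eventually_elim
    case (elim a)
    have "(c0 / 2)\<^sup>2 < (c a k)\<^sup>2" using elim(1) c0 by (intro power_strict_mono) auto
    moreover have "c0\<^sup>2 / 8 < (c0 / 2)\<^sup>2" using c0 by (simp add: power_divide)
    ultimately have m: "c0\<^sup>2 / 8 < (c a k)\<^sup>2" by simp
    interpret traveling_wave "\<eta> a k" "c a k" k "c0\<^sup>2 / 8"
      by unfold_locales (use assms(1) elim m Ak in \<open>auto intro: periodic_fun_simple.plus_period\<close>)
    show ?case by (rule wave_modulationally_stable)
  qed
  then obtain a0 where "a0 > 0" "\<And>a. a \<noteq> 0 \<Longrightarrow> dist a 0 < a0 \<Longrightarrow> modulationally_stable k (\<eta> a k) (c a k)"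
    by (auto simp: eventually_at)
  then show ?thesis by (intro exI[of _ a0]) (auto simp: dist_norm)
qed

end
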